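(* There exist $a>0$ and an orthonormal basis $\nu_1,\dots,\nu_N$ of $\mathbb{R}^N$ such that, setting for $k>0$ $$\Omega_k=\{x\in\mathbb{R}^N:\ |\langle x,\nu_1\rangle|<a,\ |\langle x,\nu_i\rangle|<k\ \text{for } i=2,\dots,N\},$$ (so that $\Omega_k$ approaches the infinite slab $\{|\langle x,\nu_1\rangle|<a\}$ as $k\to+\infty$), equality is attained in the limit $k\to+\infty$ along $\Omega=\Omega_k$ in each of the following inequalities, valid for bounded convex open sets $\Omega$: (i) $\dfrac{1}{R_F(\Omega)}\le h_F(\Omega)$; (ii) $\lambda_F(p,\Omega)\le\left(\dfrac{\pi_p}{2}\right)^p\left(\dfrac{P_F(\Omega)}{|\Omega|}\right)^p$; (iii) $\lambda_F(p,\Omega)\le\left(\dfrac{\pi_p}{2}\right)^p h_F(\Omega)^p$; (iv) $\lambda_F(p,\Omega)\ge\left(\dfrac{\pi_p}{2}\right)^p\dfrac{1}{R_F(\Omega)^p}$; (v) $\left(\dfrac{p-1}{p}\right)^{p-1}\left(\dfrac{\pi_p}{2}\right)^p\le\lambda_F(p,\Omega)M_{v_\Omega}^{p-1}$; (vi) $M_{v_\Omega}\le\dfrac{R_F(\Omega)^q}{q}$, where $q=\frac{p}{p-1}$; that is, in each of (i)–(vi) the ratio of the two sides, evaluated at $\Omega=\Omega_k$, tends to $1$ as $k\to+\infty$.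
   Context: Let $N\ge2$, $1<p<+\infty$, and let $F:\mathbb{R}^N\to[0,+\infty)$ be a convex function with $F(t\xi)=|t|F(\xi)$ for all $t\in\mathbb R$, $\xi\in\mathbb{R}^N$, with $a_0|\xi|\le F(\xi)$ for some constant $a_0>0$, with $F\in C^{3,\beta}(\mathbb{R}^N\setminus\{0\})$, and such that the Hessian $[F^p]_{\xi\xi}(\xi)$ is positive definite for every $\xi\neq0$. The polar function is $F^o(v)=\sup_{\xi\ne0}\frac{\langle\xi,v\rangle}{F(\xi)}$. First Dirichlet eigenvalue of the anisotropic $p$-Laplacian: $\lambda_F(p,\Omega)=\min_{\varphi\in W_0^{1,p}(\Omega)\setminus\{0\}}\frac{\int_\Omega F^p(\nabla\varphi)\,dx}{\int_\Omega|\varphi|^p\,dx}$. The torsion function $v_\Omega\in W_0^{1,p}(\Omega)$ is the unique (weak) solution, positive in $\Omega$, of $-\operatorname{div}\left(F^{p-1}(\nabla v)F_\xi(\nabla v)\right)=1$ in $\Omega$, $v=0$ on $\partial\Omega$; $M_{v_\Omega}$ denotes its maximum. Anisotropic inradius: $d_F(x)=\inf_{y\in\partial\Omega}F^o(x-y)$ for $x\in\overline\Omega$, and $R_F(\Omega)=\sup_{x\in\Omega}d_F(x)$. Anisotropic perimeter: $P_F(K)=\sup\left\{\int_K\operatorname{div}\sigma\,dx:\ \sigma\in C_0^1(\mathbb{R}^N;\mathbb{R}^N),\ F^o(\sigma)\le1\right\}$; equivalently, for sets of finite perimeter, $P_F(K)=\int_{\partial^*K}F(n_{\mathcal E})\,d\mathcal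 H^{N-1}$ with $\partial^*K$ the reduced boundary and $n_{\mathcal E}$ the Euclidean unit outer normal. Anisotropic Cheeger constant: $h_F(\Omega)=\inf_{K\subset\Omega}\frac{P_F(K)}{|K|}$ (over measurable $K$ with $|K|>0$). $\pi_p:=2\int_0^{(p-1)^{1/p}}\frac{dt}{[1-t^p/(p-1)]^{1/p}}=2\pi\frac{(p-1)^{1/p}}{p\sin(\pi/p)}$. *)

theory Defs
  imports "HOL-Analysis.Analysis" "HOL-Probability.Essential_Supremum"
begin

text \<open>The Euclidean space of dimension N is an arbitrary type \<open>'a\<close> of class
  \<^class>\<open>euclidean_space\<close> with \<open>N = DIM('a)\<close>.\<close>

section \<open>Differential calculus\<close>

text \<open>Continuity of the derivatives of order below \<open>k\<close> follows from their differentiability.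
  The derivatives are two-sided, so these notions are meant for open \<open>S\<close>.\<close>

primrec Ck_on :: "nat \<Rightarrow> ('a::euclidean_space \<Rightarrow> 'b::real_normed_vector) \<Rightarrow> 'a set \<Rightarrow> bool" where
  "Ck_on 0 f S \<longleftrightarrow> continuous_on S f"
| "Ck_on (Suc k) f S \<longleftrightarrow>
     f differentiable_on S \<and> (\<forall>b\<in>Basis. Ck_on k (\<lambda>x. frechet_derivative f (at x) b) S)"

definition holder_on :: "real \<Rightarrow> ('a::metric_space \<Rightarrow> 'b::real_normed_vector) \<Rightarrow> 'a set \<Rightarrow> bool" where
  "holder_on \<beta> f S \<longleftrightarrow> (\<exists>C. \<forall>x\<in>S. \<forall>y\<in>S. norm (f x - f y) \<le> C * dist x y powr \<beta>)"

text \<open>The class \<open>C\<^sup>k\<^sup>,\<^sup>\<beta>(S)\<close> in its local sense: the derivatives of order \<open>k\<close> are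
  \<open>\<beta>\<close>-Hoelder continuous on every compact subset of \<open>S\<close>. (For \<open>S = - {0}\<close> and a
  1-homogeneous function this is the only possible reading, as third derivatives are
  homogeneous of degree -2.)\<close>

primrec Ck_holder_on ::
  "nat \<Rightarrow> real \<Rightarrow> ('a::euclidean_space \<Rightarrow> 'b::real_normed_vector) \<Rightarrow> 'a set \<Rightarrow> bool" where
  "Ck_holder_on 0 \<beta> f S \<longleftrightarrow> (\<forall>K. compact K \<and> K \<subseteq> S \<longrightarrow> holder_on \<beta> f K)"
| "Ck_holder_on (Suc k) \<beta> f S \<longleftrightarrow>
     f differentiable_on S \<and> (\<forall>b\<in>Basis. Ck_holder_on k \<beta> (\<lambda>x. frechet_derivative f (at x) b) S)"

definition gradient :: "('a::euclidean_space \<Rightarrow> real) \<Rightarrow> 'a \<Rightarrow> 'a" where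
  "gradient f x = (\<Sum>b\<in>Basis. frechet_derivative f (at x) b *\<^sub>R b)"

definition divergence :: "('a::euclidean_space \<Rightarrow> 'a) \<Rightarrow> 'a \<Rightarrow> real" where
  "divergence \<sigma> x = (\<Sum>b\<in>Basis. frechet_derivative \<sigma> (at x) b \<bullet> b)"

definition hessian :: "('a::euclidean_space \<Rightarrow> real) \<Rightarrow> 'a \<Rightarrow> 'a \<Rightarrow> 'a \<Rightarrow> real" where
  "hessian f x h k = frechet_derivative (\<lambda>y. frechet_derivative f (at y) h) (at x) k"

definition support :: "('a::topological_space \<Rightarrow> 'b::zero) \<Rightarrow> 'a set" where
  "support f = closure {x. f x \<noteq> 0}"

definition test_functions :: "'a::euclidean_space set \<Rightarrow> ('a \<Rightarrow> real) set" where
  "test_functions \<Omega> =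
     {\<phi>. (\<forall>k. Ck_on k \<phi> UNIV) \<and> compact (support \<phi>) \<and> support \<phi> \<subseteq> \<Omega>}"


section \<open>Sobolev spaces\<close>

text \<open>Elements of Sobolev spaces are represented by functions on the whole space, of which only
  the restriction to \<open>\<Omega>\<close> (up to null sets) matters. The predicates relate such a
  representative \<open>u\<close> to a representative \<open>g\<close> of its weak gradient.\<close>

definition sobolev :: "real \<Rightarrow> 'a::euclidean_space set \<Rightarrow> ('a \<Rightarrow> real) \<Rightarrow> ('a \<Rightarrow> 'a) \<Rightarrow> bool" where
  "sobolev p \<Omega> u g \<longleftrightarrow>
     u \<in> borel_measurable (lebesgue_on \<Omega>) \<and> integrable (lebesgue_on \<Omega>) (\<lambda>x. \<bar>u x\<bar> powr p) \<and>
     g \<in> borel_measurable (lebesgue_on \<Omega>) \<and> integrable (lebesgue_on \<Omega>) (\<lambda>x. norm (g x) powr p) \<and>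
     (\<forall>\<phi>\<in>test_functions \<Omega>. \<forall>b\<in>Basis.
        (LINT x|lebesgue_on \<Omega>. u x * frechet_derivative \<phi> (at x) b) =
        - (LINT x|lebesgue_on \<Omega>. (g x \<bullet> b) * \<phi> x))"

definition sobolev0 :: "real \<Rightarrow> 'a::euclidean_space set \<Rightarrow> ('a \<Rightarrow> real) \<Rightarrow> ('a \<Rightarrow> 'a) \<Rightarrow> bool" where
  "sobolev0 p \<Omega> u g \<longleftrightarrow> sobolev p \<Omega> u g \<and>
     (\<exists>\<phi>. (\<forall>n::nat. \<phi> n \<in> test_functions \<Omega>) \<and>
        (\<lambda>n. (LINT x|lebesgue_on \<Omega>. \<bar>\<phi> n x - u x\<bar> powr p) +
             (LINT x|lebesgue_on \<Omega>. norm (gradient (\<phi> n) x - g x) powr p)) \<longlonglongrightarrow> 0)"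


section \<open>Anisotropic quantities\<close>

definition polar :: "('a::euclidean_space \<Rightarrow> real) \<Rightarrow> 'a \<Rightarrow> real" where
  "polar F v = (SUP \<xi>\<in>-{0}. (\<xi> \<bullet> v) / F \<xi>)"

definition eigenvalue :: "('a::euclidean_space \<Rightarrow> real) \<Rightarrow> real \<Rightarrow> 'a set \<Rightarrow> real" where
  "eigenvalue F p \<Omega> =
     Inf {(LINT x|lebesgue_on \<Omega>. F (g x) powr p) / (LINT x|lebesgue_on \<Omega>. \<bar>u x\<bar> powr p) | u g.
            sobolev0 p \<Omega> u g \<and> \<not> (AE x in lebesgue_on \<Omega>. u x = 0)}"

text \<open>Where the gradient \<open>g\<close> vanishes, \<open>F\<close> is not differentiable, but there
  \<open>F (g x) powr (p - 1) = 0\<close>; this is the usual convention that the field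
  \<open>F\<^sup>p\<^sup>-\<^sup>1 F\<^sub>\<xi>\<close>, the gradient of \<open>F\<^sup>p/p\<close>, is zero at the origin.\<close>

definition torsion_function ::
  "('a::euclidean_space \<Rightarrow> real) \<Rightarrow> real \<Rightarrow> 'a set \<Rightarrow> ('a \<Rightarrow> real) \<Rightarrow> bool" where
  "torsion_function F p \<Omega> v \<longleftrightarrow> (AE x in lebesgue_on \<Omega>. 0 < v x) \<and>
     (\<exists>g. sobolev0 p \<Omega> v g \<and>
        (\<forall>\<phi>\<in>test_functions \<Omega>.
           (LINT x|lebesgue_on \<Omega>.
              F (g x) powr (p - 1) * (gradient F (g x) \<bullet> gradient \<phi> x)) =
           (LINT x|lebesgue_on \<Omega>. \<phi> x)))"

text \<open>The maximum of an element of a Sobolev space is taken modulo null sets; for the continuous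
  representative this is the pointwise maximum over the closure of \<open>\<Omega>\<close>.\<close>

definition maximum_on :: "'a::euclidean_space set \<Rightarrow> ('a \<Rightarrow> real) \<Rightarrow> real" where
  "maximum_on \<Omega> v = real_of_ereal (esssup (lebesgue_on \<Omega>) (\<lambda>x. ereal (v x)))"

definition boundary_distance ::
  "('a::euclidean_space \<Rightarrow> real) \<Rightarrow> 'a set \<Rightarrow> 'a \<Rightarrow> real" where
  "boundary_distance F \<Omega> x = (INF y\<in>frontier \<Omega>. polar F (x - y))"

definition inradius :: "('a::euclidean_space \<Rightarrow> real) \<Rightarrow> 'a set \<Rightarrow> real" where
  "inradius F \<Omega> = (SUP x\<in>\<Omega>. boundary_distance F \<Omega> x)"

definition perimeter :: "('a::euclidean_space \<Rightarrow> real) \<Rightarrow> 'a set \<Rightarrow> ereal" where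
  "perimeter F K =
     (SUP \<sigma>\<in>{\<sigma>. Ck_on 1 \<sigma> UNIV \<and> compact (support \<sigma>) \<and> (\<forall>x. polar F (\<sigma> x) \<le> 1)}.
        ereal (LINT x|lebesgue_on K. divergence \<sigma> x))"

definition cheeger :: "('a::euclidean_space \<Rightarrow> real) \<Rightarrow> 'a set \<Rightarrow> ereal" where
  "cheeger F \<Omega> =
     (INF K\<in>{K. K \<in> sets lebesgue \<and> K \<subseteq> \<Omega> \<and> 0 < measure lebesgue K}.
        perimeter F K / ereal (measure lebesgue K))"

definition pi_p :: "real \<Rightarrow> real" where
  "pi_p p = 2 * integral {0..(p - 1) powr (1 / p)}
                  (\<lambda>t. 1 / (1 - t powr p / (p - 1)) powr (1 / p))"


section \<open>Boxes approaching a slab\<close>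

definition orthonormal_basis :: "(nat \<Rightarrow> 'a::euclidean_space) \<Rightarrow> bool" where
  "orthonormal_basis \<nu> \<longleftrightarrow>
     (\<forall>i\<in>{1..DIM('a)}. \<forall>j\<in>{1..DIM('a)}. \<nu> i \<bullet> \<nu> j = (if i = j then 1 else 0)) \<and>
     span (\<nu> ` {1..DIM('a)}) = UNIV"

definition slab_box :: "(nat \<Rightarrow> 'a::euclidean_space) \<Rightarrow> real \<Rightarrow> real \<Rightarrow> 'a set" where
  "slab_box \<nu> a k = {x. \<bar>x \<bullet> \<nu> 1\<bar> < a \<and> (\<forall>i\<in>{2..DIM('a)}. \<bar>x \<bullet> \<nu> i\<bar> < k)}"

end

theory Submission
  imports Defs "HOL-Real_Asymp.Real_Asymp"
begin

text \<open>
  Let \<open>e\<close> be a basis vector, \<open>c = F e\<close> and \<open>w = gradient F e\<close>. Convexity and homogeneity give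
  \<open>\<bar>w \<bullet> \<xi>\<bar> \<le> F \<xi>\<close> with equality at \<open>\<xi> = e\<close>. In the coordinate \<open>ht x = (x \<bullet> e) / c\<close> the slab
  \<open>\<bar>x \<bullet> e\<bar> < c\<close> becomes \<open>\<bar>ht x\<bar> < 1\<close>, and \<open>F (\<nabla>(f \<circ> ht)) = \<bar>f' \<circ> ht\<bar>\<close>, so every quantity is compared with
  its one-dimensional counterpart on \<open>(-1, 1)\<close>, for which the inradius is \<open>1\<close>.

  One half of each comparison is an integration by parts against a field \<open>(m \<circ> ht) w\<close>, using only
  \<open>\<bar>w \<bullet> \<xi>\<bar> \<le> F \<xi>\<close>: the identity \<open>m t = t\<close> calibrates the Cheeger constant, a solution of the Riccati
  equation \<open>m' = - (\<lambda> + (p - 1) \<bar>m\<bar>\<^sup>q)\<close> bounds the eigenvalue from below, and \<open>m t = - t\<close>, the field of the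
  torsion function \<open>(1 - \<bar>t\<bar>\<^sup>q) / q\<close>, bounds the torsion function from above. The other half tests with
  smooth approximations of the one-dimensional extremals, cut off in the remaining directions at scale
  \<open>k\<close>, which costs \<open>O(1 / k)\<close>. For the maximum of the torsion function this gives, by Young's inequality
  with the perturbed field \<open>m t = - t + \<theta> \<Psi> t\<close>, a bound whose derivative at \<open>\<theta> = 0\<close> is the required one
  as \<open>\<Psi>\<close> tends to the sign function.
\<close>

section \<open>Smooth functions and cutoffs\<close>

text \<open>The slab normal is a coordinate vector, so the boxes are products and integrals of a
  function of \<open>ht\<close> times a transversal cutoff factorise. Half-width \<open>F e\<close>
  puts the two faces at polar distance exactly 1 from the central hyperplane. The direction
  \<open>w\<close> is in general oblique to \<open>e\<close>: transversal cutoffs vary along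
  \<open>w\<close>, and this is one source of the \<open>O(1 / k)\<close> errors.

  The Riccati field is infinite on the faces, which is harmless against compactly supported
  functions; the eigenvalue bound is therefore proved for test functions and extended by density.

  The main obstacle is the maximum of the torsion function, because a weak solution supplies
  integral identities and no pointwise values. For m t = - t the energies of the slab balance
  exactly and v drops out of the identity, since m' + 1 = 0. Perturbing m brings v back with the
  weight m' + 1 \<ge> 0, of mass at most 2 \<theta>. There v may be replaced by its maximum, and
  comparing the terms of first order in \<theta> isolates that maximum.\<close>

definition smooth :: "('a::euclidean_space \<Rightarrow> 'b::real_normed_vector) \<Rightarrow> bool" where
  "smooth f \<longleftrightarrow> (\<forall>k. Ck_on k f UNIV)"

lemma smoothI:
  assumes "\<And>x. (f has_derivative f' x) (at x)" and "\<And>b. b \<in> Basis \<Longrightarrow> smooth (\<lambda>x. f' x b)"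
  shows "smooth f"
proof -
  have eq: "frechet_derivative f (at x) = f' x" for x
    using assms(1) frechet_derivative_at by metis
  have diff: "f differentiable_on UNIV"
    using assms(1) by (meson differentiable_on_def differentiable_at_withinI differentiableI)
  have "Ck_on k f UNIV" for k
    using assms(2) diff by (cases k) (auto simp: eq smooth_def differentiable_imp_continuous_on)
  then show ?thesis
    by (simp add: smooth_def)
qed

lemma smooth_differentiable: "smooth f \<Longrightarrow> f differentiable (at x)"
  unfolding smooth_def by (metis Ck_on.simps(2) UNIV_I differentiable_on_def)

lemma smooth_has_derivative: "smooth f \<Longrightarrow> (f has_derivative frechet_derivative f (at x)) (at x)"
  using frechet_derivative_works smooth_differentiable by blast

lemma smooth_frechet_derivative:
  "smooth f \<Longrightarrow> b \<in> Basis \<Longrightarrow> smooth (\<lambda>x. frechet_derivative f (at x) b)"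
  unfolding smooth_def by (metis Ck_on.simps(2))

lemma smooth_continuous: "smooth f \<Longrightarrow> continuous_on S f"
  unfolding smooth_def by (metis Ck_on.simps(1) continuous_on_subset top_greatest)

lemma Ck_on_SucD: "Ck_on (Suc k) f S \<Longrightarrow> Ck_on k f S"
  by (induction k arbitrary: f) (auto simp: differentiable_imp_continuous_on)

lemma Ck_on_add:
  "Ck_on k f UNIV \<Longrightarrow> Ck_on k g UNIV \<Longrightarrow> Ck_on k (\<lambda>x. f x + g x) UNIV"
proof (induction k arbitrary: f g)
  case (Suc k)
  have d: "f differentiable (at x)" "g differentiable (at x)" for x
    using Suc.prems by (auto simp: differentiable_on_def)
  have "((\<lambda>x. f x + g x) has_derivative (\<lambda>h. frechet_derivative f (at x) h + frechet_derivative g (at x) h)) (at x)" for x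
    using d by (auto intro!: has_derivative_add simp flip: frechet_derivative_works)
  then have "frechet_derivative (\<lambda>x. f x + g x) (at x) =
      (\<lambda>h. frechet_derivative f (at x) h + frechet_derivative g (at x) h)" for x
    by (rule frechet_derivative_at[symmetric])
  then show ?case
    using Suc by (auto simp: differentiable_on_def intro!: differentiable_add)
qed (auto intro: continuous_on_add continuous_on_mult continuous_on_scaleR continuous_on_const)

text \<open>In the product rule each term pairs an undifferentiated factor of full order with a
  derivative of the other factor. The induction hypothesis applies once the order of the former has
  been lowered by \<open>Ck_on_SucD\<close>.\<close>

lemma Ck_on_mult:
  fixes f g :: "'a::euclidean_space \<Rightarrow> real"
  shows "Ck_on k f UNIV \<Longrightarrow> Ck_on k g UNIV \<Longrightarrow> Ck_on k (\<lambda>x. f x * g x) UNIV"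
proof (induction k arbitrary: f g)
  case (Suc k)
  have d: "f differentiable (at x)" "g differentiable (at x)" for x
    using Suc.prems by (auto simp: differentiable_on_def)
  have "((\<lambda>x. f x * g x) has_derivative (\<lambda>h. f x * frechet_derivative g (at x) h + frechet_derivative f (at x) h * g x)) (at x)" for x
    using d by (intro has_derivative_mult) (simp_all flip: frechet_derivative_works)
  then have "frechet_derivative (\<lambda>x. f x * g x) (at x) =
      (\<lambda>h. f x * frechet_derivative g (at x) h + frechet_derivative f (at x) h * g x)" for x
    by (rule frechet_derivative_at[symmetric])
  then show ?case
    using Suc.prems d
    by (auto simp: differentiable_on_def simp del: Ck_on.simps(1) intro!: differentiable_mult Ck_on_add
        Suc.IH[OF Ck_on_SucD[OF Suc.prems(1)]] Suc.IH[OF _ Ck_on_SucD[OF Suc.prems(2)]])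
qed (auto intro: continuous_on_add continuous_on_mult continuous_on_scaleR continuous_on_const)

lemma Ck_on_scaleR_left:
  fixes f :: "'a::euclidean_space \<Rightarrow> real"
  shows "Ck_on k f UNIV \<Longrightarrow> Ck_on k (\<lambda>x. f x *\<^sub>R v) UNIV"
proof (induction k arbitrary: f)
  case (Suc k)
  have d: "f differentiable (at x)" for x
    using Suc.prems by (auto simp: differentiable_on_def)
  have D: "((\<lambda>x. f x *\<^sub>R v) has_derivative (\<lambda>h. frechet_derivative f (at x) h *\<^sub>R v)) (at x)" for x
    using d by (auto intro!: derivative_eq_intros simp flip: frechet_derivative_works)
  then have "frechet_derivative (\<lambda>x. f x *\<^sub>R v) (at x) = (\<lambda>h. frechet_derivative f (at x) h *\<^sub>R v)" for x
    by (rule frechet_derivative_at[symmetric])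
  then show ?case
    using Suc D by (auto simp: differentiable_on_def differentiable_def)
qed (auto intro: continuous_on_add continuous_on_mult continuous_on_scaleR continuous_on_const)

lemma smooth_const [simp]: "smooth (\<lambda>x. c)"
proof -
  have "Ck_on k (\<lambda>x::'a. c) UNIV" for k and c :: 'b
    by (induction k arbitrary: c) auto
  then show ?thesis
    by (simp add: smooth_def)
qed

lemma smooth_add: "smooth f \<Longrightarrow> smooth g \<Longrightarrow> smooth (\<lambda>x. f x + g x)"
  using Ck_on_add[of _ f g] by (simp add: smooth_def)

lemma smooth_mult:
  fixes f g :: "'a::euclidean_space \<Rightarrow> real"
  shows "smooth f \<Longrightarrow> smooth g \<Longrightarrow> smooth (\<lambda>x. f x * g x)"
  using Ck_on_mult[of _ f g] by (simp add: smooth_def)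

lemma smooth_diff:
  fixes f g :: "'a::euclidean_space \<Rightarrow> real"
  shows "smooth f \<Longrightarrow> smooth g \<Longrightarrow> smooth (\<lambda>x. f x - g x)"
  using smooth_add[OF _ smooth_mult[OF smooth_const[of "-1"]], of f g] by simp

lemma smooth_prod:
  fixes f :: "'i \<Rightarrow> 'a::euclidean_space \<Rightarrow> real"
  shows "(\<And>i. i \<in> I \<Longrightarrow> smooth (f i)) \<Longrightarrow> smooth (\<lambda>x. \<Prod>i\<in>I. f i x)"
  by (induction I rule: infinite_finite_induct) (auto intro: smooth_mult)

lemma smooth_bounded_linear: "bounded_linear f \<Longrightarrow> smooth f"
  by (rule smoothI[where f' = "\<lambda>x. f"]) (auto simp: bounded_linear_imp_has_derivative)

lemma smooth_inner: "smooth (\<lambda>x. x \<bullet> b)"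
  by (simp add: bounded_linear_inner_left smooth_bounded_linear)

lemma smooth_realI:
  fixes h :: "real \<Rightarrow> real"
  assumes "\<And>t. (h has_real_derivative h' t) (at t)" "smooth h'"
  shows "smooth h"
  by (rule smoothI[where f' = "\<lambda>t. (*) (h' t)"])
     (use assms in \<open>auto simp: has_field_derivative_def\<close>)

lemma smooth_realD:
  fixes h :: "real \<Rightarrow> real"
  assumes "smooth h"
  shows "(h has_real_derivative deriv h t) (at t)" "smooth (deriv h)"
proof -
  show D: "(h has_real_derivative deriv h t) (at t)" for t
    using smooth_differentiable[OF assms, of t] DERIV_deriv_iff_real_differentiable by blast
  have "deriv h = (\<lambda>t. frechet_derivative h (at t) 1)"
    using frechet_derivative_at[OF D[unfolded has_field_derivative_def]] by (metis mult.right_neutral)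
  then show "smooth (deriv h)"
    using smooth_frechet_derivative[OF assms, of 1] by simp
qed

text \<open>The chain rule produces \<open>deriv h\<close> composed with \<open>f\<close>, so the
  induction on the order keeps \<open>h\<close> arbitrary; the class of smooth \<open>h\<close> is
  closed under \<open>deriv\<close>.\<close>

lemma Ck_on_compose:
  fixes f :: "'a::euclidean_space \<Rightarrow> real" and h :: "real \<Rightarrow> real"
  shows "smooth h \<Longrightarrow> Ck_on k f UNIV \<Longrightarrow> Ck_on k (\<lambda>x. h (f x)) UNIV"
proof (induction k arbitrary: h)
  case 0
  then show ?case
    by (auto intro: continuous_on_compose2[OF smooth_continuous])
next
  case (Suc k)
  have D: "((\<lambda>x. h (f x)) has_derivative (\<lambda>v. deriv h (f x) * frechet_derivative f (at x) v)) (at x)" for x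
  proof -
    have "(f has_derivative frechet_derivative f (at x)) (at x)"
      using Suc.prems by (auto simp: differentiable_on_def simp flip: frechet_derivative_works)
    from has_derivative_compose[OF this smooth_realD(1)[OF Suc.prems(1), unfolded has_field_derivative_def]]
    show ?thesis .
  qed
  then have "frechet_derivative (\<lambda>x. h (f x)) (at x) = (\<lambda>v. deriv h (f x) * frechet_derivative f (at x) v)" for x
    by (rule frechet_derivative_at[symmetric])
  then show ?case
    using Suc.prems D Suc.IH[OF smooth_realD(2)[OF Suc.prems(1)] Ck_on_SucD]
    by (auto simp: differentiable_on_def differentiable_def intro!: Ck_on_mult)
qed

lemma smooth_compose:
  fixes f :: "'a::euclidean_space \<Rightarrow> real" and h :: "real \<Rightarrow> real"
  shows "smooth h \<Longrightarrow> smooth f \<Longrightarrow> smooth (\<lambda>x. h (f x))"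
  using Ck_on_compose[of h _ f] by (simp add: smooth_def)

lemma smooth_ident: "smooth (\<lambda>t::real. t)"
  using smooth_inner[of "1::real"] by simp

lemma smooth_antiderivative:
  fixes f :: "real \<Rightarrow> real"
  assumes "smooth f"
  obtains F where "smooth F" "\<And>t. (F has_real_derivative f t) (at t)"
proof -
  have "isCont f t" for t
    using smooth_continuous[OF assms, of UNIV] by (simp add: continuous_on_eq_continuous_at)
  then obtain F where "\<And>t. (F has_vector_derivative f t) (at t)"
    using einterval_antiderivative[of "-\<infinity>" "\<infinity>" f] by auto
  then have "\<And>t. (F has_real_derivative f t) (at t)"
    by (simp add: has_real_derivative_iff_has_vector_derivative)
  then show ?thesis
    using that[of F] smooth_realI[of F f] assms by blast
qed

lemma smooth_real_polynomial_function:
  "real_polynomial_function (f :: 'a::euclidean_space \<Rightarrow> real) \<Longrightarrow> smooth f"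
  by (induction rule: real_polynomial_function.induct) (auto intro: smooth_bounded_linear smooth_add smooth_mult)

section \<open>Flat functions and smooth cutoffs\<close>

text \<open>For \<open>n = 0\<close> this is the classical flat function exp(-1/t). The powers of t
  in the denominator close the family under differentiation, up to linear combinations, so that
  smoothness of all members is a single induction.\<close>

definition flat :: "nat \<Rightarrow> real \<Rightarrow> real" where
  "flat n t = (if t \<le> 0 then 0 else exp (- (1 / t)) / t ^ n)"

lemma flat_tendsto_0: "(flat n \<longlongrightarrow> 0) (at 0)"
proof -
  have "((\<lambda>t. (1 / t) ^ n / exp (1 / t)) \<longlongrightarrow> (0::real)) (at_right 0)"
    by (rule filterlim_compose[OF tendsto_power_div_exp_0])
       (simp add: filterlim_inverse_at_top_right flip: inverse_eq_divide)
  then have R: "(flat n \<longlongrightarrow> 0) (at_right 0)"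
    by (rule Lim_transform_eventually)
       (auto simp: eventually_at_filter flat_def exp_minus power_one_over field_simps intro!: always_eventually)
  have L: "(flat n \<longlongrightarrow> 0) (at_left 0)"
    by (rule tendsto_eventually) (auto simp: eventually_at_filter flat_def)
  show ?thesis
    using L R filterlim_split_at by blast
qed

lemma flat_has_derivative:
  "(flat n has_real_derivative - real n * flat (Suc n) t + flat (Suc (Suc n)) t) (at t)"
proof -
  consider "t < 0" | "t = 0" | "t > 0" by linarith
  then show ?thesis
  proof cases
    case 1
    have "((\<lambda>t. 0) has_real_derivative 0) (at t)"
      by simp
    then have "(flat n has_real_derivative 0) (at t)"
      by (rule DERIV_cong_ev[THEN iffD1, rotated -1])
         (use 1 eventually_nhds_in_open[of "{..<0}" t] in \<open>auto elim!: eventually_mono simp: flat_def\<close>)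
    then show ?thesis
      using 1 by (simp add: flat_def)
  next
    case 2
    \<comment> \<open>At 0 the difference quotient of \<open>flat n\<close> is
      \<open>flat (Suc n)\<close> itself, which tends to 0.\<close>
    have "((\<lambda>h. (flat n (0 + h) - flat n 0) / h) \<longlongrightarrow> 0) (at 0)"
      by (rule Lim_transform_eventually[OF flat_tendsto_0[of "Suc n"]])
         (auto simp: flat_def eventually_at_filter)
    then show ?thesis
      using 2 by (simp add: DERIV_def flat_def)
  next
    case 3
    have "((\<lambda>t. exp (- (1 / t)) / t ^ n) has_real_derivative
        - real n * flat (Suc n) t + flat (Suc (Suc n)) t) (at t)"
    proof -
      have P: "((\<lambda>t. t ^ n) has_real_derivative real n * t ^ n / t) (at t)"
        by (rule DERIV_cong[OF DERIV_pow]) (use 3 in \<open>cases n; simp\<close>)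
      have E: "((\<lambda>t. exp (- (1 / t))) has_real_derivative exp (- (1 / t)) / t ^ 2) (at t)"
        using 3 by (auto intro!: derivative_eq_intros simp: power2_eq_square)
      show ?thesis
        by (rule DERIV_cong[OF DERIV_divide[OF E P]])
           (use 3 in \<open>auto simp: flat_def field_simps power2_eq_square\<close>)
    qed
    then show ?thesis
      by (rule DERIV_cong_ev[THEN iffD1, rotated -1])
         (use 3 eventually_nhds_in_open[of "{0<..}" t] in \<open>auto elim!: eventually_mono simp: flat_def\<close>)
  qed
qed

lemma smooth_flat: "smooth (flat n)"
proof -
  have "Ck_on k (flat n) UNIV" for k
  proof (induction k arbitrary: n)
    case 0
    show ?case
      using flat_has_derivative[of n] by (auto intro!: DERIV_continuous_on)
  next
    case (Suc k)
    have eq: "frechet_derivative (flat n) (at t) = (*) (- real n * flat (Suc n) t + flat (Suc (Suc n)) t)" for t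
      using flat_has_derivative[of n t, unfolded has_field_derivative_def] frechet_derivative_at by metis
    have "Ck_on k (\<lambda>t. - real n * flat (Suc n) t + flat (Suc (Suc n)) t) UNIV"
      by (intro Ck_on_add Ck_on_mult Suc.IH) (use smooth_const smooth_def in blast)
    then show ?case
      using flat_has_derivative[of n]
      by (auto simp: eq differentiable_on_def differentiable_def has_field_derivative_def intro!: exI)
  qed
  then show ?thesis
    by (simp add: smooth_def)
qed

text \<open>The bump \<open>B\<close> is positive exactly between \<alpha> and \<beta>. Its
  antiderivative is constant on either side and strictly larger on the right, so an affine
  normalisation gives the step.\<close>

lemma smooth_step:
  fixes \<alpha> \<beta> :: real
  assumes "\<alpha> < \<beta>"
  obtains s :: "real \<Rightarrow> real" where "smooth s" "\<And>t. 0 \<le> s t" "\<And>t. s t \<le> 1"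
    "\<And>t. t \<le> \<alpha> \<Longrightarrow> s t = 0" "\<And>t. \<beta> \<le> t \<Longrightarrow> s t = 1"
proof -
  define B where "B = (\<lambda>t. flat 0 (t - \<alpha>) * flat 0 (\<beta> - t))"
  have "smooth B"
    unfolding B_def
    by (rule smooth_mult[OF smooth_compose[OF smooth_flat smooth_diff[OF smooth_ident smooth_const]]
          smooth_compose[OF smooth_flat smooth_diff[OF smooth_const smooth_ident]]])
  then obtain F where F: "smooth F" "\<And>t. (F has_real_derivative B t) (at t)"
    using smooth_antiderivative by blast
  have B: "0 \<le> B t" "t \<le> \<alpha> \<Longrightarrow> B t = 0" "\<beta> \<le> t \<Longrightarrow> B t = 0" for t
    by (auto simp: B_def flat_def)
  have Bpos: "\<alpha> < t \<Longrightarrow> t < \<beta> \<Longrightarrow> 0 < B t" for t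
    by (auto simp: B_def flat_def)
  have mono: "F s \<le> F t" if "s \<le> t" for s t
    using that F(2) B(1) by (meson DERIV_nonneg_imp_nondecreasing)
  have cont: "continuous_on S F" for S
    using F(1) by (rule smooth_continuous)
  have "F \<alpha> < F \<beta>"
    by (rule DERIV_pos_imp_increasing_open[OF assms])
       (use F(2) Bpos cont in blast)+
  have low: "F t = F \<alpha>" if "t \<le> \<alpha>" for t
  proof (cases "t = \<alpha>")
    case False
    have "DERIV F x :> 0" if "x < \<alpha>" for x
      using F(2)[of x] B(2)[of x] that by simp
    then show ?thesis
      using DERIV_isconst_end[of t \<alpha> F] that False cont by force
  qed simp
  have high: "F t = F \<beta>" if "\<beta> \<le> t" for t
  proof (cases "t = \<beta>")
    case False
    have "DERIV F x :> 0" if "\<beta> < x" for x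
      using F(2)[of x] B(3)[of x] that by simp
    then show ?thesis
      using DERIV_isconst_end[of \<beta> t F] that False cont by force
  qed simp
  show ?thesis
  proof (rule that[of "\<lambda>t. (1 / (F \<beta> - F \<alpha>)) * (F t - F \<alpha>)"])
    show "smooth (\<lambda>t. (1 / (F \<beta> - F \<alpha>)) * (F t - F \<alpha>))"
      by (intro smooth_mult smooth_diff F smooth_const)
    show "0 \<le> (1 / (F \<beta> - F \<alpha>)) * (F t - F \<alpha>)" for t
    proof -
      have "F \<alpha> \<le> F t"
        using mono[of \<alpha> t] order_refl[of "F \<alpha>"] by (cases "\<alpha> \<le> t") (simp, metis low linear)
      then show ?thesis
        using \<open>F \<alpha> < F \<beta>\<close> by simp
    qed
    show "(1 / (F \<beta> - F \<alpha>)) * (F t - F \<alpha>) \<le> 1" for t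
    proof -
      have "F t \<le> F \<beta>"
        using mono[of t \<beta>] order_refl[of "F \<beta>"] by (cases "t \<le> \<beta>") (simp, metis high linear)
      then show ?thesis
        using \<open>F \<alpha> < F \<beta>\<close> by simp
    qed
    show "(1 / (F \<beta> - F \<alpha>)) * (F t - F \<alpha>) = 0" if "t \<le> \<alpha>" for t
      using low[OF that] by simp
    show "(1 / (F \<beta> - F \<alpha>)) * (F t - F \<alpha>) = 1" if "\<beta> \<le> t" for t
      using high[OF that] \<open>F \<alpha> < F \<beta>\<close> by simp
  qed
qed

text \<open>The product of a descending step and its mirror image.\<close>

lemma smooth_cutoff:
  fixes \<alpha> \<beta> :: real
  assumes "\<alpha> < \<beta>"
  obtains \<zeta> :: "real \<Rightarrow> real" where "smooth \<zeta>" "\<And>t. 0 \<le> \<zeta> t" "\<And>t. \<zeta> t \<le> 1"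
    "\<And>t. \<bar>t\<bar> \<le> \<alpha> \<Longrightarrow> \<zeta> t = 1" "\<And>t. \<beta> \<le> \<bar>t\<bar> \<Longrightarrow> \<zeta> t = 0"
proof -
  obtain s :: "real \<Rightarrow> real" where s: "smooth s" "\<And>t. 0 \<le> s t" "\<And>t. s t \<le> 1"
    "\<And>t. t \<le> \<alpha> \<Longrightarrow> s t = 0" "\<And>t. \<beta> \<le> t \<Longrightarrow> s t = 1"
    by (rule smooth_step[OF assms], (rule that; assumption))
  have "smooth (\<lambda>t. 0 - t :: real)"
    by (intro smooth_diff smooth_ident smooth_const)
  note * = smooth_compose[OF s(1) this]
  show ?thesis
  proof (rule that[of "\<lambda>t. (1 - s t) * (1 - s (0 - t))"])
    show "smooth (\<lambda>t. (1 - s t) * (1 - s (0 - t)))"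
      by (rule smooth_mult[OF smooth_diff[OF smooth_const s(1)] smooth_diff[OF smooth_const *]])
    fix t
    show "0 \<le> (1 - s t) * (1 - s (0 - t))" "(1 - s t) * (1 - s (0 - t)) \<le> 1"
      using s(2,3)[of t] s(2,3)[of "0 - t"] by (auto intro: mult_le_one)
    show "(1 - s t) * (1 - s (0 - t)) = 1" if "\<bar>t\<bar> \<le> \<alpha>"
      using that s(4)[of t] s(4)[of "0 - t"] by simp
    show "(1 - s t) * (1 - s (0 - t)) = 0" if "\<beta> \<le> \<bar>t\<bar>"
    proof (cases "t \<ge> 0")
      case True
      then show ?thesis using that s(5)[of t] by simp
    next
      case False
      then show ?thesis using that s(5)[of "0 - t"] by simp
    qed
  qed
qed

section \<open>Smooth compactly supported approximation in one dimension\<close>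

text \<open>The case t = 0 is where \<open>1 < p\<close> enters: the difference quotient there is
  sgn h |h|^(p-1), which tends to 0.\<close>

lemma has_real_derivative_abs_powr:
  fixes p :: real
  assumes "1 < p"
  shows "((\<lambda>t. \<bar>t\<bar> powr p) has_real_derivative p * (sgn t * \<bar>t\<bar> powr (p - 1))) (at t)"
proof -
  consider "t < 0" | "t = 0" | "t > 0" by linarith
  then show ?thesis
  proof cases
    case 1
    have "((\<lambda>t. (- t) powr p) has_real_derivative p * (sgn t * \<bar>t\<bar> powr (p - 1))) (at t)"
      using 1 by (auto intro!: derivative_eq_intros simp: powr_diff)
    then show ?thesis
      by (rule DERIV_cong_ev[THEN iffD1, rotated -1])
         (use 1 eventually_nhds_in_open[of "{..<0}" t] in \<open>auto elim!: eventually_mono\<close>)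
  next
    case 2
    have "((\<lambda>h. \<bar>h\<bar> powr (p - 1)) \<longlongrightarrow> 0) (at (0::real))"
      by (rule tendsto_zero_powrI) (use assms in \<open>auto intro!: tendsto_eq_intros\<close>)
    then have "((\<lambda>h. \<bar>sgn h * \<bar>h\<bar> powr (p - 1)\<bar>) \<longlongrightarrow> 0) (at (0::real))"
      by (rule Lim_transform_eventually) (auto simp: eventually_at_filter abs_mult)
    then have "((\<lambda>h. sgn h * \<bar>h\<bar> powr (p - 1)) \<longlongrightarrow> 0) (at (0::real))"
      by (simp add: tendsto_rabs_zero_iff)
    then have "((\<lambda>h. (\<bar>0 + h\<bar> powr p - \<bar>0\<bar> powr p) / h) \<longlongrightarrow> 0) (at (0::real))"
      by (rule Lim_transform_eventually)
         (auto simp: eventually_at_filter powr_diff sgn_if)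
    then show ?thesis
      using 2 by (simp add: DERIV_def)
  next
    case 3
    have "((\<lambda>t. t powr p) has_real_derivative p * (sgn t * \<bar>t\<bar> powr (p - 1))) (at t)"
      using 3 by (auto intro!: derivative_eq_intros simp: powr_diff)
    then show ?thesis
      by (rule DERIV_cong_ev[THEN iffD1, rotated -1])
         (use 3 eventually_nhds_in_open[of "{0<..}" t] in \<open>auto elim!: eventually_mono\<close>)
  qed
qed

lemma powr_product_sgn:
  fixes t r :: real
  shows "t * (sgn t * \<bar>t\<bar> powr (r - 1)) = \<bar>t\<bar> powr r"
  by (auto simp: powr_diff sgn_if)

lemma continuous_sgn_abs_powr:
  fixes r :: real
  assumes "0 < r"
  shows "isCont (\<lambda>t::real. sgn t * \<bar>t\<bar> powr r) t"
proof (cases "t = 0")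
  case True
  have "((\<lambda>h. \<bar>h\<bar> powr r) \<longlongrightarrow> 0) (at (0::real))"
    by (rule tendsto_zero_powrI) (use assms in \<open>auto intro!: tendsto_eq_intros\<close>)
  then have "((\<lambda>h. \<bar>sgn h * \<bar>h\<bar> powr r\<bar>) \<longlongrightarrow> 0) (at (0::real))"
    by (rule Lim_transform_eventually) (auto simp: eventually_at_filter abs_mult)
  then show ?thesis
    using True by (simp add: tendsto_rabs_zero_iff isCont_def)
qed (auto intro!: continuous_intros)

lemma continuous_on_sgn_abs_powr:
  fixes r :: real
  assumes "0 < r"
  shows "continuous_on S (\<lambda>t::real. sgn t * \<bar>t\<bar> powr r)"
  by (simp add: assms continuous_at_imp_continuous_on continuous_sgn_abs_powr)

lemma continuous_on_abs_powr [continuous_intros]: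
  fixes f :: "'a::topological_space \<Rightarrow> real" and p :: real
  assumes "continuous_on S f" "0 < p"
  shows "continuous_on S (\<lambda>x. \<bar>f x\<bar> powr p)"
  by (rule continuous_on_powr') (use assms in \<open>auto intro!: continuous_intros\<close>)

text \<open>The derivative is approximated rather than the function: polynomials close to
  \<open>h\<close> are cut off near the endpoints and corrected to mean zero, and then their
  antiderivatives vanish near both endpoints. Uniformly bounded, pointwise convergent derivatives
  are what dominated convergence of the energies requires later.\<close>

lemma smooth_compact_approximation:
  fixes H h :: "real \<Rightarrow> real"
  assumes h: "continuous_on {-1..1} h" and H: "continuous_on {-1..1} H" "H (-1) = 0" "H 1 = 0"
    and DH: "\<And>t. -1 < t \<Longrightarrow> t < 1 \<Longrightarrow> (H has_real_derivative h t) (at t)"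
  obtains f :: "nat \<Rightarrow> real \<Rightarrow> real" and L
  where "\<And>n. smooth (f n)" "\<And>n. \<exists>r<1. \<forall>t. r \<le> \<bar>t\<bar> \<longrightarrow> f n t = 0"
    "\<And>n t. \<bar>deriv (f n) t\<bar> \<le> L"
    "\<And>t. -1 < t \<Longrightarrow> t < 1 \<Longrightarrow> (\<lambda>n. deriv (f n) t) \<longlonglongrightarrow> h t"
    "uniform_limit {-1..1} f H sequentially"
proof -
  define I where "I = {-1<..<1::real}"
  have "bounded (h ` {-1..1})"
    by (intro compact_imp_bounded compact_continuous_image h compact_Icc)
  then obtain B where B: "\<And>t. t \<in> {-1..1} \<Longrightarrow> \<bar>h t\<bar> \<le> B"
    unfolding bounded_iff by fastforce
  have B0: "0 \<le> B"
    using B[of 0] by simp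
  have "\<exists>g. real_polynomial_function g \<and> (\<forall>t\<in>{-1..1}. \<bar>h t - g t\<bar> < 1 / real (Suc n))" for n
    by (rule Stone_Weierstrass_real_polynomial_function) (use h in auto)
  then obtain P where P: "\<And>n. real_polynomial_function (P n)"
    "\<And>n t. t \<in> {-1..1} \<Longrightarrow> \<bar>h t - P n t\<bar> < 1 / real (Suc n)"
    by metis
  have PB: "\<bar>P n t\<bar> \<le> B + 1" if "t \<in> {-1..1}" for n t
  proof -
    have "1 / real (Suc n) \<le> 1" by simp
    then show ?thesis using P(2)[OF that, of n] B[OF that] by linarith
  qed
  \<comment> \<open>The plateau radii 1 - 1/(n+2) increase to 1, so every interior point is
    eventually left uncut, while the support stays within radius 1 - 1/(n+3) < 1.\<close>
  have "\<exists>\<zeta>. smooth \<zeta> \<and> (\<forall>t. 0 \<le> \<zeta> t) \<and> (\<forall>t. \<zeta> t \<le> 1) \<and> (\<forall>t. \<bar>t\<bar> \<le> 1 - 1 / real (n + 2) \<longrightarrow> \<zeta> t = 1) \<and>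
      (\<forall>t. 1 - 1 / real (n + 3) \<le> \<bar>t\<bar> \<longrightarrow> \<zeta> t = (0::real))" for n
  proof -
    have "1 - 1 / real (n + 2) < 1 - 1 / real (n + 3)"
      by (simp add: frac_less2)
    from smooth_cutoff[OF this] show ?thesis
      by metis
  qed
  then obtain \<zeta> :: "nat \<Rightarrow> real \<Rightarrow> real" where \<zeta>: "\<And>n. smooth (\<zeta> n)" "\<And>n t. 0 \<le> \<zeta> n t" "\<And>n t. \<zeta> n t \<le> 1"
    "\<And>n t. \<bar>t\<bar> \<le> 1 - 1 / real (n + 2) \<Longrightarrow> \<zeta> n t = 1" "\<And>n t. 1 - 1 / real (n + 3) \<le> \<bar>t\<bar> \<Longrightarrow> \<zeta> n t = 0"
    by metis
  obtain \<rho> :: "real \<Rightarrow> real" where \<rho>: "smooth \<rho>" "\<And>t. 0 \<le> \<rho> t" "\<And>t. \<rho> t \<le> 1"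
    "\<And>t. \<bar>t\<bar> \<le> 1/4 \<Longrightarrow> \<rho> t = 1" "\<And>t. 1/2 \<le> \<bar>t\<bar> \<Longrightarrow> \<rho> t = 0"
    by (rule smooth_cutoff[of "1/4" "1/2"]) (auto intro: that)
  define c where "c = integral {-1..1} \<rho>"
  have cont: "continuous_on S \<rho>" "continuous_on S (\<zeta> n)" "continuous_on S (P n)" for S n
    using \<rho>(1) \<zeta>(1) P(1) smooth_real_polynomial_function by (auto intro: smooth_continuous)
  have "integral {-1/4..1/4::real} (\<lambda>t. 1::real) \<le> integral {-1..1} \<rho>"
  proof -
    have "integral {-1/4..1/4::real} (\<lambda>t. 1::real) = integral {-1/4..1/4} \<rho>"
      by (rule Henstock_Kurzweil_Integration.integral_cong) (rule \<rho>(4)[symmetric], auto)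
    also have "\<dots> \<le> integral {-1..1} \<rho>"
      by (rule integral_subset_le) (auto intro!: integrable_continuous_real cont simp: \<rho>(2))
    finally show ?thesis .
  qed
  moreover have "integral {-1/4..1/4::real} (\<lambda>t. 1::real) = (1 / 2 :: real)"
    by simp
  ultimately have c: "0 < c"
    unfolding c_def by linarith
  \<comment> \<open>Makes the mean of \<open>u n\<close> zero, so that the antiderivative returns to
    0 at the right endpoint. It tends to 0 because \<open>h\<close> has integral
    \<open>H 1 - H (-1) = 0\<close>; hence the correction leaves the limit unchanged.\<close>
  define \<kappa> where "\<kappa> n = integral {-1..1} (\<lambda>t. P n t * \<zeta> n t) / c" for n
  define u where "u n t = P n t * \<zeta> n t - \<kappa> n * \<rho> t" for n t
  have smooth_u: "smooth (u n)" for n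
  proof -
    have "smooth (\<lambda>t. P n t * \<zeta> n t - \<kappa> n * \<rho> t)"
      by (rule smooth_diff[OF smooth_mult[OF smooth_real_polynomial_function[OF P(1)] \<zeta>(1)]
            smooth_mult[OF smooth_const \<rho>(1)]])
    then show ?thesis
      by (simp add: u_def[abs_def])
  qed
  have cont_u: "continuous_on S (u n)" for S n
    by (rule smooth_continuous[OF smooth_u])
  have P\<zeta>: "\<bar>P n t * \<zeta> n t\<bar> \<le> B + 1" for n t
  proof (cases "t \<in> {-1..1}")
    case True
    have "\<bar>P n t\<bar> * \<bar>\<zeta> n t\<bar> \<le> (B + 1) * 1"
      by (intro mult_mono PB True) (use \<zeta>(2,3) B0 in auto)
    then show ?thesis by (simp add: abs_mult)
  next
    case False
    have "1 - 1 / real (n + 3) \<le> \<bar>t\<bar>"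
    proof -
      have "0 \<le> 1 / real (n + 3)" by simp
      moreover have "1 \<le> \<bar>t\<bar>" using False by auto
      ultimately show ?thesis by linarith
    qed
    then show ?thesis using \<zeta>(5) B0 by simp
  qed
  have \<kappa>: "\<bar>\<kappa> n\<bar> \<le> 2 * (B + 1) / c" for n
  proof -
    have "norm (integral {-1..1} (\<lambda>t. P n t * \<zeta> n t)) \<le> (B + 1) * (1 - (-1))"
      by (rule integral_bound) (use P\<zeta> in \<open>auto intro!: continuous_intros cont\<close>)
    then show ?thesis
      using c by (simp add: \<kappa>_def field_simps)
  qed
  define L where "L = (B + 1) + 2 * (B + 1) / c"
  have uL: "\<bar>u n t\<bar> \<le> L" for n t
  proof -
    have "\<bar>\<kappa> n * \<rho> t\<bar> \<le> 2 * (B + 1) / c * 1"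
      unfolding abs_mult by (intro mult_mono \<kappa>) (use \<rho>(2,3) B0 c in auto)
    then show ?thesis
      using P\<zeta>[of n t] unfolding u_def L_def by linarith
  qed
  have u0: "u n t = 0" if "1 - 1 / real (n + 3) \<le> \<bar>t\<bar>" for n t
  proof -
    have "1 / real (n + 3) \<le> 1 / 2"
      by (intro divide_left_mono) auto
    then have "1 / 2 \<le> \<bar>t\<bar>"
      using that by linarith
    then show ?thesis
      using \<zeta>(5)[OF that] \<rho>(5) by (simp add: u_def)
  qed
  have iu: "integral {-1..1} (u n) = 0" for n
  proof -
    have "integral {-1..1} (u n) = integral {-1..1} (\<lambda>t. P n t * \<zeta> n t) - \<kappa> n * c"
      unfolding u_def[abs_def] c_def
      by (subst integral_diff) (auto intro!: integrable_continuous_real continuous_intros cont)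
    then show ?thesis
      using c by (simp add: \<kappa>_def)
  qed
  have P\<zeta>lim: "(\<lambda>n. P n t * \<zeta> n t) \<longlonglongrightarrow> h t" if "t \<in> I" for t
  proof -
    have "(\<lambda>n. 1 / real (Suc n)) \<longlonglongrightarrow> 0"
      by real_asymp
    then have "(\<lambda>n. P n t - h t) \<longlonglongrightarrow> 0"
      by (rule Lim_null_comparison[rotated])
         (use P(2)[of t] that in \<open>auto simp: I_def abs_minus_commute less_imp_le intro!: always_eventually\<close>)
    then have Plim: "(\<lambda>n. P n t) \<longlonglongrightarrow> h t"
      by (simp add: LIM_zero_iff)
    have "(\<lambda>n. 1 - 1 / real (n + 2)) \<longlonglongrightarrow> 1"
      by real_asymp
    moreover have "\<bar>t\<bar> < 1"
      using that by (auto simp: I_def)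
    ultimately have "\<forall>\<^sub>F n in sequentially. \<bar>t\<bar> < 1 - 1 / real (n + 2)"
      by (rule order_tendstoD)
    then have "\<forall>\<^sub>F n in sequentially. P n t = P n t * \<zeta> n t"
      by eventually_elim (simp add: \<zeta>(4))
    with Plim show ?thesis
      by (rule Lim_transform_eventually)
  qed
  have int_open: "integral {-1..1} g = integral I g" for g :: "real \<Rightarrow> real"
    unfolding I_def by (simp add: integral_open_interval_real)
  have h_int: "(h has_integral H 1 - H (-1)) {-1..1}"
    by (rule fundamental_theorem_of_calculus_interior)
       (use H DH in \<open>auto simp flip: has_real_derivative_iff_has_vector_derivative\<close>)
  have iob: "g integrable_on I" if "continuous_on {-1..1} g" for g :: "real \<Rightarrow> real"
    using that unfolding I_def by (simp add: integrable_on_open_interval_real integrable_continuous_real)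
  have "(\<lambda>n. integral I (\<lambda>t. P n t * \<zeta> n t)) \<longlonglongrightarrow> integral I h"
    by (rule dominated_convergence(2)[where h = "\<lambda>t. B + 1"])
       (use P\<zeta> P\<zeta>lim in \<open>auto intro!: iob continuous_intros cont\<close>)
  moreover have "integral I h = 0"
    using h_int H by (simp add: has_integral_iff flip: int_open)
  ultimately have "(\<lambda>n. integral {-1..1} (\<lambda>t. P n t * \<zeta> n t) / c) \<longlonglongrightarrow> 0 / c"
    by (intro tendsto_divide tendsto_const) (use c in \<open>auto simp: int_open\<close>)
  then have \<kappa>lim: "\<kappa> \<longlonglongrightarrow> 0"
    by (simp add: \<kappa>_def[abs_def])
  have ulim: "(\<lambda>n. u n t) \<longlonglongrightarrow> h t" if "t \<in> I" for t
    using tendsto_diff[OF P\<zeta>lim[OF that] tendsto_mult[OF \<kappa>lim tendsto_const[of "\<rho> t"]]]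
    by (simp add: u_def)
  have "\<exists>F. smooth F \<and> (\<forall>t. (F has_real_derivative u n t) (at t))" for n
    using smooth_antiderivative[OF smooth_u[of n]] by metis
  then obtain F where F: "\<And>n. smooth (F n)" "\<And>n t. (F n has_real_derivative u n t) (at t)"
    by metis
  define f where "f n t = F n t - F n (-1)" for n t
  have Df: "(f n has_real_derivative u n t) (at t)" for n t
    unfolding f_def[abs_def] by (auto intro!: derivative_eq_intros F(2))
  have f_smooth: "smooth (f n)" for n
    by (rule smooth_realI[OF Df smooth_u])
  have cont_f: "continuous_on S (f n)" for S n
    by (rule smooth_continuous[OF f_smooth])
  have f_diff: "f n t - f n s = integral {s..t} (u n)" if "s \<le> t" for n s t
    using fundamental_theorem_of_calculus[OF that, of "f n" "u n"]
      DERIV_subset[OF Df subset_UNIV]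
    by (simp add: integral_unique flip: has_real_derivative_iff_has_vector_derivative)
  have f1: "f n (-1) = 0" "f n 1 = 0" for n
    using f_diff[of "-1" 1 n] iu by (auto simp: f_def)
  have f0: "f n t = 0" if "1 - 1 / real (n + 3) \<le> \<bar>t\<bar>" for n t
  proof -
    define r where "r = 1 - 1 / real (n + 3)"
    have r: "0 < r" "r < 1"
      by (auto simp: r_def)
    have u0r: "u n s = 0" if "r \<le> \<bar>s\<bar>" for s
      using u0[of n s] that unfolding r_def .
    have "f n s = f n t" if "r \<le> s" "s \<le> t \<or> t \<le> s" "r \<le> t" for s t
    proof -
      have "integral {x..y} (u n) = 0" if "r \<le> x" for x y
        by (subst Henstock_Kurzweil_Integration.integral_cong[of _ _ "\<lambda>_. 0"])
           (use that u0r r in \<open>auto simp: abs_if\<close>)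
      then show ?thesis
        using that f_diff[of s t n] f_diff[of t s n] by auto
    qed
    from this[of 1 t] have pos: "f n t = 0" if "r \<le> t"
      using that r f1 by fastforce
    have "f n s = f n t" if "s \<le> - r" "s \<le> t \<or> t \<le> s" "t \<le> - r" for s t
    proof -
      have "integral {x..y} (u n) = 0" if "y \<le> - r" for x y
        by (subst Henstock_Kurzweil_Integration.integral_cong[of _ _ "\<lambda>_. 0"])
           (use that u0r r in \<open>auto simp: abs_if\<close>)
      then show ?thesis
        using that f_diff[of s t n] f_diff[of t s n] by auto
    qed
    from this[of "-1" t] have "f n t = 0" if "t \<le> - r"
      using that r f1 by fastforce
    moreover have "t \<le> - r \<or> r \<le> t"
      using that unfolding r_def[symmetric] by (auto simp: abs_if split: if_splits)
    ultimately show ?thesis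
      using pos by blast
  qed
  have deriv_f: "deriv (f n) = u n" for n
    using Df DERIV_imp_deriv by blast
  \<comment> \<open>The L1 distance of the derivatives bounds the sup distance of the functions,
    since both functions start from 0 at -1.\<close>
  define e where "e n = integral I (\<lambda>t. \<bar>u n t - h t\<bar>)" for n
  have "(\<lambda>n. integral I (\<lambda>t. \<bar>u n t - h t\<bar>)) \<longlonglongrightarrow> integral I (\<lambda>t. 0)"
  proof (rule dominated_convergence(2)[where h = "\<lambda>t. L + B"])
    show "norm \<bar>u n t - h t\<bar> \<le> L + B" if "t \<in> I" for n t
      using uL[of n t] B[of t] that by (auto simp: I_def)
    show "(\<lambda>n. \<bar>u n t - h t\<bar>) \<longlonglongrightarrow> 0" if "t \<in> I" for t
      using tendsto_rabs_zero[OF LIM_zero[OF ulim[OF that]]] .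
  qed (auto intro!: iob continuous_intros cont_u h)
  then have elim: "e \<longlonglongrightarrow> 0"
    by (simp add: e_def[abs_def])
  have fH: "\<bar>f n t - H t\<bar> \<le> e n" if t: "t \<in> {-1..1}" for n t
  proof -
    have "((\<lambda>s. u n s - h s) has_integral ((f n t - H t) - (f n (-1) - H (-1)))) {-1..t}"
    proof (rule fundamental_theorem_of_calculus_interior)
      show "continuous_on {-1..t} (\<lambda>s. f n s - H s)"
        using t by (auto intro!: continuous_intros cont_f continuous_on_subset[OF H(1)])
      show "((\<lambda>s. f n s - H s) has_vector_derivative u n s - h s) (at s)" if "s \<in> {-1<..<t}" for s
        using that t Df DH
        by (auto intro!: derivative_intros simp flip: has_real_derivative_iff_has_vector_derivative)
    qed (use t in auto)
    then have "f n t - H t = integral {-1..t} (\<lambda>s. u n s - h s)"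
      using f1 H by (simp add: integral_unique)
    also have "\<bar>\<dots>\<bar> \<le> integral {-1..t} (\<lambda>s. \<bar>u n s - h s\<bar>)"
      by (rule integral_norm_bound_integral[of "\<lambda>s. u n s - h s" _ "\<lambda>s. \<bar>u n s - h s\<bar>", unfolded real_norm_def])
         (use t in \<open>auto intro!: integrable_continuous_real continuous_intros cont_u continuous_on_subset[OF h]\<close>)
    also have "\<dots> \<le> integral {-1..1} (\<lambda>s. \<bar>u n s - h s\<bar>)"
      by (rule integral_subset_le)
         (use t in \<open>auto intro!: integrable_continuous_real continuous_intros cont_u continuous_on_subset[OF h]\<close>)
    finally show ?thesis
      by (simp add: e_def int_open)
  qed
  show ?thesis
  proof (rule that)
    show "smooth (f n)" for n by (rule f_smooth)
    show "\<exists>r<1. \<forall>t. r \<le> \<bar>t\<bar> \<longrightarrow> f n t = 0" for n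
      by (rule exI[of _ "1 - 1 / real (n + 3)"]) (use f0 in simp)
    show "\<bar>deriv (f n) t\<bar> \<le> L" for n t
      by (simp add: deriv_f uL)
    show "(\<lambda>n. deriv (f n) t) \<longlonglongrightarrow> h t" if "-1 < t" "t < 1" for t
      using ulim that by (simp add: deriv_f I_def)
    show "uniform_limit {-1..1} f H sequentially"
    proof (rule uniform_limitI)
      fix \<epsilon> :: real
      assume "0 < \<epsilon>"
      with elim have "\<forall>\<^sub>F n in sequentially. e n < \<epsilon>"
        by (rule order_tendstoD)
      then show "\<forall>\<^sub>F n in sequentially. \<forall>t\<in>{-1..1}. dist (f n t) (H t) < \<epsilon>"
        by eventually_elim (auto simp: dist_real_def intro: le_less_trans[OF fH])
    qed
  qed
qed

section \<open>The generalised cosine\<close>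

lemma conjugate_exponent:
  fixes p q :: real
  assumes "1 < p" "q = p / (p - 1)"
  shows "1 < q" "(p - 1) * q = p" "(q - 1) * p = q" "p * (1 - 1 / q) = 1" "(p - 1) * (q - 1) = 1" "1 / p + 1 / q = 1"
  unfolding assms(2) using assms(1) by (simp_all add: field_simps)

text \<open>The substitution \<open>s = (t\<^sup>-\<^sup>p - 1 / (p - 1))\<^sup>1\<^sup>/\<^sup>q\<close> turns the integral defining \<open>\<pi>\<^sub>p / 2\<close> into
  \<open>T(\<infinity>) = \<integral>\<^sub>0\<^sup>\<infinity> ds / (1 + (p - 1) s\<^sup>q)\<close>.\<close>

lemma pi_p_limit:
  fixes p q :: real
  assumes p: "1 < p" and q: "q = p / (p - 1)"
    and T: "\<And>y. (T has_real_derivative 1 / (1 + (p - 1) * \<bar>y\<bar> powr q)) (at y)" "T 0 = 0"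
  shows "(T \<longlongrightarrow> pi_p p / 2) at_top"
proof -
  note pq = conjugate_exponent[OF p q]
  define t1 where "t1 = (p - 1) powr (1 / p)"
  define \<phi> where "\<phi> t = 1 / (1 - t powr p / (p - 1)) powr (1 / p)" for t
  have t1: "0 < t1" "t1 powr p = p - 1"
    using p by (auto simp: t1_def powr_powr)
  have lt: "t powr p < p - 1" if "0 \<le> t" "t < t1" for t
    using powr_less_mono2[of p t t1] that p t1 by simp
  define s where "s t = (t powr (- p) - 1 / (p - 1)) powr (1 / q)" for t
  have base: "0 < t powr (- p) - 1 / (p - 1)" if "0 < t" "t < t1" for t
    using lt[of t] that p by (simp add: powr_minus field_simps)
  have base1: "t1 powr (- p) - 1 / (p - 1) = 0"
    using t1(2) by (simp add: powr_minus inverse_eq_divide)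
  have base_eq: "t powr (- p) - 1 / (p - 1) = t powr (- p) * (1 - t powr p / (p - 1))" if "0 < t" for t
    using that by (simp add: powr_minus field_simps)
  have Ds: "(s has_real_derivative - ((p - 1) * t powr (- p) * \<phi> t)) (at t)" if t: "0 < t" "t < t1" for t
  proof -
    have "(s has_real_derivative (1 / q) * (t powr (- p) - 1 / (p - 1)) powr (1 / q - 1) * ((- p) * t powr (- p - 1))) (at t)"
      unfolding s_def[abs_def] using base[OF t] t
      by (auto intro!: derivative_eq_intros simp: powr_diff)
    moreover have "(t powr (- p) - 1 / (p - 1)) powr (1 / q - 1) = t * \<phi> t"
    proof -
      have "1 / q - 1 = - (1 / p)"
        using pq(6) by simp
      then have "(t powr (- p) - 1 / (p - 1)) powr (1 / q - 1)
          = (t powr (- p)) powr (- (1 / p)) * (1 - t powr p / (p - 1)) powr (- (1 / p))"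
        using base_eq[of t] lt[of t] t p by (simp add: powr_mult)
      also have "(t powr (- p)) powr (- (1 / p)) = t"
        using t p by (simp add: powr_powr)
      also have "(1 - t powr p / (p - 1)) powr (- (1 / p)) = \<phi> t"
        by (simp add: \<phi>_def powr_minus inverse_eq_divide)
      finally show ?thesis .
    qed
    moreover have "(1 / q) * (t * \<phi> t) * ((- p) * t powr (- p - 1)) = - ((p - 1) * t powr (- p) * \<phi> t)"
    proof -
      have "t * t powr (- p - 1) = t powr (- p)"
        using t by (simp add: powr_diff)
      then have "(1 / q) * (t * \<phi> t) * ((- p) * t powr (- p - 1)) = - (p / q) * (t powr (- p) * \<phi> t)"
        by (simp add: mult_ac)
      also have "p / q = p - 1"
        unfolding q using p by simp
      finally show ?thesis by (simp add: algebra_simps)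
    qed
    ultimately show ?thesis
      by simp
  qed
  have s_pow: "1 + (p - 1) * \<bar>s t\<bar> powr q = (p - 1) * t powr (- p)" if "0 < t" "t < t1" for t
    using base[OF that] pq p by (simp add: s_def powr_powr field_simps)
  have s1: "s t1 = 0"
    using base1 by (simp add: s_def)
  have DH: "((\<lambda>t. - T (s t)) has_real_derivative \<phi> t) (at t)" if t: "0 < t" "t < t1" for t
  proof -
    have "((\<lambda>t. - T (s t)) has_real_derivative
        - (1 / (1 + (p - 1) * \<bar>s t\<bar> powr q) * (- ((p - 1) * t powr (- p) * \<phi> t)))) (at t)"
      by (intro DERIV_minus DERIV_chain2[OF T(1) Ds[OF t]])
    moreover have "0 < (p - 1) * t powr (- p)"
      using t p by simp
    ultimately show ?thesis
      unfolding s_pow[OF t] using t p by simp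
  qed
  have cs: "continuous_on {e..t1} s" if "0 < e" for e
    unfolding s_def using that pq p base base1
    by (intro continuous_on_powr' continuous_intros) (auto simp: order.order_iff_strict)
  have contT: "continuous_on S T" for S
    by (rule DERIV_continuous_on[OF DERIV_subset[OF T(1) subset_UNIV]])
  have int1: "(\<phi> has_integral T (s e)) {e..t1}" if e: "0 < e" "e \<le> t1" for e
  proof -
    have "(\<phi> has_integral (- T (s t1) - (- T (s e)))) {e..t1}"
      by (rule fundamental_theorem_of_calculus_interior)
         (use e DH cs in \<open>auto intro!: continuous_intros continuous_on_compose2[OF contT]
             simp flip: has_real_derivative_iff_has_vector_derivative\<close>)
    then show ?thesis
      using s1 T(2) by simp
  qed
  \<comment> \<open>\<open>\<phi>\<close> is singular at \<open>t1\<close> and \<open>s\<close> at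
    0; each half of the interval meets only one of the two singularities.\<close>
  define e0 where "e0 = t1 / 2"
  have e0: "0 < e0" "e0 < t1"
    using t1 by (auto simp: e0_def)
  have "continuous_on {0..e0} \<phi>"
    unfolding \<phi>_def
    by (intro continuous_intros continuous_on_powr') (use lt e0 p in \<open>auto simp: field_simps\<close>, (fastforce dest: lt)+)
  then have "\<phi> integrable_on {0..e0}"
    by (rule integrable_continuous_real)
  then have int2: "\<phi> integrable_on {0..t1}"
    using int1[of e0] e0
    by (intro Henstock_Kurzweil_Integration.integrable_combine[of 0 e0 t1]) (auto simp: integrable_on_def)
  have Teq: "T (s e) = pi_p p / 2 - integral {0..e} \<phi>" if e: "0 < e" "e \<le> t1" for e
  proof -
    have "integral {0..e} \<phi> + integral {e..t1} \<phi> = integral {0..t1} \<phi>"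
      by (rule Henstock_Kurzweil_Integration.integral_combine) (use e int2 in auto)
    moreover have "integral {0..t1} \<phi> = pi_p p / 2"
      by (simp add: pi_p_def t1_def \<phi>_def[abs_def])
    ultimately show ?thesis
      using int1[OF e] by (simp add: integral_unique)
  qed
  \<comment> \<open>The inverse of \<open>s\<close>, found by solving \<open>s t = y\<close> for t.
    It tends to 0 as y grows.\<close>
  define \<epsilon> where "\<epsilon> y = (y powr q + 1 / (p - 1)) powr (- (1 / p))" for y
  have \<epsilon>: "0 < \<epsilon> y" "\<epsilon> y \<le> t1" "s (\<epsilon> y) = y" if "0 < y" for y
  proof -
    have pos: "0 < y powr q + 1 / (p - 1)"
      using p by (simp add: add_nonneg_pos)
    show "0 < \<epsilon> y"
      using pos by (simp add: \<epsilon>_def)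
    have "\<epsilon> y \<le> (1 / (p - 1)) powr (- (1 / p))"
      unfolding \<epsilon>_def by (rule powr_mono2') (use p in auto)
    also have "\<dots> = t1"
      using p by (simp add: t1_def powr_minus powr_divide)
    finally show "\<epsilon> y \<le> t1" .
    have "\<epsilon> y powr (- p) = y powr q + 1 / (p - 1)"
      using pos p by (simp add: \<epsilon>_def powr_powr)
    then show "s (\<epsilon> y) = y"
      using that pq by (simp add: s_def powr_powr)
  qed
  have "filterlim (\<lambda>y. y powr q + 1 / (p - 1)) at_top at_top"
    using pq(1) by real_asymp
  then have "(\<epsilon> \<longlongrightarrow> 0) at_top"
    unfolding \<epsilon>_def[abs_def] by (rule tendsto_neg_powr[rotated]) (use p in simp)
  moreover have "\<forall>\<^sub>F y in at_top. \<epsilon> y \<in> {0..t1}"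
    using eventually_gt_at_top[of 0] by eventually_elim (use \<epsilon> in force)
  ultimately have "((\<lambda>y. integral {0..\<epsilon> y} \<phi>) \<longlongrightarrow> integral {0..0} \<phi>) at_top"
    using t1 by (intro continuous_on_tendsto_compose[OF indefinite_integral_continuous_1[OF int2]]) auto
  then have "((\<lambda>y. pi_p p / 2 - integral {0..\<epsilon> y} \<phi>) \<longlongrightarrow> pi_p p / 2 - 0) at_top"
    by (intro tendsto_intros) simp
  then have "((\<lambda>y. pi_p p / 2 - integral {0..\<epsilon> y} \<phi>) \<longlongrightarrow> pi_p p / 2) at_top"
    by simp
  moreover have "\<forall>\<^sub>F y in at_top. pi_p p / 2 - integral {0..\<epsilon> y} \<phi> = T y"
    using eventually_gt_at_top[of 0] by eventually_elim (use \<epsilon> Teq in force)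
  ultimately show ?thesis
    by (rule Lim_transform_eventually)
qed

text \<open>The equation is autonomous and separates: with T the odd antiderivative of 1 / (1 +
  (p-1)|y|^q), the value \<open>W t\<close> is the inverse of T at -\<mu> t. By
  \<open>pi_p_limit\<close> and oddness T maps onto the open interval (-\<mu>, \<mu>), so W lives
  exactly on (-1, 1) and blows up at both ends. With \<lambda> = \<mu>^p, the solution of m' = -
  (\<lambda> + (p-1)|m|^q) is \<open>\<mu> powr (p - 1) * W\<close>.\<close>

lemma riccati:
  fixes p q :: real
  assumes p: "1 < p" and q: "q = p / (p - 1)"
  defines "\<mu> \<equiv> pi_p p / 2"
  obtains W :: "real \<Rightarrow> real" where "0 < \<mu>"
    "\<And>t. -1 < t \<Longrightarrow> t < 1 \<Longrightarrow> (W has_real_derivative - (\<mu> * (1 + (p - 1) * \<bar>W t\<bar> powr q))) (at t)"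
    "filterlim W at_bot (at_left 1)" "filterlim W at_top (at_right (-1))"
proof -
  define r where "r y = 1 / (1 + (p - 1) * \<bar>y\<bar> powr q)" for y
  note pq = conjugate_exponent[OF p q]
  have rpos: "0 < 1 + (p - 1) * \<bar>y\<bar> powr q" for y
    using p by (simp add: add_pos_nonneg)
  have "continuous_on UNIV r"
    unfolding r_def using rpos pq by (intro continuous_intros) (auto simp: less_imp_neq[symmetric])
  then have "isCont r y" for y
    by (simp add: continuous_on_eq_continuous_at)
  then obtain T0 where "\<And>y. (T0 has_vector_derivative r y) (at y)"
    using einterval_antiderivative[of "-\<infinity>" "\<infinity>" r] by auto
  then have T0: "\<And>y. (T0 has_real_derivative r y) (at y)"
    by (simp add: has_real_derivative_iff_has_vector_derivative)
  define T where "T y = T0 y - T0 0" for y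
  have T: "(T has_real_derivative r y) (at y)" "T 0 = 0" for y
    unfolding T_def[abs_def] by (auto intro!: derivative_eq_intros T0)
  have odd: "T (- y) = - T y" for y
  proof -
    have "((\<lambda>y. T (- y) + T y) has_real_derivative 0) (at y)" for y
      by (auto intro!: derivative_eq_intros DERIV_chain2[OF T(1)] T(1) simp: r_def)
    then have "T (- y) + T y = T (- 0) + T 0"
      using DERIV_isconst_all[of "\<lambda>y. T (- y) + T y"] by blast
    then show ?thesis
      using T(2) by simp
  qed
  have mono: "T x < T y" if "x < y" for x y
    by (rule DERIV_pos_imp_increasing[OF that]) (use T(1) rpos in \<open>auto simp: r_def intro!: exI\<close>)
  have lim: "(T \<longlongrightarrow> \<mu>) at_top"
    unfolding \<mu>_def by (rule pi_p_limit[OF p q]) (use T r_def in auto)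
  have Tlt: "T y < \<mu>" for y
  proof -
    have "\<forall>\<^sub>F z in at_top. T (y + 1) \<le> T z"
      using eventually_gt_at_top[of "y + 1"] by eventually_elim (use mono in force)
    then have "T (y + 1) \<le> \<mu>"
      using tendsto_lowerbound[OF lim] by simp
    then show ?thesis
      using mono[of y "y + 1"] by simp
  qed
  have \<mu>: "0 < \<mu>"
    using Tlt[of 0] T(2) by simp
  have contT: "isCont T y" for y
    using T(1) DERIV_isCont by blast
  have surj: "\<exists>y. T y = z" if z: "-\<mu> < z" "z < \<mu>" for z
  proof -
    have "\<forall>\<^sub>F y in at_top. z < T y \<and> - z < T y \<and> (0::real) < y"
      by (intro eventually_conj order_tendstoD(1)[OF lim] eventually_gt_at_top) (use z in auto)
    then obtain y where y: "z < T y" "- z < T y" "0 < y"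
      using eventually_happens by fastforce
    have "\<exists>x\<ge>-y. x \<le> y \<and> T x = z"
      by (rule IVT) (use y odd contT in auto)
    then show ?thesis by blast
  qed
  have inj: "T x = T y \<longleftrightarrow> x = y" for x y
    using mono by (metis less_irrefl linorder_neqE)
  have less: "T x < T y \<longleftrightarrow> x < y" for x y
    using mono by (metis less_asym linorder_neqE less_irrefl)
  define w where "w z = (THE y. T y = z)" for z
  have wT: "w (T y) = y" for y
    unfolding w_def by (rule the_equality) (auto simp: inj)
  have Tw: "T (w z) = z" if "-\<mu> < z" "z < \<mu>" for z
    using surj[OF that] wT by metis
  have Dw: "(w has_real_derivative 1 + (p - 1) * \<bar>w z\<bar> powr q) (at z)" if z: "-\<mu> < z" "z < \<mu>" for z
  proof -
    have "isCont w (T (w z))"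
      by (rule isCont_inverse_function[of 1]) (use wT contT in auto)
    then have "isCont w z"
      using Tw[OF z] by simp
    then have "(w has_real_derivative inverse (r (w z))) (at z)"
      using DERIV_inverse_function[OF T(1), of w z "-\<mu>" \<mu>] rpos[of "w z"] z Tw by (force simp: r_def)
    then show ?thesis
      by (simp add: r_def)
  qed
  define W where "W t = w (- (\<mu> * t))" for t
  have rng: "-\<mu> < - (\<mu> * t)" "- (\<mu> * t) < \<mu>" if "-1 < t" "t < 1" for t
    using that \<mu> mult_strict_left_mono[of t 1 \<mu>] mult_strict_left_mono[of "-1" t \<mu>] by auto
  show ?thesis
  proof (rule that[of W])
    show "0 < \<mu>" by (rule \<mu>)
    show "(W has_real_derivative - (\<mu> * (1 + (p - 1) * \<bar>W t\<bar> powr q))) (at t)" if t: "-1 < t" "t < 1" for t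
    proof -
      have "((\<lambda>t. w (- (\<mu> * t))) has_real_derivative (1 + (p - 1) * \<bar>w (- (\<mu> * t))\<bar> powr q) * (- \<mu>)) (at t)"
        by (rule DERIV_chain2[OF Dw]) (use rng[OF t] in \<open>auto intro!: derivative_eq_intros\<close>)
      then show ?thesis
        by (simp add: W_def[abs_def] algebra_simps)
    qed
    have lim1: "\<forall>\<^sub>F t in at_left 1. W t < Z" for Z
    proof -
      have "- T Z / \<mu> < 1"
        using Tlt[of "-Z"] odd[of Z] \<mu> by (simp add: field_simps)
      then have "\<forall>\<^sub>F t in at_left 1. t \<in> {max (- T Z / \<mu>) (-1)<..<1}"
        by (intro eventually_at_leftI[of "max (- T Z / \<mu>) (-1)"]) auto
      then show ?thesis
      proof eventually_elim
        case (elim t)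
        then have "- (\<mu> * t) < T Z"
          using \<mu> by (simp add: field_simps)
        then have "T (W t) < T Z"
          using Tw[OF rng, of t] elim by (simp add: W_def)
        then show ?case
          by (simp add: less)
      qed
    qed
    then show "filterlim W at_bot (at_left 1)"
      by (simp add: filterlim_at_bot_dense)
    have lim2: "\<forall>\<^sub>F t in at_right (-1). Z < W t" for Z
    proof -
      have "-1 < - T Z / \<mu>"
        using Tlt[of Z] \<mu> by (simp add: field_simps)
      then have "\<forall>\<^sub>F t in at_right (-1). t \<in> {-1<..<min (- T Z / \<mu>) 1}"
        by (intro eventually_at_rightI[of _ "min (- T Z / \<mu>) 1"]) auto
      then show ?thesis
      proof eventually_elim
        case (elim t)
        then have "T Z < - (\<mu> * t)"
          using \<mu> by (simp add: field_simps)
        then have "T Z < T (W t)"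
          using Tw[OF rng, of t] elim by (simp add: W_def)
        then show ?case
          by (simp add: less)
      qed
    qed
    then show "filterlim W at_top (at_right (-1))"
      by (simp add: filterlim_at_top_dense)
  qed
qed

text \<open>The first eigenfunction of the one-dimensional p-Laplacian on (-1, 1) is read off from
  the Riccati solution: S = R(W)^(-1/p) with R y = 1 + (p-1)|y|^q, and conversely W is the quotient
  |S'|^(p-2) S' / (\<mu> S)^(p-1). Its regularity up to the ends, its sign and its Rayleigh quotient
  are what the upper bound for the eigenvalue uses.\<close>

lemma generalised_cosine:
  fixes p q \<mu> :: real and W :: "real \<Rightarrow> real"
  assumes p: "1 < p" and q: "q = p / (p - 1)" and \<mu>: "0 < \<mu>"
    and DW: "\<And>t. -1 < t \<Longrightarrow> t < 1 \<Longrightarrow> (W has_real_derivative - (\<mu> * (1 + (p - 1) * \<bar>W t\<bar> powr q))) (at t)"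
    and Wlim: "filterlim W at_bot (at_left 1)" "filterlim W at_top (at_right (-1))"
  obtains S S' :: "real \<Rightarrow> real" where
    "continuous_on {-1..1} S" "continuous_on {-1..1} S'" "S (-1) = 0" "S 1 = 0"
    "\<And>t. -1 < t \<Longrightarrow> t < 1 \<Longrightarrow> (S has_real_derivative S' t) (at t)"
    "\<And>t. -1 < t \<Longrightarrow> t < 1 \<Longrightarrow> 0 < S t"
    "integral {-1..1} (\<lambda>t. \<bar>S' t\<bar> powr p) = \<mu> powr p * integral {-1..1} (\<lambda>t. \<bar>S t\<bar> powr p)"
proof -
  note pq = conjugate_exponent[OF p q]
  define R where "R y = 1 + (p - 1) * \<bar>y\<bar> powr q" for y
  define s where "s y = R y powr (- (1 / p))" for y
  define s' where "s' y = \<mu> * (sgn y * \<bar>y\<bar> powr (q - 1) * s y)" for y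
  \<comment> \<open>\<open>\<mu> powr (p - 1) * g (W t)\<close> is S |S'|^(p-2) S'. Its derivative
    is |S'|^p - \<mu>^p S^p, so the equality of the two energies is the eigenvalue equation tested
    with S.\<close>
  define g where "g y = y / R y" for y
  have Rpos: "1 \<le> R y" for y
    using p by (simp add: R_def)
  have DR: "(R has_real_derivative p * (sgn y * \<bar>y\<bar> powr (q - 1))) (at y)" for y
  proof -
    have "(R has_real_derivative 0 + (p - 1) * (q * (sgn y * \<bar>y\<bar> powr (q - 1)))) (at y)"
      unfolding R_def[abs_def]
      by (intro DERIV_add DERIV_const DERIV_cmult has_real_derivative_abs_powr pq)
    then show ?thesis
      by (simp add: pq(2) flip: mult.assoc)
  qed
  have Ds: "(s has_real_derivative - (sgn y * \<bar>y\<bar> powr (q - 1) * s y / R y)) (at y)" for y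
  proof -
    have "(s has_real_derivative - (1 / p) * R y powr (- (1 / p) - 1) * (p * (sgn y * \<bar>y\<bar> powr (q - 1)))) (at y)"
      unfolding s_def[abs_def] using Rpos[of y]
      by (intro DERIV_chain2[OF has_real_derivative_powr DR]) simp
    then show ?thesis
      using Rpos[of y] p by (simp add: s_def powr_diff mult_ac)
  qed
  have Dg: "(g has_real_derivative (1 - \<bar>y\<bar> powr q) / R y ^ 2) (at y)" for y
  proof -
    have "(g has_real_derivative (1 * R y - y * (p * (sgn y * \<bar>y\<bar> powr (q - 1)))) / (R y * R y)) (at y)"
      unfolding g_def[abs_def] using Rpos[of y]
      by (intro DERIV_divide DERIV_ident DR) simp
    moreover have "y * (sgn y * \<bar>y\<bar> powr (q - 1)) = \<bar>y\<bar> powr q"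
      by (rule powr_product_sgn)
    then have "1 * R y - y * (p * (sgn y * \<bar>y\<bar> powr (q - 1))) = 1 - \<bar>y\<bar> powr q"
      by (simp add: R_def algebra_simps)
    ultimately show ?thesis
      by (simp add: power2_eq_square)
  qed
  have DWR: "(W has_real_derivative - (\<mu> * R (W t))) (at t)" if "-1 < t" "t < 1" for t
    using DW[OF that] by (simp add: R_def)
  have contW: "isCont W t" if "-1 < t" "t < 1" for t
    using DWR[OF that] DERIV_isCont by blast
  have cont_s: "isCont s y" for y
    using Ds DERIV_isCont by blast
  have cont_g: "isCont g y" for y
    using Dg DERIV_isCont by blast
  have cont_s': "isCont s' y" for y
  proof -
    have "isCont (\<lambda>y. sgn y * \<bar>y\<bar> powr (q - 1)) y"
      by (rule continuous_sgn_abs_powr) (use pq(1) in simp)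
    then show ?thesis
      unfolding s'_def[abs_def] by (intro isCont_mult[OF continuous_const isCont_mult[OF _ cont_s]])
  qed
  have lims: "(s \<longlongrightarrow> 0) at_top" "(s \<longlongrightarrow> 0) at_bot" "(g \<longlongrightarrow> 0) at_top" "(g \<longlongrightarrow> 0) at_bot"
    "(s' \<longlongrightarrow> \<mu> * (p - 1) powr (- (1 / p))) at_top" "(s' \<longlongrightarrow> - (\<mu> * (p - 1) powr (- (1 / p)))) at_bot"
  proof -
    have R: "filterlim (\<lambda>y. 1 + (p - 1) * y powr q) at_top at_top"
      using pq(1) p by real_asymp
    then have "((\<lambda>y. (1 + (p - 1) * y powr q) powr (- (1 / p))) \<longlongrightarrow> 0) at_top"
      by (rule tendsto_neg_powr[rotated]) (use p in simp)
    then show s: "(s \<longlongrightarrow> 0) at_top"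
      by (rule Lim_transform_eventually)
         (rule eventually_mono[OF eventually_gt_at_top[of 0]], simp add: s_def R_def)
    have "((\<lambda>y. y / (1 + (p - 1) * y powr q)) \<longlongrightarrow> 0) at_top"
      using pq(1) p by real_asymp
    then show g: "(g \<longlongrightarrow> 0) at_top"
      by (rule Lim_transform_eventually)
         (rule eventually_mono[OF eventually_gt_at_top[of 0]], simp add: g_def R_def)
    have "((\<lambda>y. \<mu> * (y powr (- q) + (p - 1)) powr (- (1 / p))) \<longlongrightarrow> \<mu> * (0 + (p - 1)) powr (- (1 / p))) at_top"
      by (intro tendsto_intros tendsto_neg_powr filterlim_ident) (use pq p in auto)
    then have "((\<lambda>y. \<mu> * (y powr (- q) + (p - 1)) powr (- (1 / p))) \<longlongrightarrow> \<mu> * (p - 1) powr (- (1 / p))) at_top"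
      by simp
    then show s': "(s' \<longlongrightarrow> \<mu> * (p - 1) powr (- (1 / p))) at_top"
    proof (rule Lim_transform_eventually)
      have "\<mu> * (y powr (- q) + (p - 1)) powr (- (1 / p)) = s' y" if y: "0 < y" for y
      proof -
        have "y powr (- q) + (p - 1) = R y * y powr (- q)"
          using y by (simp add: R_def algebra_simps flip: powr_add)
        then have "(y powr (- q) + (p - 1)) powr (- (1 / p)) = s y * (y powr (- q)) powr (- (1 / p))"
          using Rpos[of y] by (simp add: s_def powr_mult)
        also have "(y powr (- q)) powr (- (1 / p)) = y powr (q - 1)"
        proof -
          have "q / p = q - 1"
            using pq(3) p by (simp add: field_simps)
          then show ?thesis
            by (simp add: powr_powr)
        qed
        finally show ?thesis
          using y by (simp add: s'_def)
      qed
      then show "\<forall>\<^sub>F y in at_top. \<mu> * (y powr (- q) + (p - 1)) powr (- (1 / p)) = s' y"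
        by (rule eventually_mono[OF eventually_gt_at_top[of 0]])
    qed
    have even: "s (- y) = s y" "g (- y) = - g y" "s' (- y) = - s' y" for y
      by (simp_all add: s_def g_def s'_def R_def sgn_minus)
    show "(s \<longlongrightarrow> 0) at_bot" "(g \<longlongrightarrow> 0) at_bot" "(s' \<longlongrightarrow> - (\<mu> * (p - 1) powr (- (1 / p)))) at_bot"
      using s tendsto_minus[OF g] tendsto_minus[OF s']
      by (auto simp: at_bot_mirror filterlim_filtermap even)
  qed
  \<comment> \<open>Since \<open>W\<close> runs from + infinity at -1 to - infinity at 1,
    \<open>a\<close> and \<open>b\<close> stand for the limits of \<open>f\<close> at + infinity and
    - infinity, in this order.\<close>
  define ext where "ext f a b t = (if t \<le> -1 then a else if 1 \<le> t then b else f (W t))"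
    for f :: "real \<Rightarrow> real" and a b t
  have ext_in: "ext f a b t = f (W t)" if "-1 < t" "t < 1" for f a b t
    using that by (simp add: ext_def)
  have ext_ev: "\<forall>\<^sub>F x in nhds t. f (W x) = ext f a b x" if "-1 < t" "t < 1" for f a b t
    using eventually_nhds_in_open[of "{-1<..<1}" t] that by (auto elim!: eventually_mono simp: ext_def)
  have ext_cont: "continuous_on {-1..1} (ext f a b)"
    if f: "\<And>y. isCont f y" "(f \<longlongrightarrow> a) at_top" "(f \<longlongrightarrow> b) at_bot" for f a b
  proof (rule continuous_on_IccI)
    have "\<forall>\<^sub>F t in at_right (-1::real). f (W t) = ext f a b t"
      by (rule eventually_at_rightI[of _ 1]) (auto simp: ext_def)
    with filterlim_compose[OF f(2) Wlim(2)] show "(ext f a b \<longlongrightarrow> ext f a b (-1)) (at_right (-1))"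
      by (auto simp: ext_def intro: Lim_transform_eventually)
    have "\<forall>\<^sub>F t in at_left (1::real). f (W t) = ext f a b t"
      by (rule eventually_at_leftI[of "-1"]) (auto simp: ext_def)
    with filterlim_compose[OF f(3) Wlim(1)] show "(ext f a b \<longlongrightarrow> ext f a b 1) (at_left 1)"
      by (auto simp: ext_def intro: Lim_transform_eventually)
    show "ext f a b \<midarrow>t\<rightarrow> ext f a b t" if "-1 < t" "t < 1" for t
    proof -
      have "isCont (\<lambda>t. f (W t)) t"
        using isCont_o2[OF contW[OF that] f(1)] .
      then have "isCont (ext f a b) t"
        using isCont_cong[OF ext_ev[OF that]] by simp
      then show ?thesis by (simp add: isCont_def)
    qed
  qed simp
  have ext_deriv: "(ext f a b has_real_derivative D * - (\<mu> * R (W t))) (at t)"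
    if "-1 < t" "t < 1" "(f has_real_derivative D) (at (W t))" for f a b t D
    using DERIV_chain2[OF that(3) DWR[OF that(1,2)]] DERIV_cong_ev[OF refl ext_ev[OF that(1,2)] refl]
    by simp
  define S where "S = ext s 0 0"
  define S' where "S' = ext s' (\<mu> * (p - 1) powr (- (1 / p))) (- (\<mu> * (p - 1) powr (- (1 / p))))"
  define G where "G = ext g 0 0"
  have cont: "continuous_on {-1..1} S" "continuous_on {-1..1} S'" "continuous_on {-1..1} G"
    unfolding S_def S'_def G_def by (intro ext_cont cont_s cont_s' cont_g lims)+
  have "((\<lambda>t. \<bar>S' t\<bar> powr p - \<mu> powr p * \<bar>S t\<bar> powr p) has_integral
      (\<mu> powr (p - 1) * G 1 - \<mu> powr (p - 1) * G (-1))) {-1..1}"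
  proof (rule fundamental_theorem_of_calculus_interior)
    fix t :: real
    assume "t \<in> {-1<..<1}"
    then have t: "-1 < t" "t < 1" by auto
    define y where "y = W t"
    have sp: "s y powr p = 1 / R y"
    proof -
      have "s y powr p = R y powr (- 1)"
        using p by (simp add: s_def powr_powr)
      then show ?thesis
        using Rpos[of y] by (simp add: powr_minus inverse_eq_divide)
    qed
    have s'p: "\<bar>s' y\<bar> powr p = \<mu> powr p * (\<bar>y\<bar> powr q / R y)"
    proof (cases "y = 0")
      case False
      have "\<bar>s' y\<bar> = \<mu> * (\<bar>y\<bar> powr (q - 1) * s y)"
        using \<mu> False by (simp add: s'_def abs_mult abs_sgn_eq s_def)
      then show ?thesis
        using \<mu> pq(3) by (simp add: powr_mult sp powr_powr s_def[symmetric])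
    qed (use \<mu> pq in \<open>simp add: s'_def\<close>)
    have "((\<lambda>t. \<mu> powr (p - 1) * G t) has_real_derivative
        \<mu> powr (p - 1) * ((1 - \<bar>y\<bar> powr q) / R y ^ 2 * - (\<mu> * R y))) (at t)"
      unfolding G_def y_def by (intro DERIV_cmult ext_deriv t Dg)
    moreover have "\<mu> powr (p - 1) * ((1 - \<bar>y\<bar> powr q) / R y ^ 2 * - (\<mu> * R y))
        = \<bar>S' t\<bar> powr p - \<mu> powr p * \<bar>S t\<bar> powr p"
    proof -
      have S: "S t = s y" "S' t = s' y"
        using t by (simp_all add: S_def S'_def ext_in y_def)
      have "\<bar>S' t\<bar> powr p - \<mu> powr p * \<bar>S t\<bar> powr p = \<mu> powr p * (\<bar>y\<bar> powr q / R y) - \<mu> powr p * (1 / R y)"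
        unfolding S s'p using sp by (simp add: s_def)
      also have "\<dots> = (\<mu> powr (p - 1) * \<mu>) * (\<bar>y\<bar> powr q / R y - 1 / R y)"
        using \<mu> by (simp add: powr_diff algebra_simps)
      finally have E: "\<bar>S' t\<bar> powr p - \<mu> powr p * \<bar>S t\<bar> powr p
          = (\<mu> powr (p - 1) * \<mu>) * (\<bar>y\<bar> powr q / R y - 1 / R y)" .
      show ?thesis
        unfolding E using Rpos[of y] by (simp add: field_simps power2_eq_square)
    qed
    ultimately show "((\<lambda>t. \<mu> powr (p - 1) * G t) has_vector_derivative
        \<bar>S' t\<bar> powr p - \<mu> powr p * \<bar>S t\<bar> powr p) (at t)"
      by (simp add: has_real_derivative_iff_has_vector_derivative)
  qed (auto intro!: continuous_intros cont)
  then have "integral {-1..1} (\<lambda>t. \<bar>S' t\<bar> powr p - \<mu> powr p * \<bar>S t\<bar> powr p) = 0"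
    by (simp add: G_def ext_def integral_unique)
  also have "integral {-1..1} (\<lambda>t. \<bar>S' t\<bar> powr p - \<mu> powr p * \<bar>S t\<bar> powr p)
      = integral {-1..1} (\<lambda>t. \<bar>S' t\<bar> powr p) - \<mu> powr p * integral {-1..1} (\<lambda>t. \<bar>S t\<bar> powr p)"
    by (subst integral_diff)
       (use p in \<open>auto intro!: integrable_continuous_real continuous_intros cont\<close>)
  finally have int: "integral {-1..1} (\<lambda>t. \<bar>S' t\<bar> powr p) = \<mu> powr p * integral {-1..1} (\<lambda>t. \<bar>S t\<bar> powr p)"
    by simp
  show ?thesis
  proof (rule that[of S S'])
    show "(S has_real_derivative S' t) (at t)" if t: "-1 < t" "t < 1" for t
    proof -
      have "(S has_real_derivative - (sgn (W t) * \<bar>W t\<bar> powr (q - 1) * s (W t) / R (W t)) * - (\<mu> * R (W t))) (at t)"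
        unfolding S_def by (intro ext_deriv t Ds)
      then show ?thesis
        using Rpos[of "W t"] t by (simp add: S'_def ext_in s'_def mult_ac)
    qed
    show "0 < S t" if "-1 < t" "t < 1" for t
      using that Rpos[of "W t"] by (simp add: S_def ext_in s_def)
  qed (use cont int in \<open>auto simp: S_def ext_def\<close>)
qed

section \<open>Integration by parts\<close>

lemma integral_lborel_prod:
  fixes h :: "'a::euclidean_space \<Rightarrow> real \<Rightarrow> real"
  assumes "\<And>b. b \<in> Basis \<Longrightarrow> integrable lborel (h b)"
  shows "(LINT x|lborel. (\<Prod>b\<in>Basis. h b (x \<bullet> b))) = (\<Prod>b\<in>Basis. LINT t|lborel. h b t)"
proof -
  interpret product_sigma_finite "\<lambda>_::'a. lborel :: real measure"
    by standard
  have [measurable]: "b \<in> Basis \<Longrightarrow> h b \<in> borel_measurable borel" for b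
    using borel_measurable_integrable[OF assms, of b] by simp
  have "(LINT x|lborel. (\<Prod>b\<in>Basis. h b (x \<bullet> b)))
      = (LINT f|(\<Pi>\<^sub>M b\<in>(Basis::'a set). lborel). (\<Prod>b\<in>Basis. h b (f b)))"
    by (subst lborel_eq, subst integral_distr) simp_all
  also have "\<dots> = (\<Prod>b\<in>Basis. LINT t|lborel. h b t)"
    by (rule product_integral_prod) (use assms in auto)
  finally show ?thesis .
qed

lemma integral_lborel_translation:
  fixes f :: "'a::euclidean_space \<Rightarrow> real"
  assumes "f \<in> borel_measurable borel"
  shows "(LINT x|lborel. f (x + v)) = (LINT x|lborel. f x)"
proof -
  have "(LINT x|lborel. f x) = (LINT x|distr lborel borel ((+) v). f x)"
    by (simp add: lborel_distr_plus)
  also have "\<dots> = (LINT x|lborel. f (v + x))"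
    using assms by (subst integral_distr) auto
  finally show ?thesis
    by (simp add: add.commute)
qed

lemma lebesgue_on_integral_eq_lborel:
  fixes f :: "'a::euclidean_space \<Rightarrow> real"
  assumes "f \<in> borel_measurable borel" "S \<in> sets lebesgue" "\<And>x. x \<notin> S \<Longrightarrow> f x = 0"
  shows "(LINT x|lebesgue_on S. f x) = (LINT x|lborel. f x)"
proof -
  have "(LINT x|lebesgue_on S. f x) = (LINT x|lebesgue. indicator S x *\<^sub>R f x)"
    using assms(2) by (subst integral_restrict_space) auto
  also have "(\<lambda>x. indicator S x *\<^sub>R f x) = f"
    using assms(3) by (auto simp: fun_eq_iff indicator_def)
  finally show ?thesis
    using assms(1) by (simp add: integral_completion)
qed

lemma continuous_imp_borel_lebesgue_on:
  fixes f :: "'a::euclidean_space \<Rightarrow> 'b::{second_countable_topology,real_normed_vector}"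
  assumes "continuous_on UNIV f"
  shows "f \<in> borel_measurable (lebesgue_on S)"
proof -
  have "f \<in> borel_measurable borel"
    using assms by (rule borel_measurable_continuous_onI)
  then have "f \<in> borel_measurable lebesgue"
    by (simp add: measurable_completion)
  then show ?thesis
    by (rule measurable_restrict_space1)
qed

text \<open>Only the derivative along \<open>d\<close> is assumed, which spares computing full
  derivatives of composite integrands. The mean value theorem along lines bounds all difference
  quotients by one constant on one ball, so dominated convergence applies. The indicator lets the
  same statement serve the whole space and a box.\<close>

lemma difference_quotient_integral:
  fixes \<psi> D :: "'a::euclidean_space \<Rightarrow> real" and d :: 'a
  assumes deriv: "\<And>x. ((\<lambda>t. \<psi> (x + t *\<^sub>R d)) has_real_derivative D x) (at 0)"
    and cont: "continuous_on UNIV D" "continuous_on UNIV \<psi>"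
    and supp: "compact K" "\<And>x. x \<notin> K \<Longrightarrow> \<psi> x = 0"
    and A: "A \<in> sets borel"
  shows "(\<lambda>n. LINT x|lborel. indicator A x * (real (Suc n) * (\<psi> (x + (1 / real (Suc n)) *\<^sub>R d) - \<psi> x)))
      \<longlonglongrightarrow> (LINT x|lborel. indicator A x * D x)"
    and "integrable lborel D"
proof -
  \<comment> \<open>The derivative at parameter 0 is assumed for every base point; recentring gives
    it at every parameter.\<close>
  have line: "((\<lambda>t. \<psi> (x + t *\<^sub>R d)) has_real_derivative D (x + t *\<^sub>R d)) (at t)" for x t
  proof -
    have "((\<lambda>s. \<psi> ((x + t *\<^sub>R d) + s *\<^sub>R d)) has_real_derivative D (x + t *\<^sub>R d)) (at 0)"
      by (rule deriv)
    then have "((\<lambda>s. \<psi> (x + (t + s) *\<^sub>R d)) has_real_derivative D (x + t *\<^sub>R d)) (at 0)"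
      by (simp add: algebra_simps)
    then show ?thesis
      using DERIV_at_within_shift[of "\<lambda>t. \<psi> (x + t *\<^sub>R d)" "D (x + t *\<^sub>R d)" t 0 UNIV] by simp
  qed
  have D0: "D x = 0" if "x \<notin> K" for x
  proof -
    have "open (- K)"
      using compact_imp_closed[OF supp(1)] by (simp add: open_Compl)
    then have "open ((\<lambda>t. x + t *\<^sub>R d) -` (- K))"
      by (rule open_vimage) (intro continuous_intros)
    then have "\<forall>\<^sub>F t in nhds 0. t \<in> (\<lambda>t. x + t *\<^sub>R d) -` (- K)"
      by (rule eventually_nhds_in_open) (use that in simp)
    then have "\<forall>\<^sub>F t in nhds 0. \<psi> (x + t *\<^sub>R d) = 0"
      by eventually_elim (use supp(2) in auto)
    then have "((\<lambda>t. \<psi> (x + t *\<^sub>R d)) has_real_derivative 0) (at 0)"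
      using DERIV_cong_ev[of "0::real" 0 "\<lambda>t. \<psi> (x + t *\<^sub>R d)" "\<lambda>_. 0" 0 0] by simp
    then show ?thesis
      using deriv DERIV_unique by blast
  qed
  have "bounded (D ` K)"
    by (intro compact_imp_bounded compact_continuous_image supp continuous_on_subset[OF cont(1)]) auto
  then obtain B0 where B0: "\<And>x. x \<in> K \<Longrightarrow> \<bar>D x\<bar> \<le> B0"
    unfolding bounded_iff by fastforce
  define B where "B = max B0 0"
  have B: "\<bar>D x\<bar> \<le> B" for x
    using B0[of x] D0[of x] by (cases "x \<in> K") (auto simp: B_def)
  have B_nonneg: "0 \<le> B"
    by (simp add: B_def)
  have lip: "\<bar>\<psi> (x + s *\<^sub>R d) - \<psi> x\<bar> \<le> B * s" if "0 \<le> s" for x s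
  proof (cases "s = 0")
    case False
    then have "\<exists>z. 0 < z \<and> z < s \<and> \<psi> (x + s *\<^sub>R d) - \<psi> (x + 0 *\<^sub>R d) = (s - 0) * D (x + z *\<^sub>R d)"
      by (intro MVT2 line) (use that in auto)
    then obtain z where "\<psi> (x + s *\<^sub>R d) - \<psi> x = s * D (x + z *\<^sub>R d)"
      by auto
    then show ?thesis
      using mult_left_mono[OF B[of "x + z *\<^sub>R d"] that] that by (simp add: abs_mult mult.commute)
  qed simp
  obtain r where "\<forall>x\<in>K. norm x \<le> r"
    using compact_imp_bounded[OF supp(1)] unfolding bounded_iff by auto
  then have r: "K \<subseteq> cball 0 r"
    by auto
  \<comment> \<open>Enlarging the radius by \<open>norm d\<close> accommodates every shift by
    \<open>(1 / real (Suc n)) *\<^sub>R d\<close>.\<close>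
  define C where "C = cball (0::'a) (r + norm d)"
  define Q where "Q n x = real (Suc n) * (\<psi> (x + (1 / real (Suc n)) *\<^sub>R d) - \<psi> x)" for n x
  have Qbound: "\<bar>Q n x\<bar> \<le> indicator C x * B" for n x
  proof (cases "x \<in> C")
    case True
    have "\<bar>Q n x\<bar> \<le> real (Suc n) * (B * (1 / real (Suc n)))"
      unfolding Q_def abs_mult by (intro mult_mono lip) auto
    then show ?thesis
      using True by simp
  next
    case False
    have "r + norm d < norm x"
      using False by (simp add: C_def)
    moreover have "norm ((1 / real (Suc n)) *\<^sub>R d) \<le> norm d"
      using mult_right_mono[of "1 / real (Suc n)" 1 "norm d"] by simp
    moreover have "norm x \<le> norm (x + (1 / real (Suc n)) *\<^sub>R d) + norm ((1 / real (Suc n)) *\<^sub>R d)"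
      using norm_triangle_ineq4[of "x + (1 / real (Suc n)) *\<^sub>R d" "(1 / real (Suc n)) *\<^sub>R d"] by simp
    ultimately have "r < norm (x + (1 / real (Suc n)) *\<^sub>R d)" "r < norm x"
      using norm_ge_zero[of d] by linarith+
    then have "x + (1 / real (Suc n)) *\<^sub>R d \<notin> K" "x \<notin> K"
      using r by auto
    then show ?thesis
      using supp(2) B_nonneg by (simp add: Q_def)
  qed
  have Qlim: "(\<lambda>n. Q n x) \<longlonglongrightarrow> D x" for x
  proof -
    have "(\<lambda>h. (\<psi> (x + h *\<^sub>R d) - \<psi> x) / h) \<midarrow>0\<rightarrow> D x"
      using deriv[of x] by (simp add: DERIV_def)
    moreover have "filterlim (\<lambda>n. 1 / real (Suc n)) (at 0) sequentially"
    proof (rule filterlim_atI)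
      show "(\<lambda>n. 1 / real (Suc n)) \<longlonglongrightarrow> 0" by real_asymp
    qed auto
    ultimately have "(\<lambda>n. (\<psi> (x + (1 / real (Suc n)) *\<^sub>R d) - \<psi> x) / (1 / real (Suc n))) \<longlonglongrightarrow> D x"
      by (rule filterlim_compose)
    then show ?thesis
      by (simp add: Q_def[abs_def] mult.commute)
  qed
  have [measurable]: "D \<in> borel_measurable borel" "\<psi> \<in> borel_measurable borel"
    using cont by (auto intro: borel_measurable_continuous_onI)
  have [measurable]: "Q n \<in> borel_measurable borel" for n
    unfolding Q_def[abs_def] by measurable
  have "emeasure lborel C < \<infinity>"
    unfolding C_def by (rule emeasure_bounded_finite[OF bounded_cball])
  then have Cint: "integrable lborel (\<lambda>x. indicator C x * B)"
    by (intro integrable_mult_left integrable_real_indicator) (auto simp: C_def)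
  show "integrable lborel D"
  proof (rule Bochner_Integration.integrable_bound[OF Cint])
    show "AE x in lborel. norm (D x) \<le> norm (indicator C x * B)"
    proof (rule AE_I2)
      fix x
      have "\<bar>D x\<bar> \<le> indicator C x * B"
        using tendsto_rabs[OF Qlim[of x]] Qbound[of _ x]
        by (intro LIMSEQ_le_const2) auto
      then show "norm (D x) \<le> norm (indicator C x * B)"
        by simp
    qed
  qed simp
  show "(\<lambda>n. LINT x|lborel. indicator A x * (real (Suc n) * (\<psi> (x + (1 / real (Suc n)) *\<^sub>R d) - \<psi> x)))
      \<longlonglongrightarrow> (LINT x|lborel. indicator A x * D x)"
    unfolding Q_def[symmetric]
  proof (rule integral_dominated_convergence[OF _ _ Cint])
    show "AE x in lborel. (\<lambda>n. indicator A x * Q n x) \<longlonglongrightarrow> indicator A x * D x"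
      by (intro AE_I2 tendsto_intros Qlim)
    show "AE x in lborel. norm (indicator A x * Q n x) \<le> indicator C x * B" for n
    proof (rule AE_I2)
      fix x show "norm (indicator A x * Q n x) \<le> indicator C x * B"
        using Qbound[of n x] B_nonneg by (cases "x \<in> A"; cases "x \<in> C") auto
    qed
  qed (use A in measurable)
qed

text \<open>By translation invariance every difference quotient has integral 0, and so has its
  limit. This takes the place of the divergence theorem.\<close>

lemma integral_derivative_compact_support:
  fixes \<psi> D :: "'a::euclidean_space \<Rightarrow> real" and d :: 'a
  assumes deriv: "\<And>x. ((\<lambda>t. \<psi> (x + t *\<^sub>R d)) has_real_derivative D x) (at 0)"
    and cont: "continuous_on UNIV D" "continuous_on UNIV \<psi>"
    and supp: "compact K" "\<And>x. x \<notin> K \<Longrightarrow> \<psi> x = 0"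
  shows "(LINT x|lborel. D x) = 0"
proof -
  have [measurable]: "\<psi> \<in> borel_measurable borel"
    using cont by (auto intro: borel_measurable_continuous_onI)
  obtain r where "\<forall>x\<in>K. norm x \<le> r"
    using compact_imp_bounded[OF supp(1)] unfolding bounded_iff by auto
  then have r: "K \<subseteq> cball 0 r"
    by auto
  have "bounded (\<psi> ` K)"
    by (intro compact_imp_bounded compact_continuous_image supp continuous_on_subset[OF cont(2)]) auto
  then obtain B where B: "\<And>x. x \<in> K \<Longrightarrow> \<bar>\<psi> x\<bar> \<le> B"
    unfolding bounded_iff by fastforce
  have int: "integrable lborel \<psi>"
  proof (rule Bochner_Integration.integrable_bound)
    show "integrable lborel (\<lambda>x. indicator (cball (0::'a) r) x * B)"
      using emeasure_bounded_finite[OF bounded_cball, of "0::'a" r]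
      by (intro integrable_mult_left integrable_real_indicator) auto
    show "AE x in lborel. norm (\<psi> x) \<le> norm (indicator (cball 0 r) x * B)"
    proof (rule AE_I2)
      fix x show "norm (\<psi> x) \<le> norm (indicator (cball 0 r) x * B)"
        using B[of x] supp(2)[of x] r by (cases "x \<in> K") (auto simp: indicator_def)
    qed
  qed simp
  have int': "integrable lborel (\<lambda>x. \<psi> (x + v))" for v
  proof -
    have "integrable (distr lborel borel ((+) v)) \<psi>"
      using int by (simp add: lborel_distr_plus)
    then show ?thesis
      by (subst (asm) integrable_distr_eq) (auto simp: add.commute)
  qed
  have "(LINT x|lborel. real (Suc n) * (\<psi> (x + v) - \<psi> x)) = 0" for n v
    using int int' by (simp add: Bochner_Integration.integral_diff integral_lborel_translation)
  then have "(LINT x|lborel. indicator UNIV x * (real (Suc n) * (\<psi> (x + (1 / real (Suc n)) *\<^sub>R d) - \<psi> x))) = 0" for n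
    by (simp del: of_nat_Suc)
  with difference_quotient_integral(1)[OF assms, of UNIV] show ?thesis
    by (simp add: LIMSEQ_const_iff)
qed

text \<open>A bound for the flux through the two faces orthogonal to \<open>b\<close>, each of area
  |box| / h with h the edge length along \<open>b\<close>, obtained without surface integrals.
  Shifting the box by s along \<open>b\<close> alters the integral of \<psi> only on a symmetric
  difference of measure 2 s |box| / h; division by s leaves the claim.\<close>

lemma box_integral_derivative_bound:
  fixes \<psi> D :: "'a::euclidean_space \<Rightarrow> real" and b l u :: 'a
  assumes b: "b \<in> Basis" and lu: "\<And>i. i \<in> Basis \<Longrightarrow> l \<bullet> i < u \<bullet> i"
    and deriv: "\<And>x. ((\<lambda>t. \<psi> (x + t *\<^sub>R b)) has_real_derivative D x) (at 0)"
    and cont: "continuous_on UNIV D" "continuous_on UNIV \<psi>"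
    and supp: "compact K" "\<And>x. x \<notin> K \<Longrightarrow> \<psi> x = 0"
    and bound: "\<And>x. \<bar>\<psi> x\<bar> \<le> B"
  shows "(LINT x|lborel. indicator (box l u) x * D x) \<le> 2 * B * measure lborel (box l u) / (u \<bullet> b - l \<bullet> b)"
proof -
  define A where "A = box l u"
  define h where "h = u \<bullet> b - l \<bullet> b"
  have h: "0 < h"
    using lu[OF b] by (simp add: h_def)
  have [measurable]: "\<psi> \<in> borel_measurable borel" "A \<in> sets borel"
    using cont by (auto intro: borel_measurable_continuous_onI simp: A_def)
  have B: "0 \<le> B"
    using bound[of 0] by linarith
  have finA: "emeasure lborel A < \<infinity>"
    unfolding A_def by (rule emeasure_bounded_finite[OF bounded_box])
  have intA: "integrable lborel (indicator A :: 'a \<Rightarrow> real)"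
    using finA by (intro integrable_real_indicator) auto
  have est: "(LINT x|lborel. indicator A x * (\<psi> (x + s *\<^sub>R b) - \<psi> x)) \<le> 2 * B * measure lborel A * s / h"
    if s: "0 < s" "s < h" for s
  proof -
    define A' where "A' = {x. x - s *\<^sub>R b \<in> A}"
    have A'_box: "A' = box (l + s *\<^sub>R b) (u + s *\<^sub>R b)"
      by (auto simp: A'_def A_def mem_box algebra_simps)
    have [measurable]: "A' \<in> sets borel"
      by (simp add: A'_box)
    have int_bd: "integrable lborel (\<lambda>x. indicator S x * \<psi> x)" if "S \<in> sets borel" "emeasure lborel S < \<infinity>" for S
    proof (rule Bochner_Integration.integrable_bound)
      show "integrable lborel (\<lambda>x. indicator S x * B)"
        using that by (intro integrable_mult_left integrable_real_indicator) auto
      show "AE x in lborel. norm (indicator S x * \<psi> x) \<le> norm (indicator S x * B)"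
        using bound B by (auto simp: indicator_def)
    qed (use that in measurable)
    have fin: "emeasure lborel A' < \<infinity>"
      unfolding A'_box by (rule emeasure_bounded_finite[OF bounded_box])
    have shift: "(LINT x|lborel. indicator A x * \<psi> (x + s *\<^sub>R b)) = (LINT x|lborel. indicator A' x * \<psi> x)"
      using integral_lborel_translation[of "\<lambda>x. indicator A' x * \<psi> x" "s *\<^sub>R b"]
      by (simp add: A'_def indicator_def)
    have intsh: "integrable lborel (\<lambda>x. indicator A x * \<psi> (x + s *\<^sub>R b))"
    proof (rule Bochner_Integration.integrable_bound)
      show "integrable lborel (\<lambda>x. indicator A x * B)"
        using intA by simp
      show "AE x in lborel. norm (indicator A x * \<psi> (x + s *\<^sub>R b)) \<le> norm (indicator A x * B)"
        using bound B by (auto simp: indicator_def)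
    qed measurable
    have "(LINT x|lborel. indicator A x * (\<psi> (x + s *\<^sub>R b) - \<psi> x))
        = (LINT x|lborel. indicator A' x * \<psi> x) - (LINT x|lborel. indicator A x * \<psi> x)"
      using intsh int_bd[of A] finA shift by (simp add: algebra_simps Bochner_Integration.integral_diff)
    also have "\<dots> = (LINT x|lborel. (indicator A' x - indicator A x) * \<psi> x)"
      using int_bd[of A] int_bd[of A'] finA fin by (simp add: algebra_simps Bochner_Integration.integral_diff)
    \<comment> \<open>The bracket is the indicator of the symmetric difference of \<open>A\<close>
      and \<open>A'\<close>.\<close>
    also have "\<dots> \<le> (LINT x|lborel. B * (indicator A' x + indicator A x - 2 * indicator (A \<inter> A') x))"
    proof (rule integral_mono)
      show "integrable lborel (\<lambda>x. (indicator A' x - indicator A x) * \<psi> x)"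
        using int_bd[of A] int_bd[of A'] finA fin by (simp add: left_diff_distrib Bochner_Integration.integrable_diff)
      have "emeasure lborel (A \<inter> A') < \<infinity>"
        by (rule le_less_trans[OF emeasure_mono finA]) auto
      then show "integrable lborel (\<lambda>x. B * (indicator A' x + indicator A x - 2 * indicator (A \<inter> A') x))"
        using finA fin
        by (intro integrable_mult_right Bochner_Integration.integrable_diff Bochner_Integration.integrable_add integrable_real_indicator) auto
      show "(indicator A' x - indicator A x) * \<psi> x \<le> B * (indicator A' x + indicator A x - 2 * indicator (A \<inter> A') x)" for x
        using bound[of x] by (auto simp: indicator_def abs_le_iff)
    qed
    also have "\<dots> = B * (measure lborel A' + measure lborel A - 2 * measure lborel (A \<inter> A'))"
    proof -
      have "emeasure lborel (A \<inter> A') < \<infinity>"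
        by (rule le_less_trans[OF emeasure_mono finA]) auto
      then show ?thesis
        using finA fin by (simp add: Bochner_Integration.integral_diff Bochner_Integration.integral_add)
    qed
    also have "measure lborel A' = measure lborel A"
      unfolding A'_box A_def using lu
      by (subst (1 2) measure_lborel_box_eq) (auto simp: inner_add_left less_imp_le)
    also have "measure lborel (A \<inter> A') = measure lborel A * (1 - s / h)"
    proof -
      have *: "A \<inter> A' = box (l + s *\<^sub>R b) u"
      proof -
        have "l \<bullet> i \<le> l \<bullet> i + s * (b \<bullet> i)" "u \<bullet> i \<le> u \<bullet> i + s * (b \<bullet> i)" if "i \<in> Basis" for i
          using that b s by (auto simp: inner_Basis)
        then show ?thesis
          unfolding A'_box A_def by (auto simp: mem_box inner_add_left intro: le_less_trans less_le_trans; fastforce)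
      qed
      have le: "(l + s *\<^sub>R b) \<bullet> i \<le> u \<bullet> i" if "i \<in> Basis" for i
        using that b s lu[OF that] by (auto simp: inner_add_left inner_Basis h_def)
      have "measure lborel (A \<inter> A') = (\<Prod>i\<in>Basis. (u - (l + s *\<^sub>R b)) \<bullet> i)"
        unfolding * using le by (simp add: measure_lborel_box_eq)
      also have "\<dots> = (h - s) * (\<Prod>i\<in>Basis - {b}. (u - l) \<bullet> i)"
      proof -
        have "(\<Prod>i\<in>Basis - {b}. (u - (l + s *\<^sub>R b)) \<bullet> i) = (\<Prod>i\<in>Basis - {b}. (u - l) \<bullet> i)"
          by (rule prod.cong) (use b in \<open>auto simp: inner_add_left inner_diff_left inner_Basis\<close>)
        then show ?thesis
          using prod.remove[OF finite_Basis b, of "\<lambda>i. (u - (l + s *\<^sub>R b)) \<bullet> i"] b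
          by (simp add: h_def inner_diff_left inner_add_left)
      qed
      also have "\<dots> = (1 - s / h) * (h * (\<Prod>i\<in>Basis - {b}. (u - l) \<bullet> i))"
        using h by (simp add: field_simps)
      also have "h * (\<Prod>i\<in>Basis - {b}. (u - l) \<bullet> i) = (\<Prod>i\<in>Basis. (u - l) \<bullet> i)"
        using prod.remove[OF finite_Basis b, of "\<lambda>i. (u - l) \<bullet> i"] by (simp add: h_def inner_diff_left)
      also have "\<dots> = measure lborel A"
        unfolding A_def using lu by (simp add: measure_lborel_box_eq less_imp_le)
      finally show ?thesis
        by simp
    qed
    finally show ?thesis
      by (simp add: field_simps)
  qed
  have "\<forall>\<^sub>F n in sequentially. 1 / real (Suc n) < h"
    using h by real_asymp
  then have ev: "\<forall>\<^sub>F n in sequentially.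
      (LINT x|lborel. indicator A x * (real (Suc n) * (\<psi> (x + (1 / real (Suc n)) *\<^sub>R b) - \<psi> x)))
        \<le> 2 * B * measure lborel A / h"
  proof eventually_elim
    case (elim n)
    define s where "s = 1 / real (Suc n)"
    have s: "0 < s" "s < h" "real (Suc n) = 1 / s"
      using elim by (auto simp: s_def)
    have "(LINT x|lborel. indicator A x * (real (Suc n) * (\<psi> (x + s *\<^sub>R b) - \<psi> x)))
        = (1 / s) * (LINT x|lborel. indicator A x * (\<psi> (x + s *\<^sub>R b) - \<psi> x))"
      unfolding s(3) by (subst integral_mult_right_zero[symmetric]) (simp add: mult_ac)
    also have "\<dots> \<le> (1 / s) * (2 * B * measure lborel A * s / h)"
      using est[OF s(1,2)] s(1) by (intro mult_left_mono) auto
    finally show ?case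
      using s(1) by (simp add: s_def[symmetric] del: of_nat_Suc)
  qed
  have "(LINT x|lborel. indicator A x * D x) \<le> 2 * B * measure lborel A / h"
    by (rule tendsto_upperbound[OF difference_quotient_integral(1)[OF deriv cont supp] ev]) auto
  then show ?thesis
    by (simp add: A_def h_def)
qed

lemma test_functionsD:
  assumes "\<phi> \<in> test_functions \<Omega>"
  shows "smooth \<phi>" "compact (support \<phi>)" "support \<phi> \<subseteq> \<Omega>" "\<And>x. x \<notin> support \<phi> \<Longrightarrow> \<phi> x = 0"
    "\<And>x. x \<notin> \<Omega> \<Longrightarrow> \<phi> x = 0"
proof -
  show "smooth \<phi>" "compact (support \<phi>)" and s: "support \<phi> \<subseteq> \<Omega>"
    using assms by (auto simp: test_functions_def smooth_def)
  show 0: "\<phi> x = 0" if "x \<notin> support \<phi>" for x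
    using that closure_subset[of "{x. \<phi> x \<noteq> 0}"] unfolding support_def by blast
  show "\<phi> x = 0" if "x \<notin> \<Omega>" for x
    using that s 0[of x] by blast
qed

lemma test_functionsI:
  fixes \<phi> :: "'a::euclidean_space \<Rightarrow> real"
  assumes "smooth \<phi>" "compact K" "K \<subseteq> \<Omega>" "\<And>x. x \<notin> K \<Longrightarrow> \<phi> x = 0"
  shows "\<phi> \<in> test_functions \<Omega>"
proof -
  have "{x. \<phi> x \<noteq> 0} \<subseteq> K"
    using assms(4) by blast
  then have "support \<phi> \<subseteq> K"
    unfolding support_def using compact_imp_closed[OF assms(2)] by (rule closure_minimal)
  moreover have "compact (support \<phi>)"
    using compact_Int_closed[OF assms(2), of "support \<phi>"] \<open>support \<phi> \<subseteq> K\<close>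
    by (simp add: support_def Int_absorb1)
  ultimately show ?thesis
    using assms by (auto simp: test_functions_def smooth_def)
qed

text \<open>\<open>Ck_on\<close> speaks of basis directions only, whereas the derivatives taken
  below are mostly along an oblique vector.\<close>

lemma smooth_directional_derivative:
  fixes f :: "'a::euclidean_space \<Rightarrow> real"
  assumes "smooth f"
  shows "smooth (\<lambda>x. frechet_derivative f (at x) d)"
    and "((\<lambda>t. f (x + t *\<^sub>R d)) has_real_derivative frechet_derivative f (at x) d) (at 0)"
    and "frechet_derivative f (at x) d = gradient f x \<bullet> d"
proof -
  have lin: "linear (frechet_derivative f (at x))" for x
    by (rule linear_frechet_derivative[OF smooth_differentiable[OF assms]])
  have sum: "frechet_derivative f (at x) d = (\<Sum>b\<in>Basis. (d \<bullet> b) * frechet_derivative f (at x) b)" for x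
    using Linear_Algebra.linear_componentwise[OF lin, of x d 1] by simp
  show "frechet_derivative f (at x) d = gradient f x \<bullet> d"
    unfolding sum gradient_def inner_sum_left
    by (rule sum.cong) (auto simp: inner_commute mult.commute)
  have *: "smooth (\<lambda>x. \<Sum>b\<in>B. (d \<bullet> b) * frechet_derivative f (at x) b)" if "finite B" "B \<subseteq> Basis" for B
    using that
  proof (induction B rule: finite_induct)
    case (insert b B)
    have "smooth (\<lambda>x. (d \<bullet> b) * frechet_derivative f (at x) b + (\<Sum>b\<in>B. (d \<bullet> b) * frechet_derivative f (at x) b))"
      using insert by (intro smooth_add smooth_mult[OF smooth_const] smooth_frechet_derivative assms) auto
    then show ?case
      using insert by simp
  qed simp
  show "smooth (\<lambda>x. frechet_derivative f (at x) d)"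
    unfolding sum by (rule *) auto
  have l: "((\<lambda>t. x + t *\<^sub>R d) has_derivative (\<lambda>t. t *\<^sub>R d)) (at 0)"
    by (auto intro!: derivative_eq_intros)
  have "((\<lambda>t. f (x + t *\<^sub>R d)) has_derivative (\<lambda>t. frechet_derivative f (at x) (t *\<^sub>R d))) (at 0)"
    using has_derivative_compose[OF l, of f "frechet_derivative f (at x)"] smooth_has_derivative[OF assms, of x] by simp
  then show "((\<lambda>t. f (x + t *\<^sub>R d)) has_real_derivative frechet_derivative f (at x) d) (at 0)"
    by (simp add: has_field_derivative_def linear_scale[OF lin] mult_commute_abs)
qed

lemma gradient_test_function_0:
  assumes "\<phi> \<in> test_functions \<Omega>" "x \<notin> support \<phi>"
  shows "gradient \<phi> x = 0"
proof -
  have "open (- support \<phi>)"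
    by (simp add: support_def open_Compl)
  then have "frechet_derivative \<phi> (at x) = frechet_derivative (\<lambda>_. 0) (at x)"
    using assms(2) test_functionsD[OF assms(1)] smooth_differentiable
    by (intro frechet_derivative_transform_within_open[of _ _ "- support \<phi>"]) auto
  then show ?thesis
    by (simp add: gradient_def)
qed

text \<open>The product of \<theta> with a compactly supported function falls under
  \<open>integral_derivative_compact_support\<close>, so that no boundary condition has to be
  imposed on \<theta> itself.\<close>

lemma integral_by_parts_test_function:
  fixes \<phi> \<theta> D :: "'a::euclidean_space \<Rightarrow> real"
  assumes \<phi>: "\<phi> \<in> test_functions \<Omega>" and \<Omega>: "\<Omega> \<in> sets lebesgue"
    and \<theta>: "\<And>x. ((\<lambda>t. \<theta> (x + t *\<^sub>R d)) has_real_derivative D x) (at 0)"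
    and cont: "continuous_on UNIV \<theta>" "continuous_on UNIV D"
  shows "(LINT x|lebesgue_on \<Omega>. \<theta> x * (gradient \<phi> x \<bullet> d)) = - (LINT x|lebesgue_on \<Omega>. \<phi> x * D x)"
proof -
  note tf = test_functionsD[OF \<phi>]
  let ?D = "\<lambda>x. frechet_derivative \<phi> (at x) d"
  have grad: "gradient \<phi> x \<bullet> d = ?D x" for x
    using smooth_directional_derivative(3)[OF tf(1)] by simp
  have c\<phi>: "continuous_on UNIV \<phi>" "continuous_on UNIV ?D"
    using smooth_continuous tf(1) smooth_directional_derivative(1)[OF tf(1)] by blast+
  have D0: "?D x = 0" if "x \<notin> support \<phi>" for x
    using gradient_test_function_0[OF \<phi> that] grad[of x] by simp
  have d: "((\<lambda>t. \<phi> (x + t *\<^sub>R d) * \<theta> (x + t *\<^sub>R d)) has_real_derivative \<phi> x * D x + ?D x * \<theta> x) (at 0)" for x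
    using DERIV_mult'[OF smooth_directional_derivative(2)[OF tf(1), of x d] \<theta>[of x]] by simp
  have "integral\<^sup>L lborel (\<lambda>x. \<phi> x * D x + ?D x * \<theta> x) = 0"
    by (rule integral_derivative_compact_support[OF d _ _ tf(2)])
       (use tf(4) in \<open>auto intro!: continuous_intros c\<phi> cont\<close>)
  moreover have int: "integrable lborel f" if f: "continuous_on UNIV f" "\<And>x. x \<notin> support \<phi> \<Longrightarrow> f x = 0" for f :: "'a \<Rightarrow> real"
  proof -
    have "integrable lborel (\<lambda>x. indicator (support \<phi>) x *\<^sub>R f x)"
      by (rule borel_integrable_compact[OF tf(2) continuous_on_subset[OF f(1)]]) simp
    moreover have "(\<lambda>x. indicator (support \<phi>) x *\<^sub>R f x) = f"
      using f(2) by (auto simp: fun_eq_iff indicator_def)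
    ultimately show ?thesis by simp
  qed
  ultimately have "(LINT x|lborel. \<phi> x * D x) + (LINT x|lborel. \<theta> x * ?D x) = 0"
    using tf(4) D0
    by (subst (asm) Bochner_Integration.integral_add)
       (auto intro!: int continuous_intros c\<phi> cont simp: mult.commute)
  moreover have "?D x = 0" "\<phi> x = 0" if "x \<notin> \<Omega>" for x
    using that tf D0 by auto
  ultimately show ?thesis
    unfolding grad using \<Omega> c\<phi> cont
    by (subst (1 2) lebesgue_on_integral_eq_lborel)
       (auto intro!: borel_measurable_continuous_onI continuous_intros)
qed

lemma integrable_lebesgue_on_bounded:
  fixes f :: "'a::euclidean_space \<Rightarrow> 'b::{second_countable_topology,banach}"
  assumes "f \<in> borel_measurable (lebesgue_on \<Omega>)" "bounded \<Omega>" "\<Omega> \<in> sets lebesgue"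
    and "\<And>x. x \<in> \<Omega> \<Longrightarrow> norm (f x) \<le> B"
  shows "integrable (lebesgue_on \<Omega>) f"
proof -
  have "emeasure lebesgue \<Omega> \<noteq> \<infinity>"
    using fmeasurableD2[OF bounded_set_imp_lmeasurable[OF assms(2,3)]] by simp
  then interpret finite_measure "lebesgue_on \<Omega>"
    using assms(3) by (intro finite_measureI) (auto simp: emeasure_restrict_space)
  show ?thesis
    by (rule integrable_const_bound[OF AE_I2]) (use assms in auto)
qed

section \<open>Dominated approximation in Sobolev spaces\<close>

text \<open>The majorant is the sum of all terms: it is integrable because the integrals are
  summable, and wherever it converges the terms tend to 0.\<close>

lemma summable_imp_dominated:
  fixes e :: "nat \<Rightarrow> 'x \<Rightarrow> real"
  assumes int: "\<And>n. integrable M (e n)" and nn: "\<And>n x. 0 \<le> e n x"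
    and sum: "summable (\<lambda>n. LINT x|M. e n x)"
  obtains E where "integrable M E" "AE x in M. \<forall>n. e n x \<le> E x" "AE x in M. (\<lambda>n. e n x) \<longlonglongrightarrow> 0"
proof -
  have [measurable]: "e n \<in> borel_measurable M" for n
    using int by auto
  have "(\<integral>\<^sup>+x. (\<Sum>n. ennreal (e n x)) \<partial>M) = (\<Sum>n. \<integral>\<^sup>+x. ennreal (e n x) \<partial>M)"
    by (rule nn_integral_suminf) simp
  also have "\<dots> = (\<Sum>n. ennreal (LINT x|M. e n x))"
    using int nn by (simp add: nn_integral_eq_integral)
  also have "\<dots> < \<infinity>"
  proof -
    have I: "0 \<le> (LINT x|M. e n x)" for n
      by (rule Bochner_Integration.integral_nonneg) (rule nn)
    show ?thesis
      unfolding suminf_ennreal2[OF I sum] by (rule ennreal_less_top[unfolded infinity_ennreal_def[symmetric]])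
  qed
  finally have "AE x in M. (\<Sum>n. ennreal (e n x)) \<noteq> \<infinity>"
    by (intro nn_integral_PInf_AE) auto
  then have S: "AE x in M. summable (\<lambda>n. e n x)"
    by eventually_elim (use nn in \<open>auto intro: summable_suminf_not_top\<close>)
  show ?thesis
  proof
    show "integrable M (\<lambda>x. \<Sum>n. e n x)"
      by (rule integrable_suminf) (use int S sum nn in auto)
    show "AE x in M. \<forall>n. e n x \<le> (\<Sum>n. e n x)"
      using S
    proof eventually_elim
      case (elim x)
      show ?case
        using sum_le_suminf[OF elim, of "{n}" for n] nn by auto
    qed
    show "AE x in M. (\<lambda>n. e n x) \<longlonglongrightarrow> 0"
      using S by eventually_elim (rule summable_LIMSEQ_zero)
  qed
qed

lemma powr_add_le:
  fixes a b p :: real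
  assumes "0 \<le> a" "0 \<le> b" "0 \<le> p"
  shows "(a + b) powr p \<le> 2 powr p * (a powr p + b powr p)"
proof -
  have "(a + b) powr p \<le> (2 * max a b) powr p"
    by (rule powr_mono2) (use assms in auto)
  also have "\<dots> = 2 powr p * max a b powr p"
    using assms by (simp add: powr_mult)
  also have "\<dots> \<le> 2 powr p * (a powr p + b powr p)"
    by (intro mult_left_mono) (auto simp: max_def)
  finally show ?thesis .
qed

text \<open>Along indices whose error is below 2^(-k) the errors, measured in p-th powers, are
  summable. This yields a single integrable majorant together with convergence almost everywhere of
  functions and gradients. Every later passage from test functions to Sobolev functions is then
  dominated convergence, also inside the nonlinear \<open>F\<close>.\<close>

lemma sobolev0_dominated_approximation:
  fixes u :: "'a::euclidean_space \<Rightarrow> real"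
  assumes S: "sobolev0 p \<Omega> u g" and \<Omega>: "bounded \<Omega>" "\<Omega> \<in> sets lebesgue" and p: "1 < p"
  obtains \<phi> E where "\<And>n::nat. \<phi> n \<in> test_functions \<Omega>" "integrable (lebesgue_on \<Omega>) E"
    "AE x in lebesgue_on \<Omega>. \<forall>n. \<bar>\<phi> n x\<bar> powr p + norm (gradient (\<phi> n) x) powr p \<le> E x"
    "AE x in lebesgue_on \<Omega>. (\<lambda>n. \<phi> n x) \<longlonglongrightarrow> u x"
    "AE x in lebesgue_on \<Omega>. (\<lambda>n. gradient (\<phi> n) x) \<longlonglongrightarrow> g x"
proof -
  let ?M = "lebesgue_on \<Omega>"
  have u: "u \<in> borel_measurable ?M" "integrable ?M (\<lambda>x. \<bar>u x\<bar> powr p)"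
    and g: "g \<in> borel_measurable ?M" "integrable ?M (\<lambda>x. norm (g x) powr p)"
    using S by (auto simp: sobolev0_def sobolev_def)
  note [measurable] = u(1) g(1)
  obtain \<phi> where \<phi>: "\<And>n::nat. \<phi> n \<in> test_functions \<Omega>"
    and lim: "(\<lambda>n. (LINT x|?M. \<bar>\<phi> n x - u x\<bar> powr p) +
             (LINT x|?M. norm (gradient (\<phi> n) x - g x) powr p)) \<longlonglongrightarrow> 0"
    using S unfolding sobolev0_def by blast
  have grad_cont: "continuous_on UNIV (gradient (\<phi> n))" for n
    unfolding gradient_def[abs_def]
    by (intro continuous_intros smooth_continuous smooth_directional_derivative(1) test_functionsD(1)[OF \<phi>])
  have \<phi>_cont: "continuous_on UNIV (\<phi> n)" for n
    by (intro smooth_continuous test_functionsD(1)[OF \<phi>])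
  have [measurable]: "\<phi> n \<in> borel_measurable ?M" "gradient (\<phi> n) \<in> borel_measurable ?M" for n
    using continuous_imp_borel_lebesgue_on grad_cont \<phi>_cont by blast+
  have bd: "\<exists>B. \<forall>x\<in>\<Omega>. norm (f x) \<le> B" if "continuous_on UNIV f" for f :: "'a \<Rightarrow> 'c::real_normed_vector"
  proof -
    have "compact (f ` closure \<Omega>)"
      using \<Omega>(1) by (intro compact_continuous_image continuous_on_subset[OF that]) (auto simp: compact_closure)
    then have "bounded (f ` closure \<Omega>)"
      by (rule compact_imp_bounded)
    then show ?thesis
      unfolding bounded_iff using closure_subset[of \<Omega>] by blast
  qed
  have int_powr: "integrable ?M (\<lambda>x. norm (f x) powr p)"
    if f: "continuous_on UNIV f" and [measurable]: "f \<in> borel_measurable ?M" for f :: "'a \<Rightarrow> 'c::{second_countable_topology,real_normed_vector}"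
  proof -
    obtain B where "\<forall>x\<in>\<Omega>. norm (f x) \<le> B"
      using bd[OF f] by blast
    then show ?thesis
      by (intro integrable_lebesgue_on_bounded[OF _ \<Omega>, of _ "B powr p"]) (use p in \<open>auto intro!: powr_mono2\<close>)
  qed
  have int_diff: "integrable ?M (\<lambda>x. norm (f x - v x) powr p)"
    if "integrable ?M (\<lambda>x. norm (f x) powr p)" "integrable ?M (\<lambda>x. norm (v x) powr p)"
      and [measurable]: "f \<in> borel_measurable ?M" "v \<in> borel_measurable ?M"
    for f v :: "'a \<Rightarrow> 'c::{second_countable_topology,real_normed_vector}"
  proof (rule Bochner_Integration.integrable_bound)
    show "integrable ?M (\<lambda>x. 2 powr p * (norm (f x) powr p + norm (v x) powr p))"
      using that by (intro integrable_mult_right Bochner_Integration.integrable_add)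
    show "AE x in ?M. norm (norm (f x - v x) powr p) \<le> norm (2 powr p * (norm (f x) powr p + norm (v x) powr p))"
    proof (rule AE_I2)
      fix x
      have "norm (f x - v x) powr p \<le> (norm (f x) + norm (v x)) powr p"
        by (rule powr_mono2) (use p norm_triangle_ineq4 in auto)
      also have "\<dots> \<le> 2 powr p * (norm (f x) powr p + norm (v x) powr p)"
        by (rule powr_add_le) (use p in auto)
      finally show "norm (norm (f x - v x) powr p) \<le> norm (2 powr p * (norm (f x) powr p + norm (v x) powr p))"
        by simp
    qed
  qed measurable
  define e where "e n x = \<bar>\<phi> n x - u x\<bar> powr p + norm (gradient (\<phi> n) x - g x) powr p" for n x
  have i1: "integrable ?M (\<lambda>x. \<bar>\<phi> n x - u x\<bar> powr p)" for n
    using int_diff[of "\<phi> n" u] int_powr[OF \<phi>_cont, of n] u by simp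
  have i2: "integrable ?M (\<lambda>x. norm (gradient (\<phi> n) x - g x) powr p)" for n
    using int_diff[of "gradient (\<phi> n)" g] int_powr[OF grad_cont, of n] g by simp
  have e_int: "integrable ?M (e n)" for n
    unfolding e_def[abs_def] by (intro Bochner_Integration.integrable_add i1 i2)
  have "(\<lambda>n. LINT x|?M. e n x) \<longlonglongrightarrow> 0"
    using lim by (simp add: e_def Bochner_Integration.integral_add i1 i2)
  then have "\<forall>\<^sub>F n in sequentially. (LINT x|?M. e n x) < (1 / 2) ^ k" for k
    by (rule order_tendstoD) simp
  then have "\<exists>n. (LINT x|?M. e n x) < (1 / 2) ^ k" for k
    by (meson eventually_sequentially order_refl)
  \<comment> \<open>The indices need not increase; the argument rests on summability of the errors
    alone.\<close>
  then obtain r where r: "\<And>k. (LINT x|?M. e (r k) x) < (1 / 2) ^ k"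
    by metis
  have e_nonneg: "0 \<le> e n x" for n x
    by (simp add: e_def)
  have "summable (\<lambda>k. LINT x|?M. e (r k) x)"
    by (rule summable_comparison_test'[OF summable_geometric[of "1/2::real"], of 0])
       (use r e_nonneg in \<open>auto simp: less_imp_le integral_nonneg_AE\<close>)
  then obtain E where E: "integrable ?M E" "AE x in ?M. \<forall>n. e (r n) x \<le> E x" "AE x in ?M. (\<lambda>n. e (r n) x) \<longlonglongrightarrow> 0"
    by (rule summable_imp_dominated[of ?M "\<lambda>n. e (r n)", OF e_int e_nonneg])
  have root: "(\<lambda>n. a n) \<longlonglongrightarrow> 0" if "(\<lambda>n. a n powr p) \<longlonglongrightarrow> 0" "\<And>n. 0 \<le> a n" for a :: "nat \<Rightarrow> real"
  proof -
    have "(\<lambda>n. (a n powr p) powr (1 / p)) \<longlonglongrightarrow> 0"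
      by (rule tendsto_zero_powrI[OF that(1) tendsto_const]) (use p in auto)
    then show ?thesis
      using that(2) p by (simp add: powr_powr)
  qed
  show ?thesis
  proof (rule that[of "\<lambda>n. \<phi> (r n)" "\<lambda>x. 2 powr p * (E x + \<bar>u x\<bar> powr p + norm (g x) powr p)"])
    show "\<phi> (r n) \<in> test_functions \<Omega>" for n
      by (rule \<phi>)
    show "integrable ?M (\<lambda>x. 2 powr p * (E x + \<bar>u x\<bar> powr p + norm (g x) powr p))"
      using E(1) u(2) g(2) by (intro integrable_mult_right Bochner_Integration.integrable_add)
    show "AE x in ?M. \<forall>n. \<bar>\<phi> (r n) x\<bar> powr p + norm (gradient (\<phi> (r n)) x) powr p
        \<le> 2 powr p * (E x + \<bar>u x\<bar> powr p + norm (g x) powr p)"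
      using E(2)
    proof eventually_elim
      case (elim x)
      have "norm v powr p \<le> 2 powr p * (norm (v - w) powr p + norm w powr p)" for v w :: "'c::real_normed_vector"
      proof -
        have "norm v powr p \<le> (norm (v - w) + norm w) powr p"
          by (rule powr_mono2) (use p norm_triangle_sub[of v w] in \<open>auto simp: add.commute\<close>)
        also have "\<dots> \<le> 2 powr p * (norm (v - w) powr p + norm w powr p)"
          by (rule powr_add_le) (use p in auto)
        finally show ?thesis .
      qed note * = this
      have "\<bar>\<phi> (r n) x\<bar> powr p + norm (gradient (\<phi> (r n)) x) powr p
        \<le> 2 powr p * (e (r n) x + \<bar>u x\<bar> powr p + norm (g x) powr p)" for n
        using *[of "\<phi> (r n) x" "u x"] *[of "gradient (\<phi> (r n)) x" "g x"]
        by (simp add: e_def algebra_simps)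
      moreover have "2 powr p * (e (r n) x + \<bar>u x\<bar> powr p + norm (g x) powr p)
          \<le> 2 powr p * (E x + \<bar>u x\<bar> powr p + norm (g x) powr p)" for n
        using elim by (intro mult_left_mono) auto
      ultimately show ?case
        using order_trans by blast
    qed
    show "AE x in ?M. (\<lambda>n. \<phi> (r n) x) \<longlonglongrightarrow> u x"
      using E(3)
    proof eventually_elim
      case (elim x)
      have "(\<lambda>n. \<bar>\<phi> (r n) x - u x\<bar> powr p) \<longlonglongrightarrow> 0"
        by (rule Lim_null_comparison[OF _ elim]) (auto simp: e_def)
      then have "(\<lambda>n. \<bar>\<phi> (r n) x - u x\<bar>) \<longlonglongrightarrow> 0"
        by (rule root) simp
      then show ?case
        by (simp add: tendsto_rabs_zero_iff LIM_zero_iff)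
    qed
    show "AE x in ?M. (\<lambda>n. gradient (\<phi> (r n)) x) \<longlonglongrightarrow> g x"
      using E(3)
    proof eventually_elim
      case (elim x)
      have "(\<lambda>n. norm (gradient (\<phi> (r n)) x - g x) powr p) \<longlonglongrightarrow> 0"
        by (rule Lim_null_comparison[OF _ elim]) (auto simp: e_def)
      then have "(\<lambda>n. norm (gradient (\<phi> (r n)) x - g x)) \<longlonglongrightarrow> 0"
        by (rule root) simp
      then show ?case
        by (simp add: tendsto_norm_zero_iff LIM_zero_iff)
    qed
  qed
qed

section \<open>Rules for the gradient\<close>

lemma gradient_eqI:
  fixes f :: "'a::euclidean_space \<Rightarrow> real"
  assumes "(f has_derivative (\<lambda>h. v \<bullet> h)) (at x)"
  shows "gradient f x = v"
proof -
  have "frechet_derivative f (at x) = (\<lambda>h. v \<bullet> h)"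
    by (rule frechet_derivative_at[OF assms, symmetric])
  then show ?thesis
    by (simp add: gradient_def euclidean_representation)
qed

lemma has_derivative_gradient:
  fixes f :: "'a::euclidean_space \<Rightarrow> real"
  assumes "f differentiable (at x)"
  shows "(f has_derivative (\<lambda>h. gradient f x \<bullet> h)) (at x)"
proof -
  have D: "(f has_derivative frechet_derivative f (at x)) (at x)"
    using assms by (simp add: frechet_derivative_works)
  have "frechet_derivative f (at x) h = gradient f x \<bullet> h" for h
    using Linear_Algebra.linear_componentwise[OF linear_frechet_derivative[OF assms], of h 1]
    unfolding gradient_def inner_sum_left by (simp add: inner_commute mult.commute)
  then have "frechet_derivative f (at x) = (\<lambda>h. gradient f x \<bullet> h)"
    by (rule ext)
  with D show ?thesis
    by simp
qed

lemma gradient_mult: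
  fixes f g :: "'a::euclidean_space \<Rightarrow> real"
  assumes "smooth f" "smooth g"
  shows "gradient (\<lambda>x. f x * g x) x = f x *\<^sub>R gradient g x + g x *\<^sub>R gradient f x"
proof (rule gradient_eqI)
  have "((\<lambda>x. f x * g x) has_derivative (\<lambda>h. f x * (gradient g x \<bullet> h) + (gradient f x \<bullet> h) * g x)) (at x)"
    by (intro has_derivative_mult has_derivative_gradient smooth_differentiable assms)
  then show "((\<lambda>x. f x * g x) has_derivative (\<lambda>h. (f x *\<^sub>R gradient g x + g x *\<^sub>R gradient f x) \<bullet> h)) (at x)"
    by (simp add: inner_add_left mult.commute)
qed

lemma gradient_diff:
  fixes f g :: "'a::euclidean_space \<Rightarrow> real"
  assumes "smooth f" "smooth g"
  shows "gradient (\<lambda>x. f x - g x) x = gradient f x - gradient g x"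
proof (rule gradient_eqI)
  have "((\<lambda>x. f x - g x) has_derivative (\<lambda>h. gradient f x \<bullet> h - gradient g x \<bullet> h)) (at x)"
    by (intro has_derivative_diff has_derivative_gradient smooth_differentiable assms)
  then show "((\<lambda>x. f x - g x) has_derivative (\<lambda>h. (gradient f x - gradient g x) \<bullet> h)) (at x)"
    by (simp add: inner_diff_left)
qed

lemma gradient_compose:
  fixes f :: "'a::euclidean_space \<Rightarrow> real" and h :: "real \<Rightarrow> real"
  assumes "smooth h" "smooth f"
  shows "gradient (\<lambda>x. h (f x)) x = deriv h (f x) *\<^sub>R gradient f x"
proof (rule gradient_eqI)
  have "((\<lambda>x. h (f x)) has_derivative (\<lambda>v. deriv h (f x) * (gradient f x \<bullet> v))) (at x)"
    by (rule has_derivative_compose[OF has_derivative_gradient[OF smooth_differentiable[OF assms(2)]]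
          smooth_realD(1)[OF assms(1), unfolded has_field_derivative_def]])
  then show "((\<lambda>x. h (f x)) has_derivative (\<lambda>v. (deriv h (f x) *\<^sub>R gradient f x) \<bullet> v)) (at x)"
    by simp
qed

section \<open>Convex homogeneous integrands and the box\<close>

text \<open>Collects the first-order properties of \<open>F\<close> on which the comparison with the
  slab rests, together with the slab normal \<open>e\<close>, a basis vector so that the boxes
  become coordinate boxes.\<close>

locale anisotropy =
  fixes F :: "'a::euclidean_space \<Rightarrow> real" and p q :: real and e :: 'a
  assumes p: "1 < p" and q: "q = p / (p - 1)"
    and F_nonneg: "0 \<le> F \<xi>"
    and F_convex: "convex_on UNIV F"
    and F_homogeneous: "F (t *\<^sub>R \<xi>) = \<bar>t\<bar> * F \<xi>"
    and F_lower: "\<exists>a0>0. \<forall>\<xi>. a0 * norm \<xi> \<le> F \<xi>"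
    and F_differentiable: "\<xi> \<noteq> 0 \<Longrightarrow> F differentiable (at \<xi>)"
    and gradient_F_continuous: "continuous_on (-{0}) (gradient F)"
    and e: "e \<in> Basis"
begin

lemmas pq = conjugate_exponent[OF p q]

lemma F_0 [simp]: "F 0 = 0"
  using F_homogeneous[of 0 0] by simp

lemma F_pos: "\<xi> \<noteq> 0 \<Longrightarrow> 0 < F \<xi>"
proof -
  assume "\<xi> \<noteq> 0"
  obtain a0 where "0 < a0" "a0 * norm \<xi> \<le> F \<xi>"
    using F_lower by blast
  moreover have "0 < a0 * norm \<xi>"
    using \<open>0 < a0\<close> \<open>\<xi> \<noteq> 0\<close> by simp
  ultimately show ?thesis
    by linarith
qed

lemma F_minus [simp]: "F (- \<xi>) = F \<xi>"
  using F_homogeneous[of "-1" \<xi>] by simp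

lemma F_triangle: "F (x + y) \<le> F x + F y"
proof -
  have "F ((1 - 1/2) *\<^sub>R (2 *\<^sub>R x) + (1/2) *\<^sub>R (2 *\<^sub>R y)) \<le> (1 - 1/2) * F (2 *\<^sub>R x) + (1/2) * F (2 *\<^sub>R y)"
    by (rule convex_onD[OF F_convex]) auto
  then show ?thesis
    by (simp add: F_homogeneous)
qed

lemma F_sum: "finite I \<Longrightarrow> F (\<Sum>i\<in>I. f i) \<le> (\<Sum>i\<in>I. F (f i))"
proof (induction I rule: finite_induct)
  case (insert i I)
  then show ?case
    using F_triangle[of "f i" "\<Sum>i\<in>I. f i"] by simp
qed simp

definition upper :: real where "upper = (\<Sum>b\<in>Basis. F b)"

lemma upper_nonneg: "0 \<le> upper"
  by (simp add: upper_def sum_nonneg F_nonneg)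

lemma F_le_upper: "b \<in> Basis \<Longrightarrow> F b \<le> upper"
  unfolding upper_def by (rule member_le_sum) (auto simp: F_nonneg)

lemma F_upper: "F \<xi> \<le> upper * norm \<xi>"
proof -
  have "F \<xi> = F (\<Sum>b\<in>Basis. (\<xi> \<bullet> b) *\<^sub>R b)"
    by (simp add: euclidean_representation)
  also have "\<dots> \<le> (\<Sum>b\<in>Basis. F ((\<xi> \<bullet> b) *\<^sub>R b))"
    by (rule F_sum) simp
  also have "\<dots> = (\<Sum>b\<in>Basis. \<bar>\<xi> \<bullet> b\<bar> * F b)"
    by (simp add: F_homogeneous)
  also have "\<dots> \<le> (\<Sum>b\<in>Basis. norm \<xi> * F b)"
    by (intro sum_mono mult_right_mono Basis_le_norm F_nonneg) auto
  finally show ?thesis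
    by (simp add: upper_def sum_distrib_left mult.commute)
qed

lemma F_continuous: "continuous_on S F"
proof -
  have "\<bar>F x - F y\<bar> \<le> upper * dist x y" for x y
  proof -
    have "F x \<le> F y + F (x - y)" "F y \<le> F x + F (y - x)"
      using F_triangle[of y "x - y"] F_triangle[of x "y - x"] by simp_all
    moreover have "F (y - x) = F (x - y)"
      using F_minus[of "x - y"] by simp
    ultimately show ?thesis
      using F_upper[of "x - y"] by (simp add: dist_norm abs_le_iff)
  qed
  then have "upper-lipschitz_on S F"
    using upper_nonneg by (intro lipschitz_onI) (auto simp: dist_real_def)
  then show ?thesis
    by (rule lipschitz_on_continuous_on)
qed

text \<open>Subadditivity bounds the difference quotients of \<open>F\<close> along \<zeta> by
  \<open>F \<zeta>\<close>, evenness adds the absolute value, and homogeneity along \<xi> gives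
  Euler's identity. Together: \<open>gradient F \<xi>\<close> has polar norm 1 and is the functional
  at which duality with \<xi> is an equality.\<close>

lemma gradient_F_le:
  assumes "\<xi> \<noteq> 0"
  shows "gradient F \<xi> \<bullet> \<zeta> \<le> F \<zeta>" and "\<bar>gradient F \<xi> \<bullet> \<zeta>\<bar> \<le> F \<zeta>" and "gradient F \<xi> \<bullet> \<xi> = F \<xi>"
proof -
  have D: "((\<lambda>t. F (\<xi> + t *\<^sub>R \<zeta>)) has_real_derivative gradient F \<xi> \<bullet> \<zeta>) (at 0)" for \<zeta>
  proof -
    have l: "((\<lambda>t. \<xi> + t *\<^sub>R \<zeta>) has_derivative (\<lambda>t. t *\<^sub>R \<zeta>)) (at 0)"
      by (auto intro!: derivative_eq_intros)
    have "((\<lambda>t. F (\<xi> + t *\<^sub>R \<zeta>)) has_derivative (\<lambda>t. gradient F \<xi> \<bullet> (t *\<^sub>R \<zeta>))) (at 0)"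
      using has_derivative_compose[OF l, of F "\<lambda>h. gradient F \<xi> \<bullet> h"]
        has_derivative_gradient[OF F_differentiable[OF assms]] by simp
    then show ?thesis
      by (simp add: has_field_derivative_def mult_commute_abs)
  qed
  show le: "gradient F \<xi> \<bullet> \<zeta> \<le> F \<zeta>" for \<zeta>
  proof -
    have "((\<lambda>h. (F (\<xi> + h *\<^sub>R \<zeta>) - F \<xi>) / h) \<longlongrightarrow> gradient F \<xi> \<bullet> \<zeta>) (at_right 0)"
      using D[of \<zeta>] by (auto simp: DERIV_def intro: filterlim_mono at_le)
    moreover have "\<forall>\<^sub>F h in at_right 0. (F (\<xi> + h *\<^sub>R \<zeta>) - F \<xi>) / h \<le> F \<zeta>"
      using eventually_at_right_less[of 0]
    proof eventually_elim
      case (elim h)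
      then show ?case
        using F_triangle[of \<xi> "h *\<^sub>R \<zeta>"] by (simp add: F_homogeneous field_simps)
    qed
    ultimately show ?thesis
      by (rule tendsto_upperbound) simp
  qed
  show "\<bar>gradient F \<xi> \<bullet> \<zeta>\<bar> \<le> F \<zeta>"
    using le[of \<zeta>] le[of "- \<zeta>"] by (simp add: abs_le_iff)
  have D1: "((\<lambda>t. (1 + t) * F \<xi>) has_real_derivative F \<xi>) (at 0)"
    by (auto intro!: derivative_eq_intros)
  have "\<forall>\<^sub>F t in nhds 0. t \<in> {-1<..<1::real}"
    by (rule eventually_nhds_in_open) auto
  then have ev: "\<forall>\<^sub>F t in nhds 0. (1 + t) * F \<xi> = F (\<xi> + t *\<^sub>R \<xi>)"
  proof eventually_elim
    case (elim t)
    then show ?case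
      using F_homogeneous[of "1 + t" \<xi>] by (simp add: scaleR_add_left)
  qed
  have "((\<lambda>t. F (\<xi> + t *\<^sub>R \<xi>)) has_real_derivative F \<xi>) (at 0)"
    using D1 by (rule DERIV_cong_ev[OF refl ev refl, THEN iffD1])
  then show "gradient F \<xi> \<bullet> \<xi> = F \<xi>"
    using D[of \<xi>] DERIV_unique by blast
qed

text \<open>The gradient of F^p / p, whose divergence is the anisotropic p-Laplacian. At the origin
  the power factor is 0, so the field is 0 there.\<close>

definition field :: "'a \<Rightarrow> 'a" where
  "field \<xi> = F \<xi> powr (p - 1) *\<^sub>R gradient F \<xi>"

lemma field_le: "\<bar>field \<xi> \<bullet> \<zeta>\<bar> \<le> F \<xi> powr (p - 1) * F \<zeta>"
  using gradient_F_le(2)[of \<xi> \<zeta>]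
  by (cases "\<xi> = 0") (simp_all add: field_def abs_mult mult_left_mono)

lemma field_self: "field \<xi> \<bullet> \<xi> = F \<xi> powr p"
proof (cases "\<xi> = 0")
  case False
  then have "F \<xi> powr (p - 1) * F \<xi> = F \<xi> powr p"
    using F_pos[of \<xi>] by (simp add: powr_diff)
  then show ?thesis
    using False gradient_F_le(3) by (simp add: field_def)
qed (simp add: field_def)

lemma field_borel_measurable [measurable]: "field \<in> borel_measurable borel"
proof -
  have "continuous_on (-{0}) field"
    unfolding field_def[abs_def]
    by (intro continuous_intros gradient_F_continuous continuous_on_powr' F_continuous)
       (use F_pos in \<open>auto simp: F_nonneg less_imp_neq[symmetric]\<close>)
  then have "(\<lambda>\<xi>. if \<xi> \<in> -{0} then field \<xi> else 0) \<in> borel_measurable borel"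
    by (intro borel_measurable_continuous_on_if) auto
  moreover have "(\<lambda>\<xi>. if \<xi> \<in> -{0} then field \<xi> else 0) = field"
    by (auto simp: fun_eq_iff field_def)
  ultimately show ?thesis
    by simp
qed

lemma F_borel_measurable [measurable]: "F \<in> borel_measurable borel"
  by (intro borel_measurable_continuous_onI F_continuous)

definition c :: real where "c = F e"
text \<open>The direction dual to \<open>e\<close>: it has polar norm 1 and
  \<open>w \<bullet> e = F e\<close>, but in general it is not parallel to \<open>e\<close>. Moving
  by t along it changes \<open>ht\<close> by t, which is why the one-dimensional derivatives are
  taken along \<open>w\<close>.\<close>

definition w :: 'a where "w = gradient F e"
definition ht :: "'a \<Rightarrow> real" where "ht x = (x \<bullet> e) / c"

lemma c_pos: "0 < c"
  using F_pos[OF nonzero_Basis[OF e]] by (simp add: c_def)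

lemma w_le: "\<bar>w \<bullet> \<xi>\<bar> \<le> F \<xi>"
  unfolding w_def by (rule gradient_F_le(2)[OF nonzero_Basis[OF e]])

lemma w_e: "w \<bullet> e = c"
  unfolding w_def c_def by (rule gradient_F_le(3)[OF nonzero_Basis[OF e]])

lemma ht_add_w: "ht (x + t *\<^sub>R w) = ht x + t"
  using w_e c_pos by (simp add: ht_def inner_add_left field_simps)

lemma smooth_ht: "smooth ht"
proof -
  have "smooth (\<lambda>x::'a. (1 / c) * (x \<bullet> e))"
    by (rule smooth_mult[OF smooth_const smooth_inner])
  then show ?thesis
    by (simp add: ht_def[abs_def])
qed

lemma ht_continuous: "continuous_on S ht"
  by (rule smooth_continuous[OF smooth_ht])

lemma gradient_ht: "gradient ht x = (1 / c) *\<^sub>R e"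
proof (rule gradient_eqI)
  show "(ht has_derivative (\<lambda>h. ((1 / c) *\<^sub>R e) \<bullet> h)) (at x)"
    unfolding ht_def[abs_def] using c_pos by (auto intro!: derivative_eq_intros simp: inner_commute)
qed

lemma F_gradient_ht: "F (gradient ht x) = 1"
  using c_pos by (simp add: gradient_ht F_homogeneous flip: c_def)

lemma w_gradient_ht: "w \<bullet> gradient ht x = 1"
  using c_pos w_e by (simp add: gradient_ht)

text \<open>The linear lower bound on \<open>F\<close> makes the supremum in \<open>polar\<close>
  one of a bounded set; otherwise a real-valued \<open>SUP\<close> carries no information.\<close>

lemma polar_bdd: "bdd_above ((\<lambda>\<xi>. (\<xi> \<bullet> v) / F \<xi>) ` (-{0}))"
proof -
  obtain a0 where a0: "0 < a0" "\<And>\<xi>. a0 * norm \<xi> \<le> F \<xi>"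
    using F_lower by blast
  show ?thesis
  proof (rule bdd_aboveI2)
    fix \<xi> :: 'a
    assume "\<xi> \<in> -{0}"
    then have "0 < F \<xi>" using F_pos by simp
    have "\<xi> \<bullet> v \<le> norm \<xi> * norm v"
      by (rule norm_cauchy_schwarz)
    also have "\<dots> \<le> (F \<xi> / a0) * norm v"
      using a0(1) a0(2)[of \<xi>] by (intro mult_right_mono) (auto simp: field_simps)
    finally show "(\<xi> \<bullet> v) / F \<xi> \<le> norm v / a0"
      using \<open>0 < F \<xi>\<close> a0(1) by (simp add: field_simps)
  qed
qed

lemma polar_duality: "\<xi> \<bullet> v \<le> F \<xi> * polar F v"
proof (cases "\<xi> = 0")
  case False
  then have "(\<xi> \<bullet> v) / F \<xi> \<le> polar F v"
    unfolding polar_def by (intro cSUP_upper polar_bdd) simp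
  then show ?thesis
    using F_pos[OF False] by (simp add: field_simps)
qed simp

lemma polar_nonneg: "0 \<le> polar F v"
proof -
  have "e \<bullet> v \<le> F e * polar F v" "(- e) \<bullet> v \<le> F (- e) * polar F v"
    by (rule polar_duality)+
  then have "0 \<le> c * polar F v"
    by (simp add: c_def)
  then show ?thesis
    using c_pos by (simp add: zero_le_mult_iff)
qed

lemma polar_scaleR_w: "polar F (t *\<^sub>R w) \<le> \<bar>t\<bar>"
  unfolding polar_def
proof (rule cSUP_least)
  have "e \<in> -{0}"
    using e nonzero_Basis by auto
  then show "-{0::'a} \<noteq> {}"
    by blast
  fix \<xi> :: 'a
  assume "\<xi> \<in> -{0}"
  then have F: "0 < F \<xi>"
    using F_pos by simp
  have "\<xi> \<bullet> (t *\<^sub>R w) \<le> \<bar>t\<bar> * \<bar>w \<bullet> \<xi>\<bar>"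
    by (simp add: inner_commute flip: abs_mult)
  also have "\<dots> \<le> \<bar>t\<bar> * F \<xi>"
    by (intro mult_left_mono w_le) simp
  finally show "(\<xi> \<bullet> (t *\<^sub>R w)) / F \<xi> \<le> \<bar>t\<bar>"
    using F by (simp add: field_simps)
qed

text \<open>The extent \<open>c * r\<close> along \<open>e\<close> is chosen so that the closed box
  reads |ht x| \<le> r there. Values of r other than 1 describe the supports of cutoffs.\<close>

definition corner :: "real \<Rightarrow> real \<Rightarrow> 'a" where
  "corner r k = (\<Sum>b\<in>Basis. (if b = e then c * r else k) *\<^sub>R b)"

definition \<Omega> :: "real \<Rightarrow> 'a set" where
  "\<Omega> k = box (- corner 1 k) (corner 1 k)"

lemma corner_inner: "b \<in> Basis \<Longrightarrow> corner r k \<bullet> b = (if b = e then c * r else k)"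
  by (simp add: corner_def)

lemma mem_\<Omega>: "x \<in> \<Omega> k \<longleftrightarrow> \<bar>ht x\<bar> < 1 \<and> (\<forall>b\<in>Basis - {e}. \<bar>x \<bullet> b\<bar> < k)"
proof -
  have "x \<in> \<Omega> k \<longleftrightarrow> (\<forall>b\<in>Basis. \<bar>x \<bullet> b\<bar> < (if b = e then c else k))"
    by (auto simp: \<Omega>_def mem_box corner_inner abs_less_iff split: if_splits)
  also have "\<dots> \<longleftrightarrow> \<bar>x \<bullet> e\<bar> < c \<and> (\<forall>b\<in>Basis - {e}. \<bar>x \<bullet> b\<bar> < k)"
    using e by auto
  finally show ?thesis
    using c_pos by (simp add: ht_def)
qed

lemma mem_cbox_corner:
  "x \<in> cbox (- corner r k) (corner r k) \<longleftrightarrow> \<bar>ht x\<bar> \<le> r \<and> (\<forall>b\<in>Basis - {e}. \<bar>x \<bullet> b\<bar> \<le> k)"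
proof -
  have "x \<in> cbox (- corner r k) (corner r k) \<longleftrightarrow> (\<forall>b\<in>Basis. \<bar>x \<bullet> b\<bar> \<le> (if b = e then c * r else k))"
    by (auto simp: mem_box corner_inner abs_le_iff split: if_splits)
  also have "\<dots> \<longleftrightarrow> \<bar>x \<bullet> e\<bar> \<le> c * r \<and> (\<forall>b\<in>Basis - {e}. \<bar>x \<bullet> b\<bar> \<le> k)"
    using e by auto
  finally show ?thesis
    using c_pos by (simp add: ht_def field_simps)
qed

lemma \<Omega>_open: "open (\<Omega> k)" and \<Omega>_bounded: "bounded (\<Omega> k)"
  and \<Omega>_sets [measurable]: "\<Omega> k \<in> sets borel" and \<Omega>_lebesgue: "\<Omega> k \<in> sets lebesgue"
  by (auto simp: \<Omega>_def open_box bounded_box)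

definition vol :: "real \<Rightarrow> real" where "vol k = measure lebesgue (\<Omega> k)"

lemma vol_eq: "0 < k \<Longrightarrow> vol k = 2 * c * (2 * k) ^ (DIM('a) - 1)"
proof -
  assume k: "0 < k"
  have "vol k = measure lborel (\<Omega> k)"
    by (simp add: vol_def)
  also have "\<dots> = (\<Prod>b\<in>Basis. (corner 1 k - (- corner 1 k)) \<bullet> b)"
    unfolding \<Omega>_def using k c_pos by (subst measure_lborel_box_eq) (auto simp: corner_inner)
  also have "\<dots> = (\<Prod>b\<in>Basis. if b = e then 2 * c else 2 * k)"
    by (rule prod.cong) (auto simp: inner_add_left corner_inner)
  also have "\<dots> = 2 * c * (\<Prod>b\<in>Basis - {e}. if b = e then 2 * c else 2 * k)"
    using e by (subst prod.remove[of _ e]) auto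
  also have "(\<Prod>b\<in>Basis - {e}. if b = e then 2 * c else 2 * k) = (\<Prod>b\<in>Basis - {e::'a}. 2 * k)"
    by (rule prod.cong) auto
  finally show ?thesis
    using e by (simp add: card_Diff_singleton)
qed

lemma vol_pos: "0 < k \<Longrightarrow> 0 < vol k"
  using c_pos by (simp add: vol_eq)

section \<open>Inradius of the box\<close>

text \<open>From x one moves along \<open>w\<close>, by at most 1, towards the nearer of the two
  faces orthogonal to \<open>e\<close>. As \<open>w\<close> may be oblique, the segment can leave
  the box earlier through a lateral face, so the boundary point comes from connectedness rather than
  from a formula.\<close>

lemma boundary_distance_le:
  assumes x: "x \<in> \<Omega> k"
  obtains y where "y \<in> frontier (\<Omega> k)" "polar F (x - y) \<le> 1"
proof -
  define s where "s = (if 0 \<le> ht x then 1 - ht x else - 1 - ht x)"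
  have lx: "\<bar>ht x\<bar> < 1"
    using x by (simp add: mem_\<Omega>)
  have s: "\<bar>s\<bar> \<le> 1"
    using lx by (auto simp: s_def)
  have "ht (x + s *\<^sub>R w) = 1 \<or> ht (x + s *\<^sub>R w) = -1"
    by (simp add: ht_add_w s_def)
  then have "x + s *\<^sub>R w \<notin> \<Omega> k"
    by (auto simp: mem_\<Omega>)
  moreover have "x \<in> closed_segment x (x + s *\<^sub>R w)" "x + s *\<^sub>R w \<in> closed_segment x (x + s *\<^sub>R w)"
    by auto
  ultimately have "closed_segment x (x + s *\<^sub>R w) \<inter> frontier (\<Omega> k) \<noteq> {}"
    using x by (intro connected_Int_frontier) auto
  then obtain y where y: "y \<in> closed_segment x (x + s *\<^sub>R w)" "y \<in> frontier (\<Omega> k)"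
    by blast
  then obtain u where u: "0 \<le> u" "u \<le> 1" "y = (1 - u) *\<^sub>R x + u *\<^sub>R (x + s *\<^sub>R w)"
    by (auto simp: closed_segment_def)
  then have "x - y = (- (u * s)) *\<^sub>R w"
    by (simp add: algebra_simps)
  then have "polar F (x - y) \<le> \<bar>u * s\<bar>"
    using polar_scaleR_w[of "- (u * s)"] by simp
  also have "\<dots> \<le> 1"
    using u(1,2) s by (simp add: abs_mult mult_le_one)
  finally show ?thesis
    using that y(2) by blast
qed

text \<open>The origin attains the supremum: a boundary point y has some coordinate |y . b| at least
  \<open>F b\<close>, on a lateral face because k is at least \<open>upper\<close>, and duality with
  b and -b turns this into polar norm at least 1.\<close>

lemma inradius_eq_1:
  assumes k: "0 < k" "upper \<le> k"
  shows "inradius F (\<Omega> k) = 1"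
proof -
  have bdd: "bdd_below ((\<lambda>y. polar F (x - y)) ` frontier (\<Omega> k))" for x
    using polar_nonneg by (intro bdd_belowI2[of _ 0]) auto
  have le: "boundary_distance F (\<Omega> k) x \<le> 1" if x: "x \<in> \<Omega> k" for x
  proof -
    obtain y where "y \<in> frontier (\<Omega> k)" "polar F (x - y) \<le> 1"
      by (rule boundary_distance_le[OF x])
    then show ?thesis
      unfolding boundary_distance_def using cINF_lower2[OF bdd] by blast
  qed
  have 0: "0 \<in> \<Omega> k"
    using k by (simp add: mem_\<Omega> ht_def)
  have ge: "1 \<le> boundary_distance F (\<Omega> k) 0"
    unfolding boundary_distance_def
  proof (rule cINF_greatest)
    show "frontier (\<Omega> k) \<noteq> {}"
      using boundary_distance_le[OF 0] by blast
    fix y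
    assume "y \<in> frontier (\<Omega> k)"
    then have "y \<notin> \<Omega> k"
      using \<Omega>_open by (simp add: frontier_def interior_open)
    then obtain b where b: "b \<in> Basis" "F b \<le> \<bar>y \<bullet> b\<bar>"
    proof (cases "\<bar>ht y\<bar> < 1")
      case False
      then have "F e \<le> \<bar>y \<bullet> e\<bar>"
        using c_pos by (simp add: ht_def c_def)
      then show ?thesis
        using that e by blast
    next
      case True
      then obtain b where "b \<in> Basis" "k \<le> \<bar>y \<bullet> b\<bar>"
        using \<open>y \<notin> \<Omega> k\<close> by (auto simp: mem_\<Omega> not_less)
      then show ?thesis
        using that k F_le_upper[of b] by fastforce
    qed
    have "b \<bullet> (0 - y) \<le> F b * polar F (0 - y)" "(- b) \<bullet> (0 - y) \<le> F (- b) * polar F (0 - y)"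
      by (rule polar_duality)+
    then have "\<bar>y \<bullet> b\<bar> \<le> F b * polar F (0 - y)"
      by (simp add: inner_commute abs_le_iff)
    then have "F b * 1 \<le> F b * polar F (0 - y)"
      using b by simp
    moreover have "0 < F b"
      using F_pos b(1) nonzero_Basis by blast
    ultimately show "1 \<le> polar F (0 - y)"
      by simp
  qed
  show ?thesis
    unfolding inradius_def
  proof (rule antisym)
    show "(SUP x\<in>\<Omega> k. boundary_distance F (\<Omega> k) x) \<le> 1"
      by (rule cSUP_least) (use 0 le in auto)
    show "1 \<le> (SUP x\<in>\<Omega> k. boundary_distance F (\<Omega> k) x)"
      using 0 ge le
      by (intro cSUP_upper2[of "boundary_distance F (\<Omega> k)" "\<Omega> k" 0] bdd_aboveI2[of _ _ 1]) auto
  qed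
qed

section \<open>Perimeter and Cheeger constant\<close>

text \<open>Duality bounds the component along \<open>b\<close> of an admissible field by
  \<open>F b\<close>. The pair of faces orthogonal to \<open>e\<close> then contributes at most
  \<open>vol k\<close>, as the box has width \<open>2 * F e\<close> in this direction, and each
  lateral pair at most \<open>vol k * F b / k\<close>.\<close>

lemma perimeter_le:
  assumes k: "0 < k"
  shows "perimeter F (\<Omega> k) \<le> ereal (vol k * (1 + upper / k))"
  unfolding perimeter_def
proof (rule SUP_least)
  fix \<sigma> :: "'a \<Rightarrow> 'a"
  assume "\<sigma> \<in> {\<sigma>. Ck_on 1 \<sigma> UNIV \<and> compact (support \<sigma>) \<and> (\<forall>x. polar F (\<sigma> x) \<le> 1)}"
  then have diff: "\<sigma> differentiable (at x)" and dcont: "\<And>b. b \<in> Basis \<Longrightarrow> continuous_on UNIV (\<lambda>x. frechet_derivative \<sigma> (at x) b)"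
    and supp: "compact (support \<sigma>)" and pol: "polar F (\<sigma> x) \<le> 1" for x
    by (auto simp: differentiable_on_def)
  have scont: "continuous_on UNIV \<sigma>"
    using diff by (intro differentiable_imp_continuous_on) (auto simp: differentiable_on_def)
  have s0: "\<sigma> x = 0" if "x \<notin> support \<sigma>" for x
    using that closure_subset[of "{x. \<sigma> x \<noteq> 0}"] unfolding support_def by blast
  define D where "D b x = frechet_derivative \<sigma> (at x) b \<bullet> b" for b x
  have Dcont: "continuous_on UNIV (D b)" if "b \<in> Basis" for b
    unfolding D_def[abs_def] by (intro continuous_intros dcont that)
  have deriv: "((\<lambda>t. \<sigma> (x + t *\<^sub>R b) \<bullet> b) has_real_derivative D b x) (at 0)" for x b
  proof -
    have l: "((\<lambda>t. x + t *\<^sub>R b) has_derivative (\<lambda>t. t *\<^sub>R b)) (at 0)"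
      by (auto intro!: derivative_eq_intros)
    have "((\<lambda>t. \<sigma> (x + t *\<^sub>R b)) has_derivative (\<lambda>t. frechet_derivative \<sigma> (at x) (t *\<^sub>R b))) (at 0)"
      using has_derivative_compose[OF l, of \<sigma> "frechet_derivative \<sigma> (at x)"] diff[of x]
      by (simp add: frechet_derivative_works)
    then have "((\<lambda>t. \<sigma> (x + t *\<^sub>R b) \<bullet> b) has_derivative (\<lambda>t. frechet_derivative \<sigma> (at x) (t *\<^sub>R b) \<bullet> b)) (at 0)"
      by (rule has_derivative_inner_left)
    then show ?thesis
      using linear_scale[OF linear_frechet_derivative[OF diff[of x]]]
      by (simp add: has_field_derivative_def D_def mult_commute_abs)
  qed
  have bound: "\<bar>\<sigma> x \<bullet> b\<bar> \<le> F b" if "b \<in> Basis" for b x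
  proof -
    have "b \<bullet> \<sigma> x \<le> F b * polar F (\<sigma> x)" "(- b) \<bullet> \<sigma> x \<le> F (- b) * polar F (\<sigma> x)"
      by (rule polar_duality)+
    moreover have "F b * polar F (\<sigma> x) \<le> F b * 1"
      by (intro mult_left_mono pol F_nonneg)
    ultimately show ?thesis
      by (simp add: inner_commute abs_le_iff)
  qed
  have cs: "continuous_on UNIV (\<lambda>x. \<sigma> x \<bullet> b)" for b
    by (intro continuous_intros scont)
  have each: "(LINT x|lborel. indicator (\<Omega> k) x * D b x) \<le> vol k * (if b = e then 1 else F b / k)"
    if b: "b \<in> Basis" for b
  proof -
    have "(LINT x|lborel. indicator (\<Omega> k) x * D b x)
        \<le> 2 * F b * measure lborel (\<Omega> k) / (corner 1 k \<bullet> b - (- corner 1 k) \<bullet> b)"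
      unfolding \<Omega>_def
      by (rule box_integral_derivative_bound[OF b _ deriv Dcont[OF b] cs supp])
         (use k c_pos s0 bound[OF b] in \<open>auto simp: corner_inner\<close>)
    also have "\<dots> = vol k * (if b = e then 1 else F b / k)"
      using b k c_pos by (simp add: corner_inner vol_def c_def)
    finally show ?thesis .
  qed
  have int: "integrable lborel (\<lambda>x. indicator (\<Omega> k) x * D b x)" if b: "b \<in> Basis" for b
  proof -
    have "integrable lborel (D b)"
      by (rule difference_quotient_integral(2)[OF deriv Dcont[OF b] cs supp, of UNIV]) (use s0 in auto)
    then show ?thesis
      using integrable_mult_indicator[of "\<Omega> k" lborel "D b"] by simp
  qed
  have "(LINT x|lebesgue_on (\<Omega> k). divergence \<sigma> x) = (LINT x|lebesgue_on (\<Omega> k). indicator (\<Omega> k) x * (\<Sum>b\<in>Basis. D b x))"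
    by (rule Bochner_Integration.integral_cong) (auto simp: divergence_def D_def)
  also have "\<dots> = (LINT x|lborel. indicator (\<Omega> k) x * (\<Sum>b\<in>Basis. D b x))"
  proof (rule lebesgue_on_integral_eq_lborel[OF _ \<Omega>_lebesgue])
    have [measurable]: "D b \<in> borel_measurable borel" if "b \<in> Basis" for b
      by (rule borel_measurable_continuous_onI[OF Dcont[OF that]])
    show "(\<lambda>x. indicator (\<Omega> k) x * (\<Sum>b\<in>Basis. D b x)) \<in> borel_measurable borel"
      by measurable
  qed auto
  also have "\<dots> = (\<Sum>b\<in>Basis. LINT x|lborel. indicator (\<Omega> k) x * D b x)"
    unfolding sum_distrib_left by (rule Bochner_Integration.integral_sum) (rule int)
  also have "\<dots> \<le> (\<Sum>b\<in>Basis. vol k * (if b = e then 1 else F b / k))"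
    by (intro sum_mono each)
  also have "\<dots> = vol k * (1 + (\<Sum>b\<in>Basis - {e}. F b / k))"
    using e by (simp add: sum.remove[of _ e] flip: sum_distrib_left)
  also have "\<dots> \<le> vol k * (1 + upper / k)"
  proof -
    have "(\<Sum>b\<in>Basis - {e}. F b) \<le> upper"
      unfolding upper_def by (rule sum_mono2) (auto simp: F_nonneg)
    then show ?thesis
      using vol_pos[OF k] k by (simp add: divide_right_mono flip: sum_divide_distrib)
  qed
  finally show "ereal (LINT x|lebesgue_on (\<Omega> k). divergence \<sigma> x) \<le> ereal (vol k * (1 + upper / k))"
    by simp
qed

text \<open>The calibration \<open>ht x *\<^sub>R w\<close> has divergence 1 and polar norm at most
  1 on the box. To be admissible it has to be cut off outside the box, where \<open>ht\<close> may
  exceed 1. A cutoff between 1 and 1 + \<epsilon>, combined with division by 1 + \<epsilon>,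
  restores the norm bound and costs a factor that tends to 1.\<close>

lemma cheeger_ge_1:
  assumes k: "0 < k"
  shows "1 \<le> cheeger F (\<Omega> k)"
proof -
  have "ereal (1 / (1 + \<epsilon>)) \<le> cheeger F (\<Omega> k)" if \<epsilon>: "0 < \<epsilon>" for \<epsilon> :: real
    unfolding cheeger_def
  proof (rule INF_greatest, clarify)
    fix K assume K: "K \<in> sets lebesgue" "K \<subseteq> \<Omega> k" "0 < measure lebesgue K"
    obtain \<zeta> :: "real \<Rightarrow> real" where \<zeta>: "smooth \<zeta>" "\<And>t. 0 \<le> \<zeta> t" "\<And>t. \<zeta> t \<le> 1"
      "\<And>t. \<bar>t\<bar> \<le> 1 \<Longrightarrow> \<zeta> t = 1" "\<And>t. 1 + \<epsilon> \<le> \<bar>t\<bar> \<Longrightarrow> \<zeta> t = 0"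
      by (rule smooth_cutoff[of 1 "1 + \<epsilon>"]) (use \<epsilon> in \<open>auto intro: that\<close>)
    define m where "m t = (1 / (1 + \<epsilon>)) * (t * \<zeta> t)" for t
    define Z where "Z x = (\<Prod>b\<in>Basis - {e}. \<zeta> ((1 / k) * (x \<bullet> b)))" for x :: 'a
    define \<sigma> where "\<sigma> x = (m (ht x) * Z x) *\<^sub>R w" for x
    have "smooth m"
      unfolding m_def[abs_def]
      by (rule smooth_mult[OF smooth_const smooth_mult[OF smooth_ident \<zeta>(1)]])
    moreover have "smooth Z"
      unfolding Z_def[abs_def]
      by (rule smooth_prod, rule smooth_compose[OF \<zeta>(1) smooth_mult[OF smooth_const smooth_inner]])
    ultimately have "smooth (\<lambda>x. m (ht x) * Z x)"
      by (rule smooth_mult[OF smooth_compose[OF _ smooth_ht]])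
    then have C1: "Ck_on 1 \<sigma> UNIV"
      unfolding \<sigma>_def[abs_def] by (intro Ck_on_scaleR_left) (simp add: smooth_def del: Ck_on.simps)
    have m_le: "\<bar>m t\<bar> \<le> 1" for t
    proof (cases "\<bar>t\<bar> < 1 + \<epsilon>")
      case True
      have "\<bar>t * \<zeta> t\<bar> \<le> (1 + \<epsilon>) * 1"
        unfolding abs_mult using True \<zeta>(2,3)[of t] \<epsilon> by (intro mult_mono) auto
      then show ?thesis
        using \<epsilon> by (simp add: m_def)
    qed (use \<zeta>(5) in \<open>simp add: m_def\<close>)
    have Z_le: "0 \<le> Z x" "Z x \<le> 1" for x
      unfolding Z_def using \<zeta>(2,3) by (auto intro!: prod_nonneg prod_le_1)
    have pol: "polar F (\<sigma> x) \<le> 1" for x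
    proof -
      have "\<bar>m (ht x) * Z x\<bar> \<le> 1"
        unfolding abs_mult using m_le Z_le by (intro mult_le_one) auto
      then show ?thesis
        unfolding \<sigma>_def using polar_scaleR_w order_trans by blast
    qed
    have zero: "\<sigma> x = 0" if "x \<notin> cbox (- corner (1 + \<epsilon>) ((1 + \<epsilon>) * k)) (corner (1 + \<epsilon>) ((1 + \<epsilon>) * k))" for x
    proof (cases "\<bar>ht x\<bar> \<le> 1 + \<epsilon>")
      case True
      then obtain b where b: "b \<in> Basis - {e}" "(1 + \<epsilon>) * k < \<bar>x \<bullet> b\<bar>"
        using \<open>x \<notin> _\<close> by (auto simp: mem_cbox_corner not_le)
      then have "\<zeta> ((1 / k) * (x \<bullet> b)) = 0"
        using k by (intro \<zeta>(5)) (simp add: abs_mult field_simps)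
      then have "Z x = 0"
        unfolding Z_def using b(1) by (intro prod_zero) auto
      then show ?thesis
        by (simp add: \<sigma>_def)
    qed (use \<zeta>(5) in \<open>simp add: \<sigma>_def m_def\<close>)
    have supp: "compact (support \<sigma>)"
    proof -
      have "{x. \<sigma> x \<noteq> 0} \<subseteq> cbox (- corner (1 + \<epsilon>) ((1 + \<epsilon>) * k)) (corner (1 + \<epsilon>) ((1 + \<epsilon>) * k))"
        using zero by blast
      then have "bounded {x. \<sigma> x \<noteq> 0}"
        using bounded_cbox bounded_subset by blast
      then show ?thesis
        by (simp add: support_def compact_closure)
    qed
    have div: "divergence \<sigma> x = 1 / (1 + \<epsilon>)" if x: "x \<in> \<Omega> k" for x
    proof -
      have eq: "((1 / (1 + \<epsilon>)) * ht y) *\<^sub>R w = \<sigma> y" if "y \<in> \<Omega> k" for y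
      proof -
        have "\<zeta> (ht y) = 1"
          using that by (intro \<zeta>(4)) (auto simp: mem_\<Omega>)
        moreover have "Z y = 1"
          unfolding Z_def using that k by (intro prod.neutral ballI \<zeta>(4)) (auto simp: mem_\<Omega> abs_mult field_simps less_imp_le)
        ultimately show ?thesis
          by (simp add: \<sigma>_def m_def)
      qed
      have "((\<lambda>y. ((1 / (1 + \<epsilon>)) * ht y) *\<^sub>R w) has_derivative (\<lambda>h. ((1 / (1 + \<epsilon>)) * ((h \<bullet> e) / c)) *\<^sub>R w)) (at x)"
        unfolding ht_def using \<epsilon> c_pos by (auto intro!: derivative_eq_intros)
      then have "(\<sigma> has_derivative (\<lambda>h. ((1 / (1 + \<epsilon>)) * ((h \<bullet> e) / c)) *\<^sub>R w)) (at x)"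
        by (rule has_derivative_transform_within_open[OF _ \<Omega>_open x eq])
      then have "frechet_derivative \<sigma> (at x) = (\<lambda>h. ((1 / (1 + \<epsilon>)) * ((h \<bullet> e) / c)) *\<^sub>R w)"
        by (rule frechet_derivative_at[symmetric])
      then have "divergence \<sigma> x = (\<Sum>b\<in>Basis. (1 / (1 + \<epsilon>)) * (((b \<bullet> e) / c) * (w \<bullet> b)))"
        by (simp add: divergence_def)
      also have "\<dots> = (1 / (1 + \<epsilon>)) * ((w \<bullet> e) / c)"
        using e by (simp add: inner_Basis if_distrib if_distribR sum.delta flip: sum_distrib_left cong: if_cong)
      finally show ?thesis
        using w_e c_pos by simp
    qed
    have "(LINT x|lebesgue_on K. divergence \<sigma> x) = (LINT x|lebesgue_on K. 1 / (1 + \<epsilon>))"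
      by (rule Bochner_Integration.integral_cong) (use K div in auto)
    also have "\<dots> = (1 / (1 + \<epsilon>)) * measure lebesgue K"
      using K(1) by (simp add: measure_restrict_space)
    finally have "ereal ((1 / (1 + \<epsilon>)) * measure lebesgue K) \<le> perimeter F K"
      unfolding perimeter_def using C1 supp pol by (intro SUP_upper2[of \<sigma>]) auto
    then show "ereal (1 / (1 + \<epsilon>)) \<le> perimeter F K / ereal (measure lebesgue K)"
      using K(3) by (simp add: ereal_le_divide_pos mult.commute)
  qed note * = this
  show ?thesis
  proof (rule tendsto_upperbound[of "\<lambda>n. ereal (1 / (1 + 1 / real (Suc n)))" 1 sequentially])
    have "(\<lambda>n. 1 / (1 + 1 / real (Suc n))) \<longlonglongrightarrow> 1"
      by real_asymp
    then show "(\<lambda>n. ereal (1 / (1 + 1 / real (Suc n)))) \<longlonglongrightarrow> 1"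
      by (simp add: one_ereal_def)
    show "\<forall>\<^sub>F n in sequentially. ereal (1 / (1 + 1 / real (Suc n))) \<le> cheeger F (\<Omega> k)"
      by (intro always_eventually allI *) simp
  qed simp
qed

text \<open>The box competes in its own Cheeger quotient, which orders the three quantities. The
  bounds also show both extended reals to be finite, so that \<open>real_of_ereal\<close> is
  faithful.\<close>

lemma cheeger_perimeter_bounds:
  assumes k: "0 < k"
  shows "1 \<le> real_of_ereal (cheeger F (\<Omega> k))"
    and "real_of_ereal (cheeger F (\<Omega> k)) \<le> real_of_ereal (perimeter F (\<Omega> k)) / vol k"
    and "real_of_ereal (perimeter F (\<Omega> k)) / vol k \<le> 1 + upper / k"
proof -
  have V: "0 < vol k"
    by (rule vol_pos[OF k])
  have le: "cheeger F (\<Omega> k) \<le> perimeter F (\<Omega> k) / ereal (vol k)"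
    unfolding cheeger_def using V \<Omega>_lebesgue by (intro INF_lower2[of "\<Omega> k"]) (auto simp: vol_def)
  have ge: "1 \<le> cheeger F (\<Omega> k)"
    by (rule cheeger_ge_1[OF k])
  have per: "perimeter F (\<Omega> k) \<le> ereal (vol k * (1 + upper / k))"
    by (rule perimeter_le[OF k])
  have "1 \<le> perimeter F (\<Omega> k) / ereal (vol k)"
    using ge le by (rule order_trans)
  then have "ereal (vol k) \<le> perimeter F (\<Omega> k)"
    using V by (simp add: ereal_le_divide_pos one_ereal_def)
  with per obtain P where P: "perimeter F (\<Omega> k) = ereal P"
    by (cases "perimeter F (\<Omega> k)") auto
  with le ge V obtain h where h: "cheeger F (\<Omega> k) = ereal h"
    by (cases "cheeger F (\<Omega> k)") (auto simp: one_ereal_def)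
  show "1 \<le> real_of_ereal (cheeger F (\<Omega> k))"
    using ge by (simp add: h one_ereal_def)
  show "real_of_ereal (cheeger F (\<Omega> k)) \<le> real_of_ereal (perimeter F (\<Omega> k)) / vol k"
    using le V by (simp add: h P)
  show "real_of_ereal (perimeter F (\<Omega> k)) / vol k \<le> 1 + upper / k"
    using per V by (simp add: P field_simps)
qed

end

section \<open>Transversal cutoffs and test functions\<close>

lemma scaled_integral:
  fixes g :: "real \<Rightarrow> real"
  assumes g: "continuous_on UNIV g" and r: "0 < r"
  shows "integrable lborel (\<lambda>t. indicator {-r<..<r} t * g (t / r))"
    and "(LINT t|lborel. indicator {-r<..<r} t * g (t / r)) = r * integral {-1..1} g"
proof -
  have *: "set_integrable lborel {-r<..<r} (\<lambda>t. g (t / r))" if r: "0 < r" for r :: real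
  proof -
    have "set_integrable lborel {-r..r} (\<lambda>t. g (t / r))"
      using r by (intro borel_integrable_atLeastAtMost' continuous_on_compose2[OF g] continuous_intros) auto
    then show ?thesis
      by (rule set_integrable_subset) auto
  qed
  show "integrable lborel (\<lambda>t. indicator {-r<..<r} t * g (t / r))"
    using *[OF r] by (simp add: set_integrable_def)
  have "(LINT t|lborel. indicator {-r<..<r} t * g (t / r))
      = r * (LINT t|lborel. indicator {-r<..<r} (r * t) * g t)"
    using r by (subst lborel_integral_real_affine[of r _ 0]) simp_all
  also have "(\<lambda>t. indicator {-r<..<r} (r * t) * g t) = (\<lambda>t. indicator {-1<..<1} t *\<^sub>R g t)"
  proof
    fix t
    have "- r < r * t \<longleftrightarrow> -1 < t" "r * t < r \<longleftrightarrow> t < 1"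
      using r mult_less_cancel_left_pos[of r "-1" t] mult_less_cancel_left_pos[of r t 1] by auto
    then show "indicator {-r<..<r} (r * t) * g t = indicator {-1<..<1} t *\<^sub>R g t"
      by (simp add: indicator_def)
  qed
  also have "(LINT t|lborel. indicator {-1<..<1} t *\<^sub>R g t) = integral {-1<..<1} g"
    using set_borel_integral_eq_integral(2)[of "{-1<..<1}" g] *[of 1] by (simp add: set_lebesgue_integral_def)
  also have "\<dots> = integral {-1..1} g"
    by (simp add: integral_open_interval_real)
  finally show "(LINT t|lborel. indicator {-r<..<r} t * g (t / r)) = r * integral {-1..1} g" .
qed

text \<open>One profile is fixed once and for all, so that the constants derived from it are
  independent of k.\<close>

definition cutoff :: "real \<Rightarrow> real" where
  "cutoff = (SOME \<zeta>. smooth \<zeta> \<and> (\<forall>t. 0 \<le> \<zeta> t) \<and> (\<forall>t. \<zeta> t \<le> 1) \<and>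
     (\<forall>t. \<bar>t\<bar> \<le> 1/2 \<longrightarrow> \<zeta> t = 1) \<and> (\<forall>t. 3/4 \<le> \<bar>t\<bar> \<longrightarrow> \<zeta> t = 0))"

lemma cutoff: "smooth cutoff" "0 \<le> cutoff t" "cutoff t \<le> 1"
  "\<bar>t\<bar> \<le> 1/2 \<Longrightarrow> cutoff t = 1" "3/4 \<le> \<bar>t\<bar> \<Longrightarrow> cutoff t = 0"
proof -
  have ex: "\<exists>\<zeta> :: real \<Rightarrow> real. smooth \<zeta> \<and> (\<forall>t. 0 \<le> \<zeta> t) \<and> (\<forall>t. \<zeta> t \<le> 1) \<and>
     (\<forall>t. \<bar>t\<bar> \<le> 1/2 \<longrightarrow> \<zeta> t = 1) \<and> (\<forall>t. 3/4 \<le> \<bar>t\<bar> \<longrightarrow> \<zeta> t = (0::real))"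
  proof (rule smooth_cutoff[of "1/2" "3/4"])
    fix \<zeta> :: "real \<Rightarrow> real"
    assume "smooth \<zeta>" "\<And>t. 0 \<le> \<zeta> t" "\<And>t. \<zeta> t \<le> 1"
      "\<And>t. \<bar>t\<bar> \<le> 1/2 \<Longrightarrow> \<zeta> t = 1" "\<And>t. 3/4 \<le> \<bar>t\<bar> \<Longrightarrow> \<zeta> t = 0"
    then show ?thesis
      by (intro exI[of _ \<zeta>]) simp
  qed simp
  have "smooth cutoff \<and> (\<forall>t. 0 \<le> cutoff t) \<and> (\<forall>t. cutoff t \<le> 1) \<and>
     (\<forall>t. \<bar>t\<bar> \<le> 1/2 \<longrightarrow> cutoff t = 1) \<and> (\<forall>t. 3/4 \<le> \<bar>t\<bar> \<longrightarrow> cutoff t = 0)"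
    unfolding cutoff_def by (rule someI_ex[OF ex])
  then show "smooth cutoff" "0 \<le> cutoff t" "cutoff t \<le> 1"
    "\<bar>t\<bar> \<le> 1/2 \<Longrightarrow> cutoff t = 1" "3/4 \<le> \<bar>t\<bar> \<Longrightarrow> cutoff t = 0"
    by blast+
qed

lemma cutoff_continuous: "continuous_on S cutoff"
  by (rule smooth_continuous[OF cutoff(1)])

lemma cutoff_deriv_bounded: "\<exists>L\<ge>0. \<forall>t. \<bar>deriv cutoff t\<bar> \<le> L"
proof -
  have "bounded (deriv cutoff ` {-1..1})"
    by (intro compact_imp_bounded compact_continuous_image smooth_continuous smooth_realD(2) cutoff(1) compact_Icc)
  then obtain L where L: "\<forall>t\<in>{-1..1}. \<bar>deriv cutoff t\<bar> \<le> L"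
    unfolding bounded_iff by auto
  have "deriv cutoff t = 0" if t: "t \<notin> {-1..1}" for t
  proof -
    have "\<forall>\<^sub>F s in nhds t. s \<in> - {-1..1}"
      by (rule eventually_nhds_in_open) (use t in \<open>auto simp: open_Compl\<close>)
    then have "\<forall>\<^sub>F s in nhds t. cutoff s = 0"
      by eventually_elim (auto intro!: cutoff(5))
    then have "(cutoff has_real_derivative 0) (at t)"
      using DERIV_cong_ev[of t t cutoff "\<lambda>_. 0" 0 0] by simp
    then show ?thesis
      by (rule DERIV_imp_deriv)
  qed
  with L have "\<forall>t. \<bar>deriv cutoff t\<bar> \<le> max L 0"
    by (metis abs_zero max.cobounded2 max.coboundedI1)
  then show ?thesis
    by (intro exI[of _ "max L 0"]) simp
qed

lemma cutoff_integral_pos: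
  assumes "0 < s"
  shows "0 < integral {-1..1} (\<lambda>t. cutoff t powr s)"
proof -
  have c: "continuous_on S (\<lambda>t. cutoff t powr s)" for S
    by (intro continuous_on_powr' cutoff_continuous continuous_intros) (use assms cutoff(2) in auto)
  have "integral {-1/2..1/2::real} (\<lambda>t. 1::real) = integral {-1/2..1/2} (\<lambda>t. cutoff t powr s)"
    by (rule Henstock_Kurzweil_Integration.integral_cong) (subst cutoff(4); auto)
  also have "\<dots> \<le> integral {-1..1} (\<lambda>t. cutoff t powr s)"
    by (rule integral_subset_le) (auto intro!: integrable_continuous_real c)
  finally show ?thesis
    by simp
qed

lemma test_function_continuous:
  assumes "\<phi> \<in> test_functions \<Omega>"
  shows "continuous_on S \<phi>" "continuous_on S (gradient \<phi>)"
  unfolding gradient_def[abs_def]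
  by (intro continuous_intros smooth_continuous smooth_directional_derivative(1) test_functionsD(1)[OF assms])+

lemma test_function_bounded:
  assumes "\<phi> \<in> test_functions \<Omega>"
  obtains B where "\<And>x. \<bar>\<phi> x\<bar> \<le> B" "\<And>x. norm (gradient \<phi> x) \<le> B" "0 \<le> B"
proof -
  have "bounded (\<phi> ` support \<phi>)" "bounded (gradient \<phi> ` support \<phi>)"
    by (intro compact_imp_bounded compact_continuous_image test_function_continuous[OF assms] test_functionsD(2)[OF assms])+
  then obtain B1 B2 where "\<forall>x\<in>support \<phi>. \<bar>\<phi> x\<bar> \<le> B1" "\<forall>x\<in>support \<phi>. norm (gradient \<phi> x) \<le> B2"
    unfolding bounded_iff by auto
  then have "\<bar>\<phi> x\<bar> \<le> max 0 (max B1 B2)" "norm (gradient \<phi> x) \<le> max 0 (max B1 B2)" for x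
    using test_functionsD(4)[OF assms, of x] gradient_test_function_0[OF assms, of x]
    by (cases "x \<in> support \<phi>"; force)+
  then show ?thesis
    using that[of "max 0 (max B1 B2)"] by simp
qed

lemma sobolev0_test_function:
  fixes \<phi> :: "'a::euclidean_space \<Rightarrow> real"
  assumes \<phi>: "\<phi> \<in> test_functions \<Omega>" and \<Omega>: "bounded \<Omega>" "\<Omega> \<in> sets lebesgue" and p: "1 < p"
  shows "sobolev0 p \<Omega> \<phi> (gradient \<phi>)"
  unfolding sobolev0_def sobolev_def
proof (intro conjI ballI)
  obtain B where B: "\<And>x. \<bar>\<phi> x\<bar> \<le> B" "\<And>x. norm (gradient \<phi> x) \<le> B"
    using test_function_bounded[OF \<phi>] by metis
  note [measurable] = continuous_imp_borel_lebesgue_on[OF test_function_continuous(1)[OF \<phi>], of \<Omega>]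
    continuous_imp_borel_lebesgue_on[OF test_function_continuous(2)[OF \<phi>], of \<Omega>]
  show "\<phi> \<in> borel_measurable (lebesgue_on \<Omega>)" "gradient \<phi> \<in> borel_measurable (lebesgue_on \<Omega>)"
    by measurable
  show "integrable (lebesgue_on \<Omega>) (\<lambda>x. \<bar>\<phi> x\<bar> powr p)" "integrable (lebesgue_on \<Omega>) (\<lambda>x. norm (gradient \<phi> x) powr p)"
    by (rule integrable_lebesgue_on_bounded[OF _ \<Omega>, of _ "B powr p"];
        use p B in \<open>auto intro!: powr_mono2\<close>)+
  show "(LINT x|lebesgue_on \<Omega>. \<phi> x * frechet_derivative \<psi> (at x) b) =
        - (LINT x|lebesgue_on \<Omega>. (gradient \<phi> x \<bullet> b) * \<psi> x)"
    if \<psi>: "\<psi> \<in> test_functions \<Omega>" and b: "b \<in> Basis" for \<psi> b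
  proof -
    have g: "frechet_derivative \<psi> (at x) b = gradient \<psi> x \<bullet> b" "frechet_derivative \<phi> (at x) b = gradient \<phi> x \<bullet> b" for x
      using smooth_directional_derivative(3)[OF test_functionsD(1)] \<phi> \<psi> by blast+
    have "(LINT x|lebesgue_on \<Omega>. \<phi> x * (gradient \<psi> x \<bullet> b)) = - (LINT x|lebesgue_on \<Omega>. \<psi> x * frechet_derivative \<phi> (at x) b)"
      by (rule integral_by_parts_test_function[OF \<psi> \<Omega>(2) smooth_directional_derivative(2)[OF test_functionsD(1)[OF \<phi>]]])
         (intro test_function_continuous[OF \<phi>] smooth_continuous smooth_directional_derivative(1) test_functionsD(1)[OF \<phi>])+
    then show ?thesis
      by (simp add: g mult.commute)
  qed
  have "0 powr p = (0::real)"
    using p by simp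
  then show "\<exists>\<phi>'. (\<forall>n::nat. \<phi>' n \<in> test_functions \<Omega>) \<and>
        (\<lambda>n. (LINT x|lebesgue_on \<Omega>. \<bar>\<phi>' n x - \<phi> x\<bar> powr p) +
             (LINT x|lebesgue_on \<Omega>. norm (gradient (\<phi>' n) x - gradient \<phi> x) powr p)) \<longlonglongrightarrow> 0"
    by (intro exI[of _ "\<lambda>_. \<phi>"]) (simp add: \<phi>)
qed

context anisotropy
begin

text \<open>The box is a product, so its indicator factorises along with the integrand. In a
  quotient of two such integrals with the same \<open>G\<close> the transversal power cancels and
  only one-dimensional integrals of \<open>g\<close> remain.\<close>

lemma integral_slab_product:
  assumes g: "continuous_on UNIV g" and G: "continuous_on UNIV G" and k: "0 < k"
  shows "(LINT x|lebesgue_on (\<Omega> k). g (ht x) * (\<Prod>b\<in>Basis - {e}. G (x \<bullet> b / k)))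
    = c * integral {-1..1} g * (k * integral {-1..1} G) ^ (DIM('a) - 1)"
proof -
  define h where "h b t = (if b = e then indicator {-c<..<c} t * g (t / c) else indicator {-k<..<k} t * G (t / k))"
    for b and t :: real
  have int: "integrable lborel (h b)" for b
    unfolding h_def[abs_def] using scaled_integral(1)[OF g c_pos] scaled_integral(1)[OF G k] by (cases "b = e") auto
  have prod: "(\<Prod>b\<in>Basis. h b (x \<bullet> b)) = indicator (\<Omega> k) x * (g (ht x) * (\<Prod>b\<in>Basis - {e}. G (x \<bullet> b / k)))" for x
  proof -
    have "(\<Prod>b\<in>Basis. h b (x \<bullet> b)) = h e (x \<bullet> e) * (\<Prod>b\<in>Basis - {e}. h b (x \<bullet> b))"
      using e by (simp add: prod.remove)
    also have "(\<Prod>b\<in>Basis - {e}. h b (x \<bullet> b)) = (\<Prod>b\<in>Basis - {e}. indicator {-k<..<k} (x \<bullet> b) * G (x \<bullet> b / k))"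
      by (rule prod.cong) (auto simp: h_def)
    also have "\<dots> = (\<Prod>b\<in>Basis - {e}. indicator {-k<..<k} (x \<bullet> b)) * (\<Prod>b\<in>Basis - {e}. G (x \<bullet> b / k))"
      by (rule prod.distrib)
    also have "h e (x \<bullet> e) = indicator {-c<..<c} (x \<bullet> e) * g (ht x)"
      by (simp add: h_def ht_def)
    also have "indicator {-c<..<c} (x \<bullet> e) * g (ht x) * ((\<Prod>b\<in>Basis - {e}. indicator {-k<..<k} (x \<bullet> b)) * (\<Prod>b\<in>Basis - {e}. G (x \<bullet> b / k)))
        = (indicator {-c<..<c} (x \<bullet> e) * (\<Prod>b\<in>Basis - {e}. indicator {-k<..<k} (x \<bullet> b))) * (g (ht x) * (\<Prod>b\<in>Basis - {e}. G (x \<bullet> b / k)))"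
      by (simp add: mult_ac)
    also have "indicator {-c<..<c} (x \<bullet> e) * (\<Prod>b\<in>Basis - {e}. indicator {-k<..<k} (x \<bullet> b)) = (indicator (\<Omega> k) x :: real)"
    proof (cases "x \<in> \<Omega> k")
      case True
      then have *: "\<bar>x \<bullet> e\<bar> < c" "\<And>b. b \<in> Basis - {e} \<Longrightarrow> \<bar>x \<bullet> b\<bar> < k"
        using c_pos by (auto simp: mem_\<Omega> ht_def)
      then have "(\<Prod>b\<in>Basis - {e}. indicator {-k<..<k} (x \<bullet> b)) = (1::real)"
        by (intro prod.neutral) (fastforce simp: indicator_def abs_less_iff)
      moreover have "indicator {-c<..<c} (x \<bullet> e) = (1::real)"
        using *(1) by (simp add: indicator_def abs_less_iff)
      ultimately show ?thesis
        using True by simp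
    next
      case False
      then have "\<not> \<bar>x \<bullet> e\<bar> < c \<or> (\<exists>b\<in>Basis - {e}. \<not> \<bar>x \<bullet> b\<bar> < k)"
        using c_pos by (auto simp: mem_\<Omega> ht_def)
      then show ?thesis
      proof
        assume "\<not> \<bar>x \<bullet> e\<bar> < c"
        then have "x \<bullet> e \<notin> {-c<..<c}"
          by (cases "0 \<le> x \<bullet> e") auto
        then show ?thesis
          using False by simp
      next
        assume "\<exists>b\<in>Basis - {e}. \<not> \<bar>x \<bullet> b\<bar> < k"
        then obtain b where b: "b \<in> Basis - {e}" "\<not> \<bar>x \<bullet> b\<bar> < k"
          by blast
        then have "x \<bullet> b \<notin> {-k<..<k}"
          by (cases "0 \<le> x \<bullet> b") auto
        then have "(\<Prod>b\<in>Basis - {e}. indicator {-k<..<k} (x \<bullet> b)) = (0::real)"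
          using b(1) by (intro prod_zero bexI[of _ b]) auto
        then show ?thesis
          using False by simp
      qed
    qed
    finally show ?thesis .
  qed
  have [measurable]: "g \<in> borel_measurable borel" "G \<in> borel_measurable borel" "ht \<in> borel_measurable borel"
    using g G ht_continuous by (auto intro: borel_measurable_continuous_onI)
  have "(LINT x|lebesgue_on (\<Omega> k). g (ht x) * (\<Prod>b\<in>Basis - {e}. G (x \<bullet> b / k)))
      = (LINT x|lebesgue_on (\<Omega> k). indicator (\<Omega> k) x * (g (ht x) * (\<Prod>b\<in>Basis - {e}. G (x \<bullet> b / k))))"
    by (rule Bochner_Integration.integral_cong) auto
  also have "\<dots> = (LINT x|lborel. indicator (\<Omega> k) x * (g (ht x) * (\<Prod>b\<in>Basis - {e}. G (x \<bullet> b / k))))"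
    by (rule lebesgue_on_integral_eq_lborel[OF _ \<Omega>_lebesgue]) auto
  also have "\<dots> = (\<Prod>b\<in>Basis. LINT t|lborel. h b t)"
    unfolding prod[symmetric] by (rule integral_lborel_prod) (rule int)
  also have "\<dots> = (LINT t|lborel. h e t) * (\<Prod>b\<in>Basis - {e}. LINT t|lborel. h b t)"
    using e by (simp add: prod.remove)
  also have "(LINT t|lborel. h e t) = c * integral {-1..1} g"
    using scaled_integral(2)[OF g c_pos] by (simp add: h_def)
  also have "(\<Prod>b\<in>Basis - {e}. LINT t|lborel. h b t) = (\<Prod>b\<in>Basis - {e}. k * integral {-1..1} G)"
    using scaled_integral(2)[OF G k] by (intro prod.cong) (auto simp: h_def)
  also have "\<dots> = (k * integral {-1..1} G) ^ (DIM('a) - 1)"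
    using e by (simp add: card_Diff_singleton)
  finally show ?thesis .
qed

section \<open>The first eigenvalue\<close>

text \<open>Transversal cutoff at scale k. It is constant along \<open>e\<close>, whereas its
  derivative along \<open>w\<close> is of order 1/k.\<close>

definition eta :: "real \<Rightarrow> 'a \<Rightarrow> real" where
  "eta k x = (\<Prod>b\<in>Basis - {e}. cutoff ((1 / k) * (x \<bullet> b)))"

lemma smooth_eta: "smooth (eta k)"
  unfolding eta_def[abs_def]
  by (rule smooth_prod, rule smooth_compose[OF cutoff(1) smooth_mult[OF smooth_const smooth_inner]])

lemma eta_bounds: "0 \<le> eta k x" "eta k x \<le> 1"
  unfolding eta_def using cutoff(2,3) by (auto intro!: prod_nonneg prod_le_1)

text \<open>Each partial derivative picks up a factor 1/k from the rescaled argument, the remaining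
  factors of the product being at most 1; one constant serves all k.\<close>

lemma eta_gradient_bound: "\<exists>C\<ge>0. \<forall>k>0. \<forall>x. F (gradient (eta k) x) \<le> C / k"
proof -
  obtain L where L: "0 \<le> L" "\<And>t. \<bar>deriv cutoff t\<bar> \<le> L"
    using cutoff_deriv_bounded by blast
  have partial: "\<bar>frechet_derivative (eta k) (at x) b\<bar> \<le> L / k" if b: "b \<in> Basis" and k: "0 < k" for b k x
  proof (cases "b = e")
    case True
    have "((\<lambda>t. eta k (x + t *\<^sub>R b)) has_real_derivative 0) (at 0)"
    proof -
      have "eta k (x + t *\<^sub>R b) = eta k x" for t
        unfolding eta_def using True e by (intro prod.cong) (auto simp: inner_add_left inner_Basis)
      then show ?thesis by simp
    qed
    then have "frechet_derivative (eta k) (at x) b = 0"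
      using smooth_directional_derivative(2)[OF smooth_eta] DERIV_unique by blast
    then show ?thesis
      using L(1) k by simp
  next
    case False
    define R where "R = (\<Prod>i\<in>Basis - {e} - {b}. cutoff ((1 / k) * (x \<bullet> i)))"
    have R: "\<bar>R\<bar> \<le> 1"
      unfolding R_def using cutoff(2,3) by (auto simp: abs_prod intro!: prod_le_1)
    have eq: "eta k (x + t *\<^sub>R b) = cutoff ((1 / k) * (x \<bullet> b + t)) * R" for t
    proof -
      have "eta k (x + t *\<^sub>R b) = cutoff ((1 / k) * ((x + t *\<^sub>R b) \<bullet> b)) *
          (\<Prod>i\<in>Basis - {e} - {b}. cutoff ((1 / k) * ((x + t *\<^sub>R b) \<bullet> i)))"
        unfolding eta_def using b False by (intro prod.remove) auto
      also have "(\<Prod>i\<in>Basis - {e} - {b}. cutoff ((1 / k) * ((x + t *\<^sub>R b) \<bullet> i))) = R"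
        unfolding R_def by (rule prod.cong) (use b in \<open>auto simp: inner_add_left inner_Basis\<close>)
      finally show ?thesis
        using b by (simp add: inner_add_left)
    qed
    have "((\<lambda>t. cutoff ((1 / k) * (x \<bullet> b + t)) * R) has_real_derivative
        deriv cutoff ((1 / k) * (x \<bullet> b + 0)) * (1 / k) * R) (at 0)"
      by (rule DERIV_cmult_right, rule DERIV_chain2[OF smooth_realD(1)[OF cutoff(1)]])
         (use k in \<open>auto intro!: derivative_eq_intros\<close>)
    then have "frechet_derivative (eta k) (at x) b = deriv cutoff ((1 / k) * (x \<bullet> b + 0)) * (1 / k) * R"
      using smooth_directional_derivative(2)[OF smooth_eta, of k x b] DERIV_unique unfolding eq by blast
    then have "\<bar>frechet_derivative (eta k) (at x) b\<bar> = \<bar>deriv cutoff ((1 / k) * (x \<bullet> b + 0))\<bar> * (1 / k) * \<bar>R\<bar>"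
      using k by (simp add: abs_mult)
    also have "\<dots> \<le> L * (1 / k) * 1"
      by (intro mult_mono L R) (use k L in auto)
    finally show ?thesis by simp
  qed
  have "F (gradient (eta k) x) \<le> L * upper / k" if k: "0 < k" for k x
  proof -
    have "F (gradient (eta k) x) \<le> (\<Sum>b\<in>Basis. F (frechet_derivative (eta k) (at x) b *\<^sub>R b))"
      unfolding gradient_def by (rule F_sum) simp
    also have "\<dots> \<le> (\<Sum>b\<in>Basis. L / k * F b)"
      unfolding F_homogeneous by (intro sum_mono mult_right_mono partial k F_nonneg)
    also have "\<dots> = L / k * upper"
      unfolding upper_def sum_distrib_left ..
    finally show ?thesis
      by simp
  qed
  then show ?thesis
    using L(1) upper_nonneg by (intro exI[of _ "L * upper"]) simp
qed

text \<open>The support lies in the closed box of half-width r in \<open>ht\<close> and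
  \<open>3/4 * k\<close> transversally, 3/4 being the support radius of
  \<open>cutoff\<close>.\<close>

lemma eta_test_function:
  assumes f: "smooth f" "r < 1" "\<And>t. r \<le> \<bar>t\<bar> \<Longrightarrow> f t = 0" and k: "0 < k"
  shows "(\<lambda>x. f (ht x) * eta k x) \<in> test_functions (\<Omega> k)"
proof (rule test_functionsI)
  show "smooth (\<lambda>x. f (ht x) * eta k x)"
    by (rule smooth_mult[OF smooth_compose[OF f(1) smooth_ht] smooth_eta])
  show "compact (cbox (- corner r (3/4 * k)) (corner r (3/4 * k)))"
    by (rule compact_cbox)
  show "cbox (- corner r (3/4 * k)) (corner r (3/4 * k)) \<subseteq> \<Omega> k"
    using f(2) k by (force simp: subset_iff mem_cbox_corner mem_\<Omega>)
  show "f (ht x) * eta k x = 0" if x: "x \<notin> cbox (- corner r (3/4 * k)) (corner r (3/4 * k))" for x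
  proof (cases "\<bar>ht x\<bar> \<le> r")
    case True
    then obtain b where b: "b \<in> Basis - {e}" "3/4 * k < \<bar>x \<bullet> b\<bar>"
      using x by (auto simp: mem_cbox_corner not_le)
    then have "cutoff ((1 / k) * (x \<bullet> b)) = 0"
      using k by (intro cutoff(5)) (simp add: abs_mult field_simps)
    then have "eta k x = 0"
      unfolding eta_def using b(1) by (intro prod_zero) auto
    then show ?thesis by simp
  qed (use f(3) in simp)
qed

lemma integrable_\<Omega>:
  fixes f :: "'a \<Rightarrow> real"
  assumes "f \<in> borel_measurable (lebesgue_on (\<Omega> k))" "\<And>x. x \<in> \<Omega> k \<Longrightarrow> \<bar>f x\<bar> \<le> B"
  shows "integrable (lebesgue_on (\<Omega> k)) f"
  using assms by (intro integrable_lebesgue_on_bounded[OF _ \<Omega>_bounded \<Omega>_lebesgue, of _ _ B]) auto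

lemma integral_const_\<Omega>: "(LINT x|lebesgue_on (\<Omega> k). (C::real)) = C * vol k"
  by (simp add: measure_restrict_space vol_def)

lemma F_powr_bound: "F \<xi> powr p \<le> upper powr p * norm \<xi> powr p"
  using powr_mono2[of p "F \<xi>" "upper * norm \<xi>"] p F_upper F_nonneg upper_nonneg by (simp add: powr_mult)

section \<open>Lower bound for the eigenvalue\<close>

text \<open>The divergence of the field |\<phi>|^p W(ht) w has integral 0, since \<phi> vanishes
  near the faces, where W blows up. After multiplication by \<mu>^(p-1), Young's inequality bounds
  the term that contains the gradient of \<phi>, and the Riccati equation is exactly what makes all
  terms free of that gradient add up to -\<mu>^p |\<phi>|^p.\<close>

lemma wirtinger_test_function:
  assumes \<phi>: "\<phi> \<in> test_functions (\<Omega> k)"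
  shows "(pi_p p / 2) powr p * (LINT x|lebesgue_on (\<Omega> k). \<bar>\<phi> x\<bar> powr p)
    \<le> (LINT x|lebesgue_on (\<Omega> k). F (gradient \<phi> x) powr p)"
proof -
  define \<mu> where "\<mu> = pi_p p / 2"
  obtain W where \<mu>: "0 < \<mu>"
    and DW: "\<And>t. -1 < t \<Longrightarrow> t < 1 \<Longrightarrow> (W has_real_derivative - (\<mu> * (1 + (p - 1) * \<bar>W t\<bar> powr q))) (at t)"
    unfolding \<mu>_def by (rule riccati[OF p q]) (auto intro: that)
  note tf = test_functionsD[OF \<phi>]
  define W' where "W' t = - (\<mu> * (1 + (p - 1) * \<bar>W t\<bar> powr q))" for t
  define \<psi> where "\<psi> x = \<bar>\<phi> x\<bar> powr p * W (ht x)" for x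
  define D where "D x = p * (sgn (\<phi> x) * \<bar>\<phi> x\<bar> powr (p - 1)) * (gradient \<phi> x \<bullet> w) * W (ht x) + \<bar>\<phi> x\<bar> powr p * W' (ht x)" for x
  have cW: "continuous_on {-1<..<1} W"
  proof (rule DERIV_continuous_on)
    fix t :: real
    assume "t \<in> {-1<..<1}"
    then show "(W has_real_derivative W' t) (at t within {-1<..<1})"
      unfolding W'_def by (intro has_field_derivative_at_within[OF DW]) auto
  qed
  have cW\<Omega>: "continuous_on (\<Omega> k) (\<lambda>x. W (ht x))"
    by (rule continuous_on_compose2[OF cW ht_continuous]) (auto simp: mem_\<Omega> abs_less_iff)
  have csgn: "continuous_on UNIV (\<lambda>t::real. sgn t * \<bar>t\<bar> powr (p - 1))"
    by (rule continuous_on_sgn_abs_powr) (use p in simp)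
  have zero: "\<psi> x = 0" "D x = 0" if "x \<in> - support \<phi>" for x
    using that tf(4)[of x] gradient_test_function_0[OF \<phi>, of x] p by (auto simp: \<psi>_def D_def)
  \<comment> \<open>\<open>W\<close> is controlled only inside the slab. Gluing over the open cover
    by the box and the complement of the support, where both functions are 0, gives continuity on
    the whole space.\<close>
  have cov: "UNIV = \<Omega> k \<union> (- support \<phi>)"
    using tf(3) by auto
  have op: "open (- support \<phi>)"
    by (simp add: support_def open_Compl)
  have cont: "continuous_on UNIV \<psi>" "continuous_on UNIV D"
  proof -
    note c\<phi> = test_function_continuous[OF \<phi>, of "\<Omega> k"]
    have "continuous_on (\<Omega> k) \<psi>"
      unfolding \<psi>_def[abs_def] using p
      by (intro continuous_on_mult continuous_on_abs_powr c\<phi>(1) cW\<Omega>) simp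
    moreover have "continuous_on (\<Omega> k) D"
    proof -
      have 1: "continuous_on (\<Omega> k) (\<lambda>x. sgn (\<phi> x) * \<bar>\<phi> x\<bar> powr (p - 1))"
        by (rule continuous_on_compose2[OF csgn c\<phi>(1)]) simp
      have 2: "continuous_on (\<Omega> k) (\<lambda>x. \<bar>\<phi> x\<bar> powr p * W' (ht x))"
        unfolding W'_def using p pq(1)
        by (intro continuous_on_mult continuous_on_minus continuous_on_add continuous_on_const
            continuous_on_abs_powr c\<phi>(1) cW\<Omega>) simp_all
      show ?thesis
        unfolding D_def[abs_def]
        by (rule continuous_on_add[OF continuous_on_mult[OF continuous_on_mult[OF
              continuous_on_mult[OF continuous_on_const 1] continuous_on_inner[OF c\<phi>(2) continuous_on_const]] cW\<Omega>] 2])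
    qed
    moreover have "continuous_on (- support \<phi>) \<psi>" "continuous_on (- support \<phi>) D"
      by (rule continuous_on_eq[OF continuous_on_const[of _ 0]], simp add: zero)+
    ultimately have "continuous_on (\<Omega> k \<union> (- support \<phi>)) \<psi>" "continuous_on (\<Omega> k \<union> (- support \<phi>)) D"
      using continuous_on_open_Un[OF \<Omega>_open op] by blast+
    then show "continuous_on UNIV \<psi>" "continuous_on UNIV D"
      by (simp_all only: cov[symmetric])
  qed
  have deriv: "((\<lambda>t. \<psi> (x + t *\<^sub>R w)) has_real_derivative D x) (at 0)" for x
  proof (cases "x \<in> \<Omega> k")
    case True
    then have h: "-1 < ht x" "ht x < 1"
      by (auto simp: mem_\<Omega> abs_less_iff)
    have "((\<lambda>t. \<phi> (x + t *\<^sub>R w)) has_real_derivative gradient \<phi> x \<bullet> w) (at 0)"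
      using smooth_directional_derivative(2,3)[OF tf(1), of x w] by simp
    then have 1: "((\<lambda>t. \<bar>\<phi> (x + t *\<^sub>R w)\<bar> powr p) has_real_derivative
        p * (sgn (\<phi> x) * \<bar>\<phi> x\<bar> powr (p - 1)) * (gradient \<phi> x \<bullet> w)) (at 0)"
      using DERIV_chain2[OF has_real_derivative_abs_powr[OF p], of "\<lambda>t. \<phi> (x + t *\<^sub>R w)" _ 0 UNIV] by simp
    have 2: "((\<lambda>t. W (ht x + t)) has_real_derivative W' (ht x) * 1) (at 0)"
      by (rule DERIV_chain2) (use DW[OF h] in \<open>auto simp: W'_def intro!: derivative_eq_intros\<close>)
    show ?thesis
      using DERIV_mult[OF 1 2] by (simp add: \<psi>_def D_def ht_add_w mult_ac add.commute)
  next
    case False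
    then have x: "x \<in> - support \<phi>"
      using tf(3) by auto
    have "open ((\<lambda>t. x + t *\<^sub>R w) -` (- support \<phi>))"
      by (rule open_vimage[OF op]) (intro continuous_intros)
    then have "\<forall>\<^sub>F t in nhds 0. t \<in> (\<lambda>t. x + t *\<^sub>R w) -` (- support \<phi>)"
      by (rule eventually_nhds_in_open) (use x in simp)
    then have "\<forall>\<^sub>F t in nhds 0. \<psi> (x + t *\<^sub>R w) = 0"
      by eventually_elim (use zero(1) in auto)
    then show ?thesis
      using DERIV_cong_ev[of "0::real" 0 "\<lambda>t. \<psi> (x + t *\<^sub>R w)" "\<lambda>_. 0" 0 0] zero(2)[OF x] by simp
  qed
  have int0: "(LINT x|lborel. D x) = 0"
    by (rule integral_derivative_compact_support[OF deriv cont(2,1) tf(2)]) (use zero(1) in auto)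
  have D\<Omega>: "(LINT x|lebesgue_on (\<Omega> k). D x) = 0"
  proof -
    have "(LINT x|lebesgue_on (\<Omega> k). D x) = (LINT x|lborel. D x)"
      by (rule lebesgue_on_integral_eq_lborel[OF borel_measurable_continuous_onI[OF cont(2)] \<Omega>_lebesgue])
         (use zero(2) tf(3) in auto)
    then show ?thesis
      using int0 by simp
  qed
  have pointwise: "\<mu> powr (p - 1) * D x \<le> F (gradient \<phi> x) powr p - \<mu> powr p * \<bar>\<phi> x\<bar> powr p" for x
  proof -
    define a where "a = F (gradient \<phi> x)"
    \<comment> \<open>The power of \<mu> is chosen so that \<open>(p - 1) * b powr q\<close> cancels
      the contribution of the nonlinear part of \<open>W'\<close>.\<close>
    define b where "b = \<mu> powr (p - 1) * (\<bar>\<phi> x\<bar> powr (p - 1) * \<bar>W (ht x)\<bar>)"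
    have ab: "0 \<le> a" "0 \<le> b"
      by (auto simp: a_def b_def F_nonneg)
    have young: "p * (a * b) \<le> a powr p + (p - 1) * b powr q"
    proof -
      have "a * b \<le> a powr p / p + b powr q / q"
        by (rule Youngs_inequality) (use p pq ab in auto)
      then have "p * (a * b) \<le> p * (a powr p / p + b powr q / q)"
        using p by (intro mult_left_mono) auto
      also have "\<dots> = a powr p + (p / q) * b powr q"
        using p by (simp add: distrib_left)
      also have "p / q = p - 1"
        unfolding q using p by simp
      finally show ?thesis .
    qed
    have bq: "b powr q = \<mu> powr p * (\<bar>\<phi> x\<bar> powr p * \<bar>W (ht x)\<bar> powr q)"
      using \<mu> pq(2) by (simp add: b_def powr_mult powr_powr)
    have \<mu>p: "\<mu> powr p = \<mu> powr (p - 1) * \<mu>"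
      using \<mu> by (simp add: powr_diff)
    have "\<mu> powr (p - 1) * (p * (sgn (\<phi> x) * \<bar>\<phi> x\<bar> powr (p - 1)) * (gradient \<phi> x \<bullet> w) * W (ht x))
        \<le> \<bar>\<mu> powr (p - 1) * (p * (sgn (\<phi> x) * \<bar>\<phi> x\<bar> powr (p - 1)) * (gradient \<phi> x \<bullet> w) * W (ht x))\<bar>"
      by (rule abs_ge_self)
    also have "\<dots> = p * (\<bar>sgn (\<phi> x)\<bar> * (\<bar>w \<bullet> gradient \<phi> x\<bar> * b))"
      using p by (simp add: abs_mult b_def inner_commute mult_ac)
    also have "\<dots> \<le> p * (1 * (a * b))"
      unfolding a_def using p ab w_le[of "gradient \<phi> x"]
      by (intro mult_left_mono mult_mono) (auto simp: abs_sgn_eq a_def F_nonneg)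
    also have "\<dots> \<le> a powr p + (p - 1) * b powr q"
      using young by simp
    finally have "\<mu> powr (p - 1) * D x \<le> a powr p + (p - 1) * b powr q + \<mu> powr (p - 1) * (\<bar>\<phi> x\<bar> powr p * W' (ht x))"
      unfolding D_def distrib_left by simp
    also have "\<dots> = a powr p - \<mu> powr p * \<bar>\<phi> x\<bar> powr p"
      unfolding bq W'_def \<mu>p by (simp add: algebra_simps)
    finally show ?thesis
      by (simp add: a_def)
  qed
  obtain B where B: "\<And>x. \<bar>\<phi> x\<bar> \<le> B" "\<And>x. norm (gradient \<phi> x) \<le> B" "0 \<le> B"
    by (rule test_function_bounded[OF \<phi>]) (auto intro: that)
  note [measurable] = continuous_imp_borel_lebesgue_on[OF test_function_continuous(1)[OF \<phi>], of "\<Omega> k"]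
    continuous_imp_borel_lebesgue_on[OF test_function_continuous(2)[OF \<phi>], of "\<Omega> k"]
  have i1: "integrable (lebesgue_on (\<Omega> k)) (\<lambda>x. \<bar>\<phi> x\<bar> powr p)"
    by (rule integrable_\<Omega>[of _ _ "B powr p"]) (use B p in \<open>auto intro!: powr_mono2\<close>)
  have i2: "integrable (lebesgue_on (\<Omega> k)) (\<lambda>x. F (gradient \<phi> x) powr p)"
  proof (rule integrable_\<Omega>)
    show "\<bar>F (gradient \<phi> x) powr p\<bar> \<le> upper powr p * B powr p" for x
      using F_powr_bound[of "gradient \<phi> x"] powr_mono2[of p "norm (gradient \<phi> x)" B] B p
      by (smt (verit) mult_left_mono norm_ge_zero powr_ge_zero)
  qed measurable
  have iD: "integrable (lebesgue_on (\<Omega> k)) D"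
  proof -
    have "bounded (D ` support \<phi>)"
      by (intro compact_imp_bounded compact_continuous_image continuous_on_subset[OF cont(2)] tf(2)) auto
    then obtain M where M: "\<forall>x\<in>support \<phi>. \<bar>D x\<bar> \<le> M"
      unfolding bounded_iff by auto
    have "\<bar>D x\<bar> \<le> max M 0" for x
      using M zero(2)[of x] by (cases "x \<in> support \<phi>") auto
    then show ?thesis
      by (intro integrable_\<Omega>[OF continuous_imp_borel_lebesgue_on[OF cont(2)]])
  qed
  have "(LINT x|lebesgue_on (\<Omega> k). \<mu> powr (p - 1) * D x)
      \<le> (LINT x|lebesgue_on (\<Omega> k). F (gradient \<phi> x) powr p - \<mu> powr p * \<bar>\<phi> x\<bar> powr p)"
    by (intro integral_mono integrable_mult_right Bochner_Integration.integrable_diff i1 i2 iD pointwise)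
  then show ?thesis
    using D\<Omega> i1 i2 by (simp add: Bochner_Integration.integral_diff \<mu>_def)
qed

text \<open>The Riccati argument stays confined to test functions; here both energies pass to the
  limit under one integrable majorant.\<close>

lemma wirtinger:
  assumes S: "sobolev0 p (\<Omega> k) u g"
  shows "(pi_p p / 2) powr p * (LINT x|lebesgue_on (\<Omega> k). \<bar>u x\<bar> powr p)
    \<le> (LINT x|lebesgue_on (\<Omega> k). F (g x) powr p)"
proof -
  let ?M = "lebesgue_on (\<Omega> k)"
  obtain \<phi> E where \<phi>: "\<And>n::nat. \<phi> n \<in> test_functions (\<Omega> k)" and E: "integrable ?M E"
    and dom: "AE x in ?M. \<forall>n. \<bar>\<phi> n x\<bar> powr p + norm (gradient (\<phi> n) x) powr p \<le> E x"
    and lim: "AE x in ?M. (\<lambda>n. \<phi> n x) \<longlonglongrightarrow> u x" "AE x in ?M. (\<lambda>n. gradient (\<phi> n) x) \<longlonglongrightarrow> g x"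
    by (rule sobolev0_dominated_approximation[OF S \<Omega>_bounded \<Omega>_lebesgue p], (rule that; assumption))
  have [measurable]: "u \<in> borel_measurable ?M" "g \<in> borel_measurable ?M"
    using S by (auto simp: sobolev0_def sobolev_def)
  have [measurable]: "\<phi> n \<in> borel_measurable ?M" "gradient (\<phi> n) \<in> borel_measurable ?M" for n
    by (intro continuous_imp_borel_lebesgue_on test_function_continuous[OF \<phi>])+
  have "(\<lambda>n. LINT x|?M. \<bar>\<phi> n x\<bar> powr p) \<longlonglongrightarrow> (LINT x|?M. \<bar>u x\<bar> powr p)"
  proof (rule integral_dominated_convergence[OF _ _ E])
    show "AE x in ?M. (\<lambda>n. \<bar>\<phi> n x\<bar> powr p) \<longlonglongrightarrow> \<bar>u x\<bar> powr p"
      using lim(1) by eventually_elim (use p in \<open>auto intro!: tendsto_intros\<close>)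
    show "AE x in ?M. norm (\<bar>\<phi> n x\<bar> powr p) \<le> E x" for n
      using dom by eventually_elim (smt (verit) powr_ge_zero real_norm_def)
  qed measurable
  moreover have "(\<lambda>n. LINT x|?M. F (gradient (\<phi> n) x) powr p) \<longlonglongrightarrow> (LINT x|?M. F (g x) powr p)"
  proof (rule integral_dominated_convergence[OF _ _ integrable_mult_right[OF E, of "upper powr p"]])
    show "AE x in ?M. (\<lambda>n. F (gradient (\<phi> n) x) powr p) \<longlonglongrightarrow> F (g x) powr p"
      using lim(2)
    proof eventually_elim
      case (elim x)
      have "(\<lambda>n. F (gradient (\<phi> n) x)) \<longlonglongrightarrow> F (g x)"
        by (rule continuous_on_tendsto_compose[OF F_continuous[of UNIV] elim]) auto
      then show ?case
        by (rule tendsto_powr'[OF _ tendsto_const]) (use p F_nonneg in auto)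
    qed
    show "AE x in ?M. norm (F (gradient (\<phi> n) x) powr p) \<le> upper powr p * E x" for n
      using dom
    proof eventually_elim
      case (elim x)
      then have "norm (gradient (\<phi> n) x) powr p \<le> E x"
        by (smt (verit) powr_ge_zero)
      then have "upper powr p * norm (gradient (\<phi> n) x) powr p \<le> upper powr p * E x"
        by (intro mult_left_mono) auto
      then show ?case
        using F_powr_bound[of "gradient (\<phi> n) x"] by simp
    qed
  qed measurable
  ultimately show ?thesis
    by (intro LIMSEQ_le[OF tendsto_mult[OF tendsto_const]]) (use wirtinger_test_function[OF \<phi>] in auto)
qed

text \<open>Both conclusions carry a competitor: in the first it provides the quotient, in the
  second it shows that the set under \<open>Inf\<close> is nonempty, without which an infimum of
  reals could not be bounded from below.\<close>

lemma eigenvalue_le: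
  assumes \<phi>: "\<phi> \<in> test_functions (\<Omega> k)" and pos: "0 < (LINT x|lebesgue_on (\<Omega> k). \<bar>\<phi> x\<bar> powr p)"
  shows "eigenvalue F p (\<Omega> k) \<le> (LINT x|lebesgue_on (\<Omega> k). F (gradient \<phi> x) powr p) / (LINT x|lebesgue_on (\<Omega> k). \<bar>\<phi> x\<bar> powr p)"
    and "(pi_p p / 2) powr p \<le> eigenvalue F p (\<Omega> k)"
proof -
  let ?M = "lebesgue_on (\<Omega> k)"
  define A where "A = {(LINT x|?M. F (g x) powr p) / (LINT x|?M. \<bar>u x\<bar> powr p) | u g.
            sobolev0 p (\<Omega> k) u g \<and> \<not> (AE x in ?M. u x = 0)}"
  have A: "(LINT x|?M. F (gradient \<phi> x) powr p) / (LINT x|?M. \<bar>\<phi> x\<bar> powr p) \<in> A"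
  proof -
    have "\<not> (AE x in ?M. \<phi> x = 0)"
    proof
      assume "AE x in ?M. \<phi> x = 0"
      then have "AE x in ?M. \<bar>\<phi> x\<bar> powr p = 0"
        by eventually_elim (use p in simp)
      then have "(LINT x|?M. \<bar>\<phi> x\<bar> powr p) = 0"
        by (rule integral_eq_zero_AE)
      with pos show False by simp
    qed
    then show ?thesis
      unfolding A_def using sobolev0_test_function[OF \<phi> \<Omega>_bounded \<Omega>_lebesgue p] by blast
  qed
  have low: "(pi_p p / 2) powr p \<le> a" if aA: "a \<in> A" for a
  proof -
    obtain u g where a: "a = (LINT x|?M. F (g x) powr p) / (LINT x|?M. \<bar>u x\<bar> powr p)"
      and S: "sobolev0 p (\<Omega> k) u g" and nz: "\<not> (AE x in ?M. u x = 0)"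
      using aA unfolding A_def by blast
    have int: "integrable ?M (\<lambda>x. \<bar>u x\<bar> powr p)"
      using S by (auto simp: sobolev0_def sobolev_def)
    have "0 \<le> (LINT x|?M. \<bar>u x\<bar> powr p)"
      by (rule Bochner_Integration.integral_nonneg) simp
    moreover have "(LINT x|?M. \<bar>u x\<bar> powr p) \<noteq> 0"
      using nz integral_nonneg_eq_0_iff_AE[OF int] by auto
    ultimately have "0 < (LINT x|?M. \<bar>u x\<bar> powr p)"
      by linarith
    then show ?thesis
      unfolding a using wirtinger[OF S] by (simp add: pos_le_divide_eq)
  qed
  have bdd: "bdd_below A"
    using low by (rule bdd_belowI)
  show "eigenvalue F p (\<Omega> k) \<le> (LINT x|?M. F (gradient \<phi> x) powr p) / (LINT x|?M. \<bar>\<phi> x\<bar> powr p)"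
    unfolding eigenvalue_def A_def[symmetric] by (rule cInf_lower[OF A bdd])
  show "(pi_p p / 2) powr p \<le> eigenvalue F p (\<Omega> k)"
    unfolding eigenvalue_def A_def[symmetric] by (rule cInf_greatest) (use A low in auto)
qed

section \<open>Upper bound for the eigenvalue\<close>

text \<open>By the mean value theorem an increment b raises the p-th power by O(b), uniformly for a
  up to L. This converts a gradient error of order 1/k into an energy error of order 1/k.\<close>

lemma powr_increment_le:
  fixes a b L :: real
  assumes "0 \<le> a" "a \<le> L" "0 \<le> b" "b \<le> 1"
  shows "(a + b) powr p \<le> a powr p + p * (L + 1) powr (p - 1) * b"
proof (cases "b = 0")
  case False
  then have "\<exists>z. a < z \<and> z < a + b \<and> (\<lambda>t. \<bar>t\<bar> powr p) (a + b) - (\<lambda>t. \<bar>t\<bar> powr p) a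
      = (a + b - a) * (p * (sgn z * \<bar>z\<bar> powr (p - 1)))"
    by (intro MVT2 has_real_derivative_abs_powr p) (use assms in auto)
  then obtain z where z: "a < z" "z < a + b" "(a + b) powr p - a powr p = b * (p * z powr (p - 1))"
    using assms by auto
  have "z powr (p - 1) \<le> (L + 1) powr (p - 1)"
    by (rule powr_mono2) (use z assms p in auto)
  then have "b * (p * z powr (p - 1)) \<le> b * (p * (L + 1) powr (p - 1))"
    using assms p by (intro mult_left_mono) auto
  then show ?thesis
    using z(3) by (simp add: mult_ac)
qed simp

text \<open>The competitor is \<open>f (ht x) * eta k x\<close>. Its gradient is
  \<open>eta k x * deriv f (ht x)\<close> times \<open>gradient ht x\<close> up to O(1/k), and
  \<open>F (gradient ht x) = 1\<close>. Numerator and denominator share the factor \<open>Y\<close>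
  introduced below; since the volume is a fixed multiple of \<open>Y\<close>, the error stays of
  order 1/k after division.\<close>

lemma eigenvalue_upper_bound:
  assumes f: "smooth f" "r < 1" "\<And>t. r \<le> \<bar>t\<bar> \<Longrightarrow> f t = 0"
    and pos: "0 < integral {-1..1} (\<lambda>t. \<bar>f t\<bar> powr p)"
  obtains C k0 where "0 < k0"
    "\<And>k. k0 \<le> k \<Longrightarrow> eigenvalue F p (\<Omega> k)
      \<le> (integral {-1..1} (\<lambda>t. \<bar>deriv f t\<bar> powr p) + C / k) / integral {-1..1} (\<lambda>t. \<bar>f t\<bar> powr p)"
    "\<And>k. k0 \<le> k \<Longrightarrow> (pi_p p / 2) powr p \<le> eigenvalue F p (\<Omega> k)"
proof -
  obtain C1 where C1: "0 \<le> C1" "\<And>k x. 0 < k \<Longrightarrow> F (gradient (eta k) x) \<le> C1 / k"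
    using eta_gradient_bound by blast
  have fcont: "continuous_on S f" "continuous_on S (deriv f)" for S
    using smooth_continuous f(1) smooth_realD(2) by blast+
  have "bounded (f ` {-1..1})" "bounded (deriv f ` {-1..1})"
    by (intro compact_imp_bounded compact_continuous_image fcont compact_Icc)+
  then obtain B1 B2 where "\<forall>t\<in>{-1..1}. \<bar>f t\<bar> \<le> B1" "\<forall>t\<in>{-1..1}. \<bar>deriv f t\<bar> \<le> B2"
    unfolding bounded_iff by auto
  then have B: "\<bar>f t\<bar> \<le> B1" "\<bar>deriv f t\<bar> \<le> B2" if "-1 < t" "t < 1" for t
    using that by auto
  have B_nonneg: "0 \<le> B1" "0 \<le> B2"
    using B[of 0] by auto
  \<comment> \<open>Beyond \<open>B1 * C1\<close> the increment \<open>B1 * C1 / k\<close> is at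
    most 1, as \<open>powr_increment_le\<close> requires.\<close>
  define k0 where "k0 = max 1 (B1 * C1)"
  define K where "K = p * (B2 + 1) powr (p - 1) * (B1 * C1)"
  have K: "0 \<le> K"
    using p C1 B_nonneg by (simp add: K_def)
  define X where "X = integral {-1..1} (\<lambda>t. cutoff t powr p)"
  have X: "0 < X"
    unfolding X_def by (rule cutoff_integral_pos) (use p in simp)
  have ccont: "continuous_on UNIV (\<lambda>t. cutoff t powr p)"
    by (intro continuous_on_powr' cutoff_continuous continuous_intros) (use p cutoff(2) in auto)
  have bound: "0 < (LINT x|lebesgue_on (\<Omega> k). \<bar>f (ht x) * eta k x\<bar> powr p) \<and>
      (LINT x|lebesgue_on (\<Omega> k). F (gradient (\<lambda>x. f (ht x) * eta k x) x) powr p) / (LINT x|lebesgue_on (\<Omega> k). \<bar>f (ht x) * eta k x\<bar> powr p)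
      \<le> (integral {-1..1} (\<lambda>t. \<bar>deriv f t\<bar> powr p) + K * 2 * (2 / X) ^ (DIM('a) - 1) / k) / integral {-1..1} (\<lambda>t. \<bar>f t\<bar> powr p)"
    if k: "k0 \<le> k" for k
  proof -
    let ?M = "lebesgue_on (\<Omega> k)"
    define \<phi> where "\<phi> x = f (ht x) * eta k x" for x
    have kpos: "0 < k" "B1 * C1 \<le> k"
      using k by (auto simp: k0_def)
    have \<phi>: "\<phi> \<in> test_functions (\<Omega> k)"
      unfolding \<phi>_def[abs_def] by (rule eta_test_function[OF f kpos(1)])
    have eta_powr: "eta k x powr p = (\<Prod>b\<in>Basis - {e}. cutoff (x \<bullet> b / k) powr p)" for x
      by (simp add: eta_def prod_powr_distrib)
    have prod: "(LINT x|?M. g (ht x) * eta k x powr p) = c * integral {-1..1} g * (k * X) ^ (DIM('a) - 1)"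
      if "continuous_on UNIV g" for g
      unfolding eta_powr X_def by (rule integral_slab_product[OF that ccont kpos(1)])
    have gprod: "gradient \<phi> x = f (ht x) *\<^sub>R gradient (eta k) x + (eta k x * deriv f (ht x)) *\<^sub>R gradient ht x" for x
      unfolding \<phi>_def[abs_def]
      by (simp add: gradient_mult[OF smooth_compose[OF f(1) smooth_ht] smooth_eta] gradient_compose[OF f(1) smooth_ht])
    have pointwise: "F (gradient \<phi> x) powr p \<le> \<bar>deriv f (ht x)\<bar> powr p * eta k x powr p + K / k" if x: "x \<in> \<Omega> k" for x
    proof -
      have h: "-1 < ht x" "ht x < 1"
        using x by (auto simp: mem_\<Omega> abs_less_iff)
      define a where "a = eta k x * \<bar>deriv f (ht x)\<bar>"
      have "F (gradient \<phi> x) \<le> \<bar>f (ht x)\<bar> * F (gradient (eta k) x) + \<bar>eta k x * deriv f (ht x)\<bar> * F (gradient ht x)"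
        unfolding gprod using F_triangle by (simp add: F_homogeneous[symmetric])
      also have "\<dots> \<le> B1 * (C1 / k) + a * 1"
        unfolding F_gradient_ht
        by (intro add_mono mult_mono B h C1 kpos F_nonneg)
           (use B_nonneg eta_bounds in \<open>auto simp: a_def abs_mult\<close>)
      finally have le: "F (gradient \<phi> x) \<le> a + B1 * C1 / k"
        by simp
      have a: "0 \<le> a" "a \<le> B2"
        using eta_bounds[of k x] B(2)[OF h] mult_mono[of "eta k x" 1 "\<bar>deriv f (ht x)\<bar>" B2] by (auto simp: a_def)
      have "F (gradient \<phi> x) powr p \<le> (a + B1 * C1 / k) powr p"
        by (rule powr_mono2) (use le p F_nonneg in auto)
      also have "\<dots> \<le> a powr p + p * (B2 + 1) powr (p - 1) * (B1 * C1 / k)"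
        by (rule powr_increment_le) (use a kpos B_nonneg C1 in auto)
      also have "a powr p = \<bar>deriv f (ht x)\<bar> powr p * eta k x powr p"
        using eta_bounds by (simp add: a_def powr_mult)
      finally show ?thesis
        by (simp add: K_def)
    qed
    obtain B' where B': "\<And>x. \<bar>\<phi> x\<bar> \<le> B'" "\<And>x. norm (gradient \<phi> x) \<le> B'" "0 \<le> B'"
      by (rule test_function_bounded[OF \<phi>]) (auto intro: that)
    note [measurable] = continuous_imp_borel_lebesgue_on[OF test_function_continuous(1)[OF \<phi>], of "\<Omega> k"]
      continuous_imp_borel_lebesgue_on[OF test_function_continuous(2)[OF \<phi>], of "\<Omega> k"]
      continuous_imp_borel_lebesgue_on[OF smooth_continuous[OF smooth_eta[of k]], of "\<Omega> k"]
      continuous_imp_borel_lebesgue_on[OF continuous_on_compose2[OF fcont(2)[of UNIV] ht_continuous[of UNIV]], of "\<Omega> k"]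
    have i1: "integrable ?M (\<lambda>x. \<bar>deriv f (ht x)\<bar> powr p * eta k x powr p)"
    proof (rule integrable_\<Omega>)
      show "\<bar>\<bar>deriv f (ht x)\<bar> powr p * eta k x powr p\<bar> \<le> B2 powr p * 1" if "x \<in> \<Omega> k" for x
        unfolding abs_mult using that eta_bounds B(2)[of "ht x"] p
        by (intro mult_mono) (auto simp: mem_\<Omega> abs_less_iff intro!: powr_mono2 powr_le1)
    qed measurable
    have i2: "integrable ?M (\<lambda>x. F (gradient \<phi> x) powr p)"
    proof (rule integrable_\<Omega>)
      show "\<bar>F (gradient \<phi> x) powr p\<bar> \<le> upper powr p * B' powr p" for x
        using F_powr_bound[of "gradient \<phi> x"] powr_mono2[of p "norm (gradient \<phi> x)" B'] B' p
        by (smt (verit) mult_left_mono norm_ge_zero powr_ge_zero)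
    qed measurable
    have i3: "integrable ?M (\<lambda>x. K / k)"
      by (rule integrable_\<Omega>[of _ _ "\<bar>K / k\<bar>"]) auto
    have num: "(LINT x|?M. F (gradient \<phi> x) powr p)
        \<le> c * integral {-1..1} (\<lambda>t. \<bar>deriv f t\<bar> powr p) * (k * X) ^ (DIM('a) - 1) + K / k * vol k"
    proof -
      have "(LINT x|?M. F (gradient \<phi> x) powr p) \<le> (LINT x|?M. \<bar>deriv f (ht x)\<bar> powr p * eta k x powr p + K / k)"
        by (rule integral_mono[OF i2 Bochner_Integration.integrable_add[OF i1 i3]]) (use pointwise in simp)
      also have "\<dots> = (LINT x|?M. \<bar>deriv f (ht x)\<bar> powr p * eta k x powr p) + K / k * vol k"
        by (subst Bochner_Integration.integral_add[OF i1 i3]) (simp only: integral_const_\<Omega>)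
      also have "(LINT x|?M. \<bar>deriv f (ht x)\<bar> powr p * eta k x powr p)
          = c * integral {-1..1} (\<lambda>t. \<bar>deriv f t\<bar> powr p) * (k * X) ^ (DIM('a) - 1)"
        by (rule prod) (use p in \<open>auto intro!: continuous_intros fcont\<close>)
      finally show ?thesis .
    qed
    have "(LINT x|?M. \<bar>\<phi> x\<bar> powr p) = (LINT x|?M. \<bar>f (ht x)\<bar> powr p * eta k x powr p)"
      using eta_bounds by (simp add: \<phi>_def abs_mult powr_mult)
    also have "\<dots> = c * integral {-1..1} (\<lambda>t. \<bar>f t\<bar> powr p) * (k * X) ^ (DIM('a) - 1)"
      by (rule prod) (use p in \<open>auto intro!: continuous_intros fcont\<close>)
    finally have den: "(LINT x|?M. \<bar>\<phi> x\<bar> powr p) = c * integral {-1..1} (\<lambda>t. \<bar>f t\<bar> powr p) * (k * X) ^ (DIM('a) - 1)" .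
    define Y where "Y = c * (k * X) ^ (DIM('a) - 1)"
    have Y: "0 < Y"
      using c_pos kpos X by (simp add: Y_def)
    have den': "(LINT x|?M. \<bar>\<phi> x\<bar> powr p) = Y * integral {-1..1} (\<lambda>t. \<bar>f t\<bar> powr p)"
      by (simp add: den Y_def mult_ac)
    have vol: "vol k = Y * (2 * (2 / X) ^ (DIM('a) - 1))"
      using X kpos by (simp add: vol_eq Y_def power_mult_distrib power_divide)
    have num': "(LINT x|?M. F (gradient \<phi> x) powr p)
        \<le> Y * (integral {-1..1} (\<lambda>t. \<bar>deriv f t\<bar> powr p) + K * 2 * (2 / X) ^ (DIM('a) - 1) / k)"
    proof -
      have "c * integral {-1..1} (\<lambda>t. \<bar>deriv f t\<bar> powr p) * (k * X) ^ (DIM('a) - 1) + K / k * vol k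
          = Y * (integral {-1..1} (\<lambda>t. \<bar>deriv f t\<bar> powr p) + K * 2 * (2 / X) ^ (DIM('a) - 1) / k)"
        unfolding vol by (simp add: Y_def algebra_simps)
      then show ?thesis
        using num by linarith
    qed
    have "(LINT x|?M. F (gradient \<phi> x) powr p) / (LINT x|?M. \<bar>\<phi> x\<bar> powr p)
        \<le> Y * (integral {-1..1} (\<lambda>t. \<bar>deriv f t\<bar> powr p) + K * 2 * (2 / X) ^ (DIM('a) - 1) / k) / (Y * integral {-1..1} (\<lambda>t. \<bar>f t\<bar> powr p))"
      unfolding den' by (rule divide_right_mono[OF num']) (use Y pos in simp)
    also have "\<dots> = (integral {-1..1} (\<lambda>t. \<bar>deriv f t\<bar> powr p) + K * 2 * (2 / X) ^ (DIM('a) - 1) / k) / integral {-1..1} (\<lambda>t. \<bar>f t\<bar> powr p)"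
      using Y by (rule mult_divide_mult_cancel_left[OF less_imp_neq[symmetric]])
    finally show ?thesis
      using Y pos by (simp add: den' flip: \<phi>_def)
  qed
  show ?thesis
  proof (rule that[of k0 "K * 2 * (2 / X) ^ (DIM('a) - 1)"])
    show "0 < k0"
      by (simp add: k0_def)
    fix k assume k: "k0 \<le> k"
    then have "0 < k"
      by (simp add: k0_def)
    note \<phi> = eta_test_function[OF f this]
    show "eigenvalue F p (\<Omega> k)
      \<le> (integral {-1..1} (\<lambda>t. \<bar>deriv f t\<bar> powr p) + K * 2 * (2 / X) ^ (DIM('a) - 1) / k) / integral {-1..1} (\<lambda>t. \<bar>f t\<bar> powr p)"
      using eigenvalue_le(1)[OF \<phi>] bound[OF k] by (blast intro: order_trans)
    show "(pi_p p / 2) powr p \<le> eigenvalue F p (\<Omega> k)"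
      using eigenvalue_le(2)[OF \<phi>] bound[OF k] by blast
  qed
qed

text \<open>The eigenfunction \<open>S\<close> enters through its smooth compactly supported
  approximants \<open>f n\<close>. The index n is fixed first, to bring the one-dimensional quotient
  close to \<mu>^p, and only then is k sent to infinity, because the error constant of
  \<open>eigenvalue_upper_bound\<close> depends on n.\<close>

lemma eigenvalue_limit: "((\<lambda>k. eigenvalue F p (\<Omega> k)) \<longlongrightarrow> (pi_p p / 2) powr p) at_top"
proof (rule order_tendstoI)
  define \<mu> where "\<mu> = pi_p p / 2"
  obtain W where W: "0 < \<mu>"
    "\<And>t. -1 < t \<Longrightarrow> t < 1 \<Longrightarrow> (W has_real_derivative - (\<mu> * (1 + (p - 1) * \<bar>W t\<bar> powr q))) (at t)"
    "filterlim W at_bot (at_left 1)" "filterlim W at_top (at_right (-1))"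
    unfolding \<mu>_def by (rule riccati[OF p q]) (auto intro: that)
  obtain S S' where S: "continuous_on {-1..1} S" "continuous_on {-1..1} S'" "S (-1) = 0" "S 1 = 0"
    "\<And>t. -1 < t \<Longrightarrow> t < 1 \<Longrightarrow> (S has_real_derivative S' t) (at t)"
    "\<And>t. -1 < t \<Longrightarrow> t < 1 \<Longrightarrow> 0 < S t"
    "integral {-1..1} (\<lambda>t. \<bar>S' t\<bar> powr p) = \<mu> powr p * integral {-1..1} (\<lambda>t. \<bar>S t\<bar> powr p)"
    by (rule generalised_cosine[OF p q W]) (auto intro: that)
  obtain f L where f: "\<And>n. smooth (f n)" "\<And>n. \<exists>r<1. \<forall>t. r \<le> \<bar>t\<bar> \<longrightarrow> f n t = 0"
    "\<And>n t. \<bar>deriv (f n) t\<bar> \<le> L" "\<And>t. -1 < t \<Longrightarrow> t < 1 \<Longrightarrow> (\<lambda>n. deriv (f n) t) \<longlonglongrightarrow> S' t"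
    "uniform_limit {-1..1} f S sequentially"
    by (rule smooth_compact_approximation[OF S(2,1,3,4,5)]) (auto intro: that)
  let ?I = "{-1<..<1::real}"
  have int_open: "integral {-1..1} g = integral ?I g" for g :: "real \<Rightarrow> real"
    by (simp add: integral_open_interval_real)
  have iob: "g integrable_on ?I" if "continuous_on {-1..1} g" for g :: "real \<Rightarrow> real"
    using that by (simp add: integrable_on_open_interval_real integrable_continuous_real)
  have fcont: "continuous_on A (f n)" "continuous_on A (deriv (f n))" for A n
    using smooth_continuous f(1) smooth_realD(2) by blast+
  have num: "(\<lambda>n. integral ?I (\<lambda>t. \<bar>deriv (f n) t\<bar> powr p)) \<longlonglongrightarrow> integral ?I (\<lambda>t. \<bar>S' t\<bar> powr p)"
  proof (rule dominated_convergence(2)[where h = "\<lambda>t. L powr p"])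
    show "(\<lambda>t. \<bar>deriv (f n) t\<bar> powr p) integrable_on ?I" for n
      by (rule iob) (use p in \<open>auto intro!: continuous_intros fcont\<close>)
    show "norm (\<bar>deriv (f n) t\<bar> powr p) \<le> L powr p" for n t
      using f(3)[of n t] p by (auto intro!: powr_mono2)
    show "(\<lambda>n. \<bar>deriv (f n) t\<bar> powr p) \<longlonglongrightarrow> \<bar>S' t\<bar> powr p" if "t \<in> ?I" for t
      using f(4)[of t] that p by (auto intro!: tendsto_intros)
  qed (auto intro!: iob)
  obtain B where "\<forall>t\<in>{-1..1}. \<bar>S t\<bar> \<le> B"
    using compact_imp_bounded[OF compact_continuous_image[OF S(1) compact_Icc]] unfolding bounded_iff by auto
  then have B: "\<bar>S t\<bar> \<le> B" if "t \<in> {-1..1}" for t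
    using that by blast
  have "\<forall>\<^sub>F n in sequentially. \<forall>t\<in>{-1..1}. dist (f n t) (S t) < 1"
    using f(5) by (simp add: uniform_limit_iff)
  \<comment> \<open>Closeness to \<open>S\<close> yields a common bound for the \<open>f n\<close>
    from this index on, hence the shift by \<open>n0\<close> below.\<close>
  then obtain n0 where n0: "\<forall>n\<ge>n0. \<forall>t\<in>{-1..1}. dist (f n t) (S t) < 1"
    unfolding eventually_sequentially by blast
  have fB: "\<bar>f (n + n0) t\<bar> \<le> B + 1" if "t \<in> {-1..1}" for n t
    using n0[rule_format, of "n + n0" t] B[of t] that by (auto simp: dist_real_def)
  have flim: "(\<lambda>n. f n t) \<longlonglongrightarrow> S t" if "t \<in> {-1..1}" for t
    by (rule tendsto_uniform_limitI[OF f(5) that])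
  have "(\<lambda>n. integral ?I (\<lambda>t. \<bar>f (n + n0) t\<bar> powr p)) \<longlonglongrightarrow> integral ?I (\<lambda>t. \<bar>S t\<bar> powr p)"
  proof (rule dominated_convergence(2)[where h = "\<lambda>t. (B + 1) powr p"])
    show "(\<lambda>t. \<bar>f (n + n0) t\<bar> powr p) integrable_on ?I" for n
      by (rule iob) (use p in \<open>auto intro!: continuous_intros fcont\<close>)
    show "norm (\<bar>f (n + n0) t\<bar> powr p) \<le> (B + 1) powr p" if "t \<in> ?I" for n t
      using fB[of t n] that p by (auto intro!: powr_mono2)
    show "(\<lambda>n. \<bar>f (n + n0) t\<bar> powr p) \<longlonglongrightarrow> \<bar>S t\<bar> powr p" if "t \<in> ?I" for t
      using LIMSEQ_ignore_initial_segment[OF flim[of t], of n0] that p by (auto intro!: tendsto_intros)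
  qed (auto intro!: iob)
  then have den: "(\<lambda>n. integral ?I (\<lambda>t. \<bar>f n t\<bar> powr p)) \<longlonglongrightarrow> integral ?I (\<lambda>t. \<bar>S t\<bar> powr p)"
    by (rule LIMSEQ_offset)
  have Spos: "0 < integral {-1..1} (\<lambda>t. \<bar>S t\<bar> powr p)"
  proof -
    have cS: "continuous_on {-1..1} (\<lambda>t. \<bar>S t\<bar> powr p)"
      using p by (intro continuous_intros S) simp
    have "0 < \<bar>S 0\<bar> powr p"
      using S(6)[of 0] by simp
    moreover have "integral {-1..1} (\<lambda>t. \<bar>S t\<bar> powr p) = 0 \<longleftrightarrow> (\<forall>t\<in>{-1..1}. \<bar>S t\<bar> powr p = 0)"
      by (rule integral_eq_0_iff) (use cS in auto)
    moreover have "0 \<le> integral {-1..1} (\<lambda>t. \<bar>S t\<bar> powr p)"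
      by (rule Henstock_Kurzweil_Integration.integral_nonneg) (use cS in \<open>auto intro!: integrable_continuous_real\<close>)
    ultimately show ?thesis
      by force
  qed
  define N where "N n = integral {-1..1} (\<lambda>t. \<bar>deriv (f n) t\<bar> powr p)" for n
  define Dn where "Dn n = integral {-1..1} (\<lambda>t. \<bar>f n t\<bar> powr p)" for n
  have Dlim: "Dn \<longlonglongrightarrow> integral {-1..1} (\<lambda>t. \<bar>S t\<bar> powr p)"
    using den by (simp add: Dn_def[abs_def] int_open)
  have "(\<lambda>n. N n / Dn n) \<longlonglongrightarrow> integral {-1..1} (\<lambda>t. \<bar>S' t\<bar> powr p) / integral {-1..1} (\<lambda>t. \<bar>S t\<bar> powr p)"
    using num Dlim Spos by (intro tendsto_divide) (simp_all add: N_def[abs_def] int_open)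
  then have ratio: "(\<lambda>n. N n / Dn n) \<longlonglongrightarrow> \<mu> powr p"
    using Spos by (simp add: S(7))
  have main: "\<exists>k0>0. \<forall>k\<ge>k0. (pi_p p / 2) powr p \<le> eigenvalue F p (\<Omega> k) \<and> eigenvalue F p (\<Omega> k) < a" if "\<mu> powr p < a" for a
  proof -
    have "\<forall>\<^sub>F n in sequentially. N n / Dn n < a \<and> 0 < Dn n"
      by (intro eventually_conj order_tendstoD(2)[OF ratio that] order_tendstoD(1)[OF Dlim Spos])
    then obtain n where n: "N n / Dn n < a" "0 < Dn n"
      using eventually_happens by fastforce
    obtain r where r: "r < 1" "\<And>t. r \<le> \<bar>t\<bar> \<Longrightarrow> f n t = 0"
      using f(2) by blast
    obtain C k0 where k0: "0 < k0" "\<And>k. k0 \<le> k \<Longrightarrow> eigenvalue F p (\<Omega> k) \<le> (N n + C / k) / Dn n"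
      "\<And>k. k0 \<le> k \<Longrightarrow> (pi_p p / 2) powr p \<le> eigenvalue F p (\<Omega> k)"
      unfolding N_def Dn_def
      by (rule eigenvalue_upper_bound[OF f(1) r n(2)[unfolded Dn_def]]) (auto intro: that)
    have "((\<lambda>k. (N n + C / k) / Dn n) \<longlongrightarrow> (N n + 0) / Dn n) at_top"
      by (intro tendsto_intros) (use n in \<open>auto intro!: real_tendsto_divide_at_top filterlim_ident\<close>)
    then have "\<forall>\<^sub>F k in at_top. (N n + C / k) / Dn n < a"
      by (rule order_tendstoD) (use n in simp)
    then obtain k1 where k1: "\<And>k. k1 \<le> k \<Longrightarrow> (N n + C / k) / Dn n < a"
      by (auto simp: eventually_at_top_linorder)
    show ?thesis
      by (rule exI[of _ "max k0 k1"]) (use k0 k1 in \<open>force intro: le_less_trans\<close>)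
  qed
  show "\<forall>\<^sub>F k in at_top. a < eigenvalue F p (\<Omega> k)" if "a < (pi_p p / 2) powr p" for a
  proof -
    \<comment> \<open>Any level above \<mu>^p would do here; only the lower half of
      \<open>main\<close> is wanted.\<close>
    obtain k0 where "\<forall>k\<ge>k0. (pi_p p / 2) powr p \<le> eigenvalue F p (\<Omega> k)"
      using main[of "\<mu> powr p + 1"] by auto
    then show ?thesis
      using that by (auto simp: eventually_at_top_linorder intro: less_le_trans)
  qed
  show "\<forall>\<^sub>F k in at_top. eigenvalue F p (\<Omega> k) < a" if "(pi_p p / 2) powr p < a" for a
    using main[of a] that by (auto simp: eventually_at_top_linorder \<mu>_def)
qed


section \<open>The torsion function\<close>

text \<open>The shape in which Young's inequality meets \<open>field\<close>, whose size is governed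
  by the power p - 1 of \<open>F\<close>. The sharp first form enters the energy estimates, the
  cruder second one only majorants and error terms.\<close>

lemma young:
  assumes "0 \<le> a" "0 \<le> b"
  shows "a * b powr (p - 1) \<le> a powr p / p + b powr p / q" "a * b powr (p - 1) \<le> a powr p + b powr p"
proof -
  have "(b powr (p - 1)) powr q = b powr p"
    using pq(2) by (simp add: powr_powr)
  then show 1: "a * b powr (p - 1) \<le> a powr p / p + b powr p / q"
    using Youngs_inequality[of p q a "b powr (p - 1)"] assms p pq by simp
  have "a powr p / p \<le> a powr p" "b powr p / q \<le> b powr p"
    using p pq(1) mult_left_mono[of 1 p "a powr p"] mult_left_mono[of 1 q "b powr p"]
    by (simp_all add: divide_le_eq)
  with 1 show "a * b powr (p - 1) \<le> a powr p + b powr p"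
    by linarith
qed

lemma le_one_plus_powr: "0 \<le> a \<Longrightarrow> a \<le> 1 + a powr p"
  using powr_mono[of 1 p a] p by (cases "a \<le> 1") (auto intro: add_increasing2)

lemma powr_pred_le: "0 \<le> b \<Longrightarrow> b powr (p - 1) \<le> 1 + b powr p"
  using young(2)[of 1 b] by simp

lemma bounded_on_\<Omega>:
  fixes f :: "'a \<Rightarrow> 'b::real_normed_vector"
  assumes "continuous_on UNIV f"
  obtains B where "0 \<le> B" "\<And>x. x \<in> \<Omega> k \<Longrightarrow> norm (f x) \<le> B"
proof -
  have "bounded (f ` closure (\<Omega> k))"
    using \<Omega>_bounded by (intro compact_imp_bounded compact_continuous_image continuous_on_subset[OF assms]) (auto simp: compact_closure)
  then obtain B where B: "\<forall>x\<in>closure (\<Omega> k). norm (f x) \<le> B"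
    unfolding bounded_iff by blast
  show ?thesis
  proof (rule that[of "max B 0"])
    show "norm (f x) \<le> max B 0" if "x \<in> \<Omega> k" for x
      using B that closure_subset[of "\<Omega> k"] by (auto intro: max.coboundedI1)
  qed simp
qed

lemma sobolev0_integrable:
  assumes "sobolev0 p (\<Omega> k) u g"
  shows "u \<in> borel_measurable (lebesgue_on (\<Omega> k))" "g \<in> borel_measurable (lebesgue_on (\<Omega> k))"
    "integrable (lebesgue_on (\<Omega> k)) (\<lambda>x. \<bar>u x\<bar> powr p)"
    "integrable (lebesgue_on (\<Omega> k)) (\<lambda>x. F (g x) powr p)"
proof -
  show [measurable]: "u \<in> borel_measurable (lebesgue_on (\<Omega> k))" "g \<in> borel_measurable (lebesgue_on (\<Omega> k))"
    and "integrable (lebesgue_on (\<Omega> k)) (\<lambda>x. \<bar>u x\<bar> powr p)"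
    using assms by (auto simp: sobolev0_def sobolev_def)
  have "integrable (lebesgue_on (\<Omega> k)) (\<lambda>x. upper powr p * norm (g x) powr p)"
    using assms by (auto simp: sobolev0_def sobolev_def)
  then show "integrable (lebesgue_on (\<Omega> k)) (\<lambda>x. F (g x) powr p)"
    by (rule Bochner_Integration.integrable_bound) (use F_powr_bound in auto)
qed

lemma integrable_const_\<Omega>: "integrable (lebesgue_on (\<Omega> k)) (\<lambda>x. C::real)"
  by (rule integrable_\<Omega>[of _ _ "\<bar>C\<bar>"]) auto

lemma sobolev0_approximation:
  assumes S: "sobolev0 p (\<Omega> k) u g"
  obtains \<phi> E where "\<And>n::nat. \<phi> n \<in> test_functions (\<Omega> k)" "integrable (lebesgue_on (\<Omega> k)) E"
    "AE x in lebesgue_on (\<Omega> k). \<forall>n. \<bar>\<phi> n x\<bar> powr p \<le> E x \<and> F (gradient (\<phi> n) x) powr p \<le> E x"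
    "AE x in lebesgue_on (\<Omega> k). (\<lambda>n. \<phi> n x) \<longlonglongrightarrow> u x"
    "AE x in lebesgue_on (\<Omega> k). (\<lambda>n. gradient (\<phi> n) x) \<longlonglongrightarrow> g x"
proof -
  let ?M = "lebesgue_on (\<Omega> k)"
  obtain \<phi> E where \<phi>: "\<And>n::nat. \<phi> n \<in> test_functions (\<Omega> k)" and E: "integrable ?M E"
    and dom: "AE x in ?M. \<forall>n. \<bar>\<phi> n x\<bar> powr p + norm (gradient (\<phi> n) x) powr p \<le> E x"
    and lim: "AE x in ?M. (\<lambda>n. \<phi> n x) \<longlonglongrightarrow> u x" "AE x in ?M. (\<lambda>n. gradient (\<phi> n) x) \<longlonglongrightarrow> g x"
    by (rule sobolev0_dominated_approximation[OF S \<Omega>_bounded \<Omega>_lebesgue p], (rule that; assumption))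
  define C where "C = 1 + upper powr p"
  show ?thesis
  proof (rule that[OF \<phi> _ _ lim])
    show "integrable ?M (\<lambda>x. C * E x)"
      using E by simp
    show "AE x in ?M. \<forall>n. \<bar>\<phi> n x\<bar> powr p \<le> C * E x \<and> F (gradient (\<phi> n) x) powr p \<le> C * E x"
      using dom
    proof eventually_elim
      case (elim x)
      show ?case
      proof
        fix n
        define a b where "a = \<bar>\<phi> n x\<bar> powr p" and "b = norm (gradient (\<phi> n) x) powr p"
        have ab: "0 \<le> a" "0 \<le> b" "a + b \<le> E x"
          using elim by (auto simp: a_def b_def)
        have "a \<le> C * E x"
          using ab mult_right_mono[of 1 C "E x"] by (simp add: C_def)
        moreover have "upper powr p * b \<le> C * E x"
          using ab by (intro mult_mono) (auto simp: C_def)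
        ultimately show "\<bar>\<phi> n x\<bar> powr p \<le> C * E x \<and> F (gradient (\<phi> n) x) powr p \<le> C * E x"
          using F_powr_bound[of "gradient (\<phi> n) x"] by (simp add: a_def b_def)
      qed
    qed
  qed
qed

text \<open>No boundary term arises although \<theta> may be nonzero on the frontier: the identity
  holds for the approximating test functions and survives the dominated limit.\<close>

lemma sobolev0_by_parts:
  assumes S: "sobolev0 p (\<Omega> k) u g"
    and \<theta>: "\<And>x. ((\<lambda>t. \<theta> (x + t *\<^sub>R w)) has_real_derivative D x) (at 0)"
    and cont: "continuous_on UNIV \<theta>" "continuous_on UNIV D"
  shows "(LINT x|lebesgue_on (\<Omega> k). \<theta> x * (g x \<bullet> w)) = - (LINT x|lebesgue_on (\<Omega> k). u x * D x)"
proof -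
  let ?M = "lebesgue_on (\<Omega> k)"
  obtain \<phi> E where \<phi>: "\<And>n::nat. \<phi> n \<in> test_functions (\<Omega> k)" and E: "integrable ?M E"
    and dom: "AE x in ?M. \<forall>n. \<bar>\<phi> n x\<bar> powr p \<le> E x \<and> F (gradient (\<phi> n) x) powr p \<le> E x"
    and lim: "AE x in ?M. (\<lambda>n. \<phi> n x) \<longlonglongrightarrow> u x" "AE x in ?M. (\<lambda>n. gradient (\<phi> n) x) \<longlonglongrightarrow> g x"
    by (rule sobolev0_approximation[OF S], (rule that; assumption))
  note [measurable] = sobolev0_integrable(1,2)[OF S]
  have [measurable]: "\<phi> n \<in> borel_measurable ?M" "gradient (\<phi> n) \<in> borel_measurable ?M" for n
    by (intro continuous_imp_borel_lebesgue_on test_function_continuous[OF \<phi>])+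
  have [measurable]: "\<theta> \<in> borel_measurable ?M" "D \<in> borel_measurable ?M"
    by (intro continuous_imp_borel_lebesgue_on cont)+
  obtain B1 where B1: "0 \<le> B1" "\<And>x. x \<in> \<Omega> k \<Longrightarrow> norm (\<theta> x) \<le> B1"
    by (rule bounded_on_\<Omega>[OF cont(1), of k], (rule that; assumption))
  obtain B2 where B2: "0 \<le> B2" "\<And>x. x \<in> \<Omega> k \<Longrightarrow> norm (D x) \<le> B2"
    by (rule bounded_on_\<Omega>[OF cont(2), of k], (rule that; assumption))
  have E1: "integrable ?M (\<lambda>x. B * (1 + E x))" for B
    using E integrable_const_\<Omega>[of k 1] by simp
  have sp: "AE x in ?M. x \<in> \<Omega> k"
    by (rule AE_I2) simp
  have 1: "(\<lambda>n. LINT x|?M. \<theta> x * (gradient (\<phi> n) x \<bullet> w)) \<longlonglongrightarrow> (LINT x|?M. \<theta> x * (g x \<bullet> w))"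
  proof (rule integral_dominated_convergence[OF _ _ E1[of B1]])
    show "AE x in ?M. (\<lambda>n. \<theta> x * (gradient (\<phi> n) x \<bullet> w)) \<longlonglongrightarrow> \<theta> x * (g x \<bullet> w)"
      using lim(2) by eventually_elim (intro tendsto_intros)
    show "AE x in ?M. norm (\<theta> x * (gradient (\<phi> n) x \<bullet> w)) \<le> B1 * (1 + E x)" for n
      using dom sp
    proof eventually_elim
      case (elim x)
      have "\<bar>gradient (\<phi> n) x \<bullet> w\<bar> \<le> 1 + E x"
        using w_le[of "gradient (\<phi> n) x"] le_one_plus_powr[OF F_nonneg, of "gradient (\<phi> n) x"]
          elim(1)[rule_format, of n]
        by (simp add: inner_commute)
      then show ?case
        using B1 elim(2) by (auto simp: abs_mult intro!: mult_mono)
    qed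
  qed measurable
  have 2: "(\<lambda>n. LINT x|?M. \<phi> n x * D x) \<longlonglongrightarrow> (LINT x|?M. u x * D x)"
  proof (rule integral_dominated_convergence[OF _ _ E1[of B2]])
    show "AE x in ?M. (\<lambda>n. \<phi> n x * D x) \<longlonglongrightarrow> u x * D x"
      using lim(1) by eventually_elim (intro tendsto_intros)
    show "AE x in ?M. norm (\<phi> n x * D x) \<le> B2 * (1 + E x)" for n
      using dom sp
    proof eventually_elim
      case (elim x)
      have "\<bar>\<phi> n x\<bar> \<le> 1 + E x"
        using le_one_plus_powr[of "\<bar>\<phi> n x\<bar>"] elim(1)[rule_format, of n] by simp
      then have "\<bar>D x\<bar> * \<bar>\<phi> n x\<bar> \<le> B2 * (1 + E x)"
        using B2 elim(2) by (intro mult_mono) auto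
      then show ?case
        by (simp add: abs_mult mult.commute)
    qed
  qed measurable
  have "(LINT x|?M. \<theta> x * (gradient (\<phi> n) x \<bullet> w)) = - (LINT x|?M. \<phi> n x * D x)" for n
    by (rule integral_by_parts_test_function[OF \<phi> \<Omega>_lebesgue \<theta> cont])
  then have "(\<lambda>n. LINT x|?M. \<theta> x * (gradient (\<phi> n) x \<bullet> w)) \<longlonglongrightarrow> - (LINT x|?M. u x * D x)"
    using tendsto_minus[OF 2] by simp
  then show ?thesis
    using 1 LIMSEQ_unique by blast
qed

section \<open>Weak solutions of the torsion equation\<close>

text \<open>Names the representative \<open>g\<close> of the weak gradient, which
  \<open>torsion_function\<close> keeps under an existential quantifier, and writes the flux as
  \<open>field\<close>.\<close>

definition weak_solution :: "real \<Rightarrow> ('a \<Rightarrow> real) \<Rightarrow> ('a \<Rightarrow> 'a) \<Rightarrow> bool" where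
  "weak_solution k v g \<longleftrightarrow> sobolev0 p (\<Omega> k) v g \<and> (AE x in lebesgue_on (\<Omega> k). 0 < v x) \<and>
     (\<forall>\<phi>\<in>test_functions (\<Omega> k).
        (LINT x|lebesgue_on (\<Omega> k). field (g x) \<bullet> gradient \<phi> x) = (LINT x|lebesgue_on (\<Omega> k). \<phi> x))"

lemma torsion_function_weak_solution:
  "torsion_function F p (\<Omega> k) v \<Longrightarrow> \<exists>g. weak_solution k v g"
  unfolding torsion_function_def weak_solution_def by (auto simp: field_def)

text \<open>The function \<theta> v - X need not be a test function, but replacing v by its smooth
  approximants makes it one, and since the flux has integrability q the products are dominated. The
  choice \<theta> = 1, X = 0 gives the energy identity; \<theta> = \<open>eta k\<close> with X =
  f(ht) \<open>eta k\<close> gives the localised comparison with a one-dimensional profile.\<close>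

lemma weak_solution_test:
  assumes v: "weak_solution k v g" and \<theta>: "smooth \<theta>" and X: "X \<in> test_functions (\<Omega> k)"
  shows "(LINT x|lebesgue_on (\<Omega> k). field (g x) \<bullet> (\<theta> x *\<^sub>R g x + v x *\<^sub>R gradient \<theta> x - gradient X x))
    = (LINT x|lebesgue_on (\<Omega> k). \<theta> x * v x - X x)"
    and "integrable (lebesgue_on (\<Omega> k)) (\<lambda>x. field (g x) \<bullet> (\<theta> x *\<^sub>R g x + v x *\<^sub>R gradient \<theta> x - gradient X x))"
    and "integrable (lebesgue_on (\<Omega> k)) (\<lambda>x. \<theta> x * v x - X x)"
proof -
  let ?M = "lebesgue_on (\<Omega> k)"
  have S: "sobolev0 p (\<Omega> k) v g"
    and eq: "\<And>\<phi>. \<phi> \<in> test_functions (\<Omega> k) \<Longrightarrow> (LINT x|?M. field (g x) \<bullet> gradient \<phi> x) = (LINT x|?M. \<phi> x)"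
    using v by (auto simp: weak_solution_def)
  obtain \<phi> E where \<phi>: "\<And>n::nat. \<phi> n \<in> test_functions (\<Omega> k)" and E: "integrable ?M E"
    and dom: "AE x in ?M. \<forall>n. \<bar>\<phi> n x\<bar> powr p \<le> E x \<and> F (gradient (\<phi> n) x) powr p \<le> E x"
    and lim: "AE x in ?M. (\<lambda>n. \<phi> n x) \<longlonglongrightarrow> v x" "AE x in ?M. (\<lambda>n. gradient (\<phi> n) x) \<longlonglongrightarrow> g x"
    by (rule sobolev0_approximation[OF S], (rule that; assumption))
  note [measurable] = sobolev0_integrable(1,2)[OF S]
  have [measurable]: "\<phi> n \<in> borel_measurable ?M" "gradient (\<phi> n) \<in> borel_measurable ?M" for n
    by (intro continuous_imp_borel_lebesgue_on test_function_continuous[OF \<phi>])+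
  have [measurable]: "X \<in> borel_measurable ?M" "gradient X \<in> borel_measurable ?M"
    by (intro continuous_imp_borel_lebesgue_on test_function_continuous[OF X])+
  have c\<theta>: "continuous_on UNIV \<theta>" "continuous_on UNIV (gradient \<theta>)"
    unfolding gradient_def[abs_def]
    by (intro continuous_intros smooth_continuous smooth_directional_derivative(1) \<theta>)+
  have [measurable]: "\<theta> \<in> borel_measurable ?M" "gradient \<theta> \<in> borel_measurable ?M"
    by (intro continuous_imp_borel_lebesgue_on c\<theta>)+
  obtain B1 where B1: "0 \<le> B1" "\<And>x. x \<in> \<Omega> k \<Longrightarrow> norm (\<theta> x) \<le> B1"
    by (rule bounded_on_\<Omega>[OF c\<theta>(1), of k], (rule that; assumption))
  have cF: "continuous_on UNIV (\<lambda>x. F (gradient \<theta> x))" "continuous_on UNIV (\<lambda>x. F (gradient X x))"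
    by (intro continuous_on_compose2[OF F_continuous[of UNIV]] c\<theta> test_function_continuous[OF X]; simp)+
  obtain B2 where B2: "0 \<le> B2" "\<And>x. x \<in> \<Omega> k \<Longrightarrow> norm (F (gradient \<theta> x)) \<le> B2"
    by (rule bounded_on_\<Omega>[OF cF(1), of k], (rule that; assumption))
  obtain B3 where B3: "0 \<le> B3" "\<And>x. x \<in> \<Omega> k \<Longrightarrow> norm (F (gradient X x)) \<le> B3"
    by (rule bounded_on_\<Omega>[OF cF(2), of k], (rule that; assumption))
  obtain B4 where B4: "0 \<le> B4" "\<And>x. x \<in> \<Omega> k \<Longrightarrow> norm (X x) \<le> B4"
    by (rule bounded_on_\<Omega>[OF test_function_continuous(1)[OF X], of k], (rule that; assumption))
  have sp: "AE x in ?M. x \<in> \<Omega> k"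
    by (rule AE_I2) simp
  define R where "R x = (B1 + B2) * (E x + F (g x) powr p) + (B3 powr p + F (g x) powr p)" for x
  have R: "integrable ?M R"
    unfolding R_def[abs_def] using E sobolev0_integrable(4)[OF S] integrable_const_\<Omega>[of k] by simp
  have lim1: "AE x in ?M. (\<lambda>n. field (g x) \<bullet> (\<theta> x *\<^sub>R gradient (\<phi> n) x + \<phi> n x *\<^sub>R gradient \<theta> x - gradient X x))
      \<longlonglongrightarrow> field (g x) \<bullet> (\<theta> x *\<^sub>R g x + v x *\<^sub>R gradient \<theta> x - gradient X x)"
    using lim by eventually_elim (intro tendsto_intros)
  have dom1: "AE x in ?M. norm (field (g x) \<bullet> (\<theta> x *\<^sub>R gradient (\<phi> n) x + \<phi> n x *\<^sub>R gradient \<theta> x - gradient X x)) \<le> R x" for n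
    using dom sp
  proof eventually_elim
    case (elim x)
    define s where "s = F (g x)"
    have s: "0 \<le> s" by (simp add: s_def F_nonneg)
    have "\<bar>field (g x) \<bullet> gradient (\<phi> n) x\<bar> \<le> E x + s powr p"
      using field_le[of "g x" "gradient (\<phi> n) x"] young(2)[OF F_nonneg s, of "gradient (\<phi> n) x"] elim(1)
      by (simp add: s_def mult.commute) (smt (verit))
    then have 1: "\<bar>\<theta> x\<bar> * \<bar>field (g x) \<bullet> gradient (\<phi> n) x\<bar> \<le> B1 * (E x + s powr p)"
      using B1 elim(2) by (intro mult_mono) auto
    have "\<bar>\<phi> n x\<bar> * \<bar>field (g x) \<bullet> gradient \<theta> x\<bar> \<le> \<bar>\<phi> n x\<bar> * (s powr (p - 1) * B2)"
      using field_le[of "g x" "gradient \<theta> x"] B2(2)[OF elim(2)]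
        mult_left_mono[of "F (gradient \<theta> x)" B2 "s powr (p - 1)"] F_nonneg[of "gradient \<theta> x"]
      by (intro mult_left_mono) (auto simp: s_def)
    also have "\<dots> = B2 * (\<bar>\<phi> n x\<bar> * s powr (p - 1))"
      by simp
    also have "\<dots> \<le> B2 * (E x + s powr p)"
    proof (rule mult_left_mono[OF _ B2(1)])
      have "\<bar>\<phi> n x\<bar> * s powr (p - 1) \<le> \<bar>\<phi> n x\<bar> powr p + s powr p"
        by (rule young(2)) (use s in auto)
      also have "\<dots> \<le> E x + s powr p"
        using elim(1) by simp
      finally show "\<bar>\<phi> n x\<bar> * s powr (p - 1) \<le> E x + s powr p" .
    qed
    finally have 2: "\<bar>\<phi> n x\<bar> * \<bar>field (g x) \<bullet> gradient \<theta> x\<bar> \<le> B2 * (E x + s powr p)" .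
    have "\<bar>field (g x) \<bullet> gradient X x\<bar> \<le> B3 * s powr (p - 1)"
      using field_le[of "g x" "gradient X x"] B3(2)[OF elim(2)]
        mult_left_mono[of "F (gradient X x)" B3 "s powr (p - 1)"] F_nonneg[of "gradient X x"]
      by (simp add: s_def mult.commute)
    also have "\<dots> \<le> B3 powr p + s powr p"
      by (rule young(2)) (use s B3 in auto)
    finally have 3: "\<bar>field (g x) \<bullet> gradient X x\<bar> \<le> B3 powr p + s powr p" .
    have "\<bar>field (g x) \<bullet> (\<theta> x *\<^sub>R gradient (\<phi> n) x + \<phi> n x *\<^sub>R gradient \<theta> x - gradient X x)\<bar>
        \<le> \<bar>\<theta> x\<bar> * \<bar>field (g x) \<bullet> gradient (\<phi> n) x\<bar> + \<bar>\<phi> n x\<bar> * \<bar>field (g x) \<bullet> gradient \<theta> x\<bar> + \<bar>field (g x) \<bullet> gradient X x\<bar>"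
      unfolding inner_diff_right inner_add_right inner_scaleR_right abs_mult[symmetric] by linarith
    also have "\<dots> \<le> R x"
      using 1 2 3 by (simp add: R_def s_def distrib_right)
    finally show ?case
      by simp
  qed
  show int1: "integrable ?M (\<lambda>x. field (g x) \<bullet> (\<theta> x *\<^sub>R g x + v x *\<^sub>R gradient \<theta> x - gradient X x))"
    by (rule integrable_dominated_convergence[OF _ _ R lim1 dom1]) measurable
  define R2 where "R2 x = B1 * (1 + E x) + B4" for x
  have R2: "integrable ?M R2"
    unfolding R2_def[abs_def] using E integrable_const_\<Omega>[of k] by simp
  have lim2: "AE x in ?M. (\<lambda>n. \<theta> x * \<phi> n x - X x) \<longlonglongrightarrow> \<theta> x * v x - X x"
    using lim(1) by eventually_elim (intro tendsto_intros)
  have dom2: "AE x in ?M. norm (\<theta> x * \<phi> n x - X x) \<le> R2 x" for n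
    using dom sp
  proof eventually_elim
    case (elim x)
    have "\<bar>\<phi> n x\<bar> \<le> 1 + E x"
      using le_one_plus_powr[of "\<bar>\<phi> n x\<bar>"] elim(1)[rule_format, of n] by simp
    then have "\<bar>\<theta> x * \<phi> n x\<bar> \<le> B1 * (1 + E x)"
      unfolding abs_mult using B1 elim(2) by (intro mult_mono) auto
    then show ?case
      using B4(2)[OF elim(2)] by (simp add: R2_def)
  qed
  show "integrable ?M (\<lambda>x. \<theta> x * v x - X x)"
    by (rule integrable_dominated_convergence[OF _ _ R2 lim2 dom2]) measurable
  have "(LINT x|?M. field (g x) \<bullet> (\<theta> x *\<^sub>R gradient (\<phi> n) x + \<phi> n x *\<^sub>R gradient \<theta> x - gradient X x))
      = (LINT x|?M. \<theta> x * \<phi> n x - X x)" for n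
  proof -
    have s: "smooth (\<phi> n)" "smooth X"
      using test_functionsD(1) \<phi> X by blast+
    have "(\<lambda>x. \<theta> x * \<phi> n x - X x) \<in> test_functions (\<Omega> k)"
    proof (rule test_functionsI)
      show "smooth (\<lambda>x. \<theta> x * \<phi> n x - X x)"
        by (rule smooth_diff[OF smooth_mult[OF \<theta> s(1)] s(2)])
      show "compact (support (\<phi> n) \<union> support X)"
        using test_functionsD(2) \<phi> X by (intro compact_Un) blast+
      show "support (\<phi> n) \<union> support X \<subseteq> \<Omega> k"
        using test_functionsD(3)[OF \<phi>] test_functionsD(3)[OF X] by blast
      show "\<theta> x * \<phi> n x - X x = 0" if "x \<notin> support (\<phi> n) \<union> support X" for x
        using test_functionsD(4)[OF \<phi>] test_functionsD(4)[OF X] that by simp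
    qed
    from eq[OF this] show ?thesis
      unfolding gradient_diff[OF smooth_mult[OF \<theta> s(1)] s(2)] gradient_mult[OF \<theta> s(1)] .
  qed
  moreover have "(\<lambda>n. LINT x|?M. field (g x) \<bullet> (\<theta> x *\<^sub>R gradient (\<phi> n) x + \<phi> n x *\<^sub>R gradient \<theta> x - gradient X x))
      \<longlonglongrightarrow> (LINT x|?M. field (g x) \<bullet> (\<theta> x *\<^sub>R g x + v x *\<^sub>R gradient \<theta> x - gradient X x))"
    by (rule integral_dominated_convergence[OF _ _ R lim1 dom1]) measurable
  moreover have "(\<lambda>n. LINT x|?M. \<theta> x * \<phi> n x - X x) \<longlonglongrightarrow> (LINT x|?M. \<theta> x * v x - X x)"
    by (rule integral_dominated_convergence[OF _ _ R2 lim2 dom2]) measurable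
  ultimately show "(LINT x|?M. field (g x) \<bullet> (\<theta> x *\<^sub>R g x + v x *\<^sub>R gradient \<theta> x - gradient X x))
    = (LINT x|?M. \<theta> x * v x - X x)"
    using LIMSEQ_unique by simp
qed

lemma zero_test_function: "(\<lambda>x. 0) \<in> test_functions (\<Omega> k)"
  by (rule test_functionsI[of _ "{}"]) auto

text \<open>Testing with v equates the energy with the integral of v, and integration by parts
  against \<open>ht x *\<^sub>R w\<close> bounds the latter by the integral of F(g); Young's
  inequality then lets part of the energy be absorbed. A bound by the volume, rather than mere
  finiteness, keeps cutoff errors of order 1/k relative to the volume.\<close>

lemma weak_solution_energy:
  assumes v: "weak_solution k v g"
  shows "(LINT x|lebesgue_on (\<Omega> k). F (g x) powr p) \<le> vol k"
proof -
  let ?M = "lebesgue_on (\<Omega> k)"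
  have S: "sobolev0 p (\<Omega> k) v g"
    using v by (simp add: weak_solution_def)
  note [measurable] = sobolev0_integrable(1,2)[OF S]
  note iF = sobolev0_integrable(4)[OF S]
  have g0: "gradient (\<lambda>x. C::real) x = 0" for x :: 'a and C
    by (simp add: gradient_def)
  have 1: "(LINT x|?M. F (g x) powr p) = (LINT x|?M. v x)"
    using weak_solution_test(1)[OF v smooth_const[of 1] zero_test_function] by (simp add: g0 field_self)
  have 2: "(LINT x|?M. ht x * (g x \<bullet> w)) = - (LINT x|?M. v x * 1)"
    by (rule sobolev0_by_parts[OF S]) (auto simp: ht_add_w intro!: derivative_eq_intros ht_continuous)
  have [measurable]: "ht \<in> borel_measurable ?M"
    by (intro continuous_imp_borel_lebesgue_on ht_continuous)
  have bd: "\<bar>ht x * (g x \<bullet> w)\<bar> \<le> F (g x) powr p / p + 1 / q" if "x \<in> \<Omega> k" for x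
  proof -
    have "\<bar>ht x * (g x \<bullet> w)\<bar> \<le> 1 * F (g x)"
      unfolding abs_mult using that w_le[of "g x"] by (intro mult_mono) (auto simp: mem_\<Omega> inner_commute F_nonneg)
    also have "\<dots> \<le> F (g x) powr p / p + 1 / q"
      using young(1)[of "F (g x)" 1] F_nonneg by simp
    finally show ?thesis .
  qed
  have i2: "integrable ?M (\<lambda>x. F (g x) powr p / p + 1 / q)"
    using iF integrable_const_\<Omega>[of k "1 / q"] by simp
  have i3: "integrable ?M (\<lambda>x. - (ht x * (g x \<bullet> w)))"
    by (rule Bochner_Integration.integrable_bound[OF i2])
       (use bd in \<open>auto intro!: AE_I2 simp: p pq F_nonneg, smt (verit, best)\<close>)
  have "(LINT x|?M. - (ht x * (g x \<bullet> w))) \<le> (LINT x|?M. F (g x) powr p / p + 1 / q)"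
    by (rule integral_mono[OF i3 i2]) (use bd in \<open>auto simp: abs_le_iff\<close>)
  also have "\<dots> = (LINT x|?M. F (g x) powr p) / p + vol k / q"
    using iF integrable_const_\<Omega>[of k "1 / q"] integral_const_\<Omega>[of k "1 / q"]
    by (subst Bochner_Integration.integral_add) auto
  finally have "(LINT x|?M. F (g x) powr p) \<le> (LINT x|?M. F (g x) powr p) / p + vol k / q"
    using 1 2 by simp
  then have "(LINT x|?M. F (g x) powr p) * (1 - 1 / p) \<le> vol k / q"
    by (simp add: algebra_simps)
  also have "1 - 1 / p = 1 / q"
    using pq(6) by simp
  finally show ?thesis
    using pq(1) by (simp add: divide_le_cancel)
qed

section \<open>Comparison with the slab\<close>

definition slab_torsion :: "real \<Rightarrow> real" where
  "slab_torsion t = (1 - \<bar>t\<bar> powr q) / q"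

definition slab_torsion' :: "real \<Rightarrow> real" where
  "slab_torsion' t = - (sgn t * \<bar>t\<bar> powr (q - 1))"

lemma slab_torsion_deriv: "(slab_torsion has_real_derivative slab_torsion' t) (at t)"
proof -
  have "(slab_torsion has_real_derivative (0 - q * (sgn t * \<bar>t\<bar> powr (q - 1))) / q) (at t)"
    unfolding slab_torsion_def[abs_def]
    by (intro DERIV_cdivide DERIV_diff DERIV_const has_real_derivative_abs_powr pq(1))
  then show ?thesis
    using pq(1) by (simp add: slab_torsion'_def)
qed

lemma slab_torsion_continuous: "continuous_on S slab_torsion" "continuous_on S slab_torsion'"
proof -
  show "continuous_on S slab_torsion"
    by (rule DERIV_continuous_on[OF DERIV_subset[OF slab_torsion_deriv subset_UNIV]])
  show "continuous_on S slab_torsion'"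
    unfolding slab_torsion'_def[abs_def] using pq(1)
    by (intro continuous_on_minus continuous_on_sgn_abs_powr) simp
qed

lemma slab_torsion_bounds: "\<bar>t\<bar> \<le> 1 \<Longrightarrow> 0 \<le> slab_torsion t" "slab_torsion t \<le> 1 / q"
proof -
  show "0 \<le> slab_torsion t" if "\<bar>t\<bar> \<le> 1"
    using powr_le1[of q "\<bar>t\<bar>"] that pq(1) by (simp add: slab_torsion_def)
  show "slab_torsion t \<le> 1 / q"
    using pq(1) by (simp add: slab_torsion_def divide_right_mono)
qed

lemma slab_torsion_approximation:
  obtains f L where "\<And>n::nat. smooth (f n)" "\<And>n. \<exists>r<1. \<forall>t. r \<le> \<bar>t\<bar> \<longrightarrow> f n t = 0"
    "\<And>n t. \<bar>deriv (f n) t\<bar> \<le> L"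
    "\<And>t. -1 < t \<Longrightarrow> t < 1 \<Longrightarrow> (\<lambda>n. deriv (f n) t) \<longlonglongrightarrow> slab_torsion' t"
    "uniform_limit {-1..1} f slab_torsion sequentially"
proof (rule smooth_compact_approximation[OF slab_torsion_continuous(2,1)])
  show "slab_torsion (- 1) = 0" "slab_torsion 1 = 0"
    by (simp_all add: slab_torsion_def)
  show "(slab_torsion has_real_derivative slab_torsion' t) (at t)" for t
    by (rule slab_torsion_deriv)
qed (rule that; assumption)

text \<open>Here \<open>- ht x *\<^sub>R w\<close> is the field of the gradient of \<open>slab_torsion \<circ> ht\<close>, so \<open>gap\<close> is the monotonicity
  gap of \<open>field\<close>; only its consequence in the single direction \<open>w\<close> is needed.\<close>

lemma monotonicity_gap:
  fixes \<xi> :: 'a and x :: 'a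
  defines "gap \<equiv> (field \<xi> + ht x *\<^sub>R w) \<bullet> (\<xi> - slab_torsion' (ht x) *\<^sub>R gradient ht x)"
  shows "0 \<le> gap" and "gap = 0 \<Longrightarrow> \<xi> \<bullet> w = slab_torsion' (ht x)"
proof -
  define t where "t = ht x"
  define \<sigma> where "\<sigma> = sgn t"
  define \<rho> where "\<rho> = \<bar>t\<bar> powr (q - 1)"
  define s where "s = F \<xi>"
  \<comment> \<open>\<open>\<rho>\<close> is the \<open>F\<close>-length of the slab gradient
    \<open>slab_torsion' (ht x) *\<^sub>R gradient ht x\<close>, and \<open>\<tau>\<close>, which is
    at most \<open>s\<close>, measures \<xi> along it by means of \<open>w\<close>.\<close>
  define \<tau> where "\<tau> = - (\<sigma> * (w \<bullet> \<xi>))"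
  have s: "0 \<le> s" and \<rho>: "0 \<le> \<rho>"
    by (auto simp: s_def F_nonneg \<rho>_def)
  have \<sigma>: "\<bar>\<sigma>\<bar> \<le> 1"
    by (simp add: \<sigma>_def sgn_if)
  have \<tau>: "\<tau> \<le> s"
  proof -
    have "\<tau> \<le> \<bar>\<sigma>\<bar> * \<bar>w \<bullet> \<xi>\<bar>"
      unfolding \<tau>_def abs_mult[symmetric] by linarith
    also have "\<dots> \<le> 1 * F \<xi>"
      by (intro mult_mono \<sigma> w_le) auto
    finally show ?thesis by (simp add: s_def)
  qed
  have \<rho>1: "\<rho> powr (p - 1) = \<bar>t\<bar>"
    using pq(5) by (simp add: \<rho>_def powr_powr mult.commute)
  have \<rho>p: "\<rho> * \<rho> powr (p - 1) = \<rho> powr p"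
    using \<rho> p by (cases "\<rho> = 0") (auto simp: powr_diff)
  have sp: "s * s powr (p - 1) = s powr p"
    using s p by (cases "s = 0") (auto simp: powr_diff)
  have t: "t = \<sigma> * \<rho> powr (p - 1)"
    by (simp add: \<rho>1 \<sigma>_def sgn_mult_abs)
  have "gap = s powr p + \<sigma> * \<rho> * (field \<xi> \<bullet> gradient ht x) + t * (w \<bullet> \<xi>) + t * (\<sigma> * \<rho>)"
    unfolding gap_def slab_torsion'_def t_def[symmetric] \<sigma>_def[symmetric] \<rho>_def[symmetric]
    by (simp add: inner_diff_right inner_add_left field_self w_gradient_ht s_def algebra_simps)
  moreover have "- (\<rho> * s powr (p - 1)) \<le> \<sigma> * \<rho> * (field \<xi> \<bullet> gradient ht x)"
  proof -
    have "\<bar>\<sigma> * \<rho> * (field \<xi> \<bullet> gradient ht x)\<bar> = \<bar>\<sigma>\<bar> * (\<rho> * \<bar>field \<xi> \<bullet> gradient ht x\<bar>)"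
      using \<rho> by (simp add: abs_mult)
    also have "\<dots> \<le> 1 * (\<rho> * (s powr (p - 1) * 1))"
      using field_le[of \<xi> "gradient ht x"] \<rho> by (intro mult_mono \<sigma>) (auto simp: s_def F_gradient_ht)
    finally show ?thesis by simp
  qed
  moreover have "t * (w \<bullet> \<xi>) = - (\<rho> powr (p - 1) * \<tau>)"
    by (subst t) (simp add: \<tau>_def mult_ac)
  moreover have "t * (\<sigma> * \<rho>) = \<rho> powr p"
  proof -
    have "t * \<sigma> = \<bar>t\<bar>"
      by (simp add: \<sigma>_def abs_sgn)
    then show ?thesis
      using \<rho>p \<rho>1 by (simp add: mult_ac flip: mult.assoc)
  qed
  ultimately have "s powr p - \<rho> * s powr (p - 1) - \<rho> powr (p - 1) * \<tau> + \<rho> powr p \<le> gap"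
    by linarith
  \<comment> \<open>Both summands are nonnegative, the first because the power p - 1 is increasing,
    the second because \<open>\<tau> \<le> s\<close>. If the first vanishes then s = \<rho>; if the
    second vanishes then \<tau> = s or \<rho> = 0.\<close>
  also have "s powr p - \<rho> * s powr (p - 1) - \<rho> powr (p - 1) * \<tau> + \<rho> powr p
      = (s powr (p - 1) - \<rho> powr (p - 1)) * (s - \<rho>) + \<rho> powr (p - 1) * (s - \<tau>)"
    using sp \<rho>p by (simp add: algebra_simps)
  finally have low: "(s powr (p - 1) - \<rho> powr (p - 1)) * (s - \<rho>) + \<rho> powr (p - 1) * (s - \<tau>) \<le> gap" .
  have mono: "0 \<le> (s powr (p - 1) - \<rho> powr (p - 1)) * (s - \<rho>)"
    using powr_mono2[of "p - 1" s \<rho>] powr_mono2[of "p - 1" \<rho> s] p s \<rho>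
    by (cases "s \<le> \<rho>") (auto intro: mult_nonpos_nonpos)
  have nn: "0 \<le> \<rho> powr (p - 1) * (s - \<tau>)"
    using \<tau> by simp
  show "0 \<le> gap"
    using low mono nn by linarith
  show "\<xi> \<bullet> w = slab_torsion' (ht x)" if "gap = 0"
  proof -
    have z: "(s powr (p - 1) - \<rho> powr (p - 1)) * (s - \<rho>) = 0" "\<rho> powr (p - 1) * (s - \<tau>) = 0"
      using that low mono nn by linarith+
    have "s = \<rho>"
    proof (rule ccontr)
      assume "s \<noteq> \<rho>"
      with z(1) have "s powr (p - 1) = \<rho> powr (p - 1)"
        by simp
      then show False
        using \<open>s \<noteq> \<rho>\<close> powr_less_mono2[of "p - 1" s \<rho>] powr_less_mono2[of "p - 1" \<rho> s] p s \<rho>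
        by (cases s \<rho> rule: linorder_cases) auto
    qed
    show ?thesis
    proof (cases "t = 0")
      case True
      then have "\<rho> = 0"
        by (simp add: \<rho>_def)
      then have "F \<xi> = 0"
        using \<open>s = \<rho>\<close> by (simp add: s_def)
      then have "w \<bullet> \<xi> = 0"
        using w_le[of \<xi>] by simp
      then show ?thesis
        using True by (simp add: slab_torsion'_def inner_commute flip: t_def)
    next
      case False
      then have "0 < \<rho>"
        by (simp add: \<rho>_def)
      with z(2) have "s = \<tau>"
        by simp
      with \<open>s = \<rho>\<close> have "\<sigma> * (w \<bullet> \<xi>) = - \<rho>"
        by (simp add: \<tau>_def)
      then have "\<sigma> * \<sigma> * (w \<bullet> \<xi>) = - (\<sigma> * \<rho>)"
        by (simp add: mult.assoc)
      moreover have "\<sigma> * \<sigma> = 1"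
        using False by (simp add: \<sigma>_def sgn_if)
      ultimately show ?thesis
        by (simp add: slab_torsion'_def inner_commute flip: t_def \<sigma>_def \<rho>_def)
    qed
  qed
qed

text \<open>Comparison with the slab: the equation is tested with \<open>G (v - slab_torsion \<circ> ht)\<close>, where \<open>G\<close> vanishes
  below \<open>\<delta>\<close>, so that replacing \<open>v\<close> and \<open>slab_torsion\<close> by smooth approximations gives test functions.\<close>

lemma weak_solution_le:
  assumes v: "weak_solution k v g"
  shows "AE x in lebesgue_on (\<Omega> k). v x \<le> 1 / q"
proof -
  let ?M = "lebesgue_on (\<Omega> k)"
  have S: "sobolev0 p (\<Omega> k) v g"
    and eq: "\<And>\<phi>. \<phi> \<in> test_functions (\<Omega> k) \<Longrightarrow> (LINT x|?M. field (g x) \<bullet> gradient \<phi> x) = (LINT x|?M. \<phi> x)"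
    using v by (auto simp: weak_solution_def)
  obtain \<phi> E where \<phi>: "\<And>n::nat. \<phi> n \<in> test_functions (\<Omega> k)" and E: "integrable ?M E"
    and dom: "AE x in ?M. \<forall>n. \<bar>\<phi> n x\<bar> powr p \<le> E x \<and> F (gradient (\<phi> n) x) powr p \<le> E x"
    and lim: "AE x in ?M. (\<lambda>n. \<phi> n x) \<longlonglongrightarrow> v x" "AE x in ?M. (\<lambda>n. gradient (\<phi> n) x) \<longlonglongrightarrow> g x"
    by (rule sobolev0_approximation[OF S], (rule that; assumption))
  note [measurable] = sobolev0_integrable(1,2)[OF S]
  note iF = sobolev0_integrable(4)[OF S]
  have sp: "AE x in ?M. x \<in> \<Omega> k"
    by (rule AE_I2) simp
  have \<phi>s: "smooth (\<phi> n)" for n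
    by (rule test_functionsD(1)[OF \<phi>])
  obtain f L where f: "\<And>n. smooth (f n)" "\<And>n. \<exists>r<1. \<forall>t. r \<le> \<bar>t\<bar> \<longrightarrow> f n t = 0"
    "\<And>n t. \<bar>deriv (f n) t\<bar> \<le> L" "\<And>t. -1 < t \<Longrightarrow> t < 1 \<Longrightarrow> (\<lambda>n. deriv (f n) t) \<longlonglongrightarrow> slab_torsion' t"
    "uniform_limit {-1..1} f slab_torsion sequentially"
    by (rule slab_torsion_approximation, (rule that; assumption))
  have L0: "0 \<le> L"
    using f(3)[of 0 0] by linarith
  have main: "AE x in ?M. v x \<le> 1 / q + \<delta>" if \<delta>: "0 < \<delta>" for \<delta>
  proof -
    have "\<forall>\<^sub>F n in sequentially. \<forall>t\<in>{-1..1}. dist (f n t) (slab_torsion t) < \<delta>"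
      using f(5) \<delta> by (simp add: uniform_limit_iff)
    then obtain n0 where n0: "\<forall>n\<ge>n0. \<forall>t\<in>{-1..1}. dist (f n t) (slab_torsion t) < \<delta>"
      unfolding eventually_sequentially by blast
    define h where "h n = f (n + n0)" for n
    have h_close: "\<bar>h n t - slab_torsion t\<bar> < \<delta>" if "\<bar>t\<bar> \<le> 1" for n t
      using n0[rule_format, of "n + n0" t] that by (auto simp: h_def dist_real_def abs_le_iff)
    \<comment> \<open>Where \<open>\<phi> n\<close> is 0 the argument
      \<open>\<phi> n x - h n (ht x)\<close> is therefore at most \<delta> and \<open>G\<close>
      vanishes: the compact support of the test function is inherited from \<open>\<phi> n\<close>
      alone.\<close>
    have h_low: "- \<delta> \<le> h n t" for n t
    proof (cases "\<bar>t\<bar> \<le> 1")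
      case True
      then show ?thesis
        using h_close[OF True, of n] slab_torsion_bounds(1)[OF True] by linarith
    next
      case False
      obtain r where "r < 1" "\<forall>t. r \<le> \<bar>t\<bar> \<longrightarrow> h n t = 0"
        using f(2) by (auto simp: h_def)
      then show ?thesis
        using False \<delta> by auto
    qed
    have hs: "smooth (h n)" for n
      by (simp add: h_def f(1))
    have hlim: "(\<lambda>n. h n t) \<longlonglongrightarrow> slab_torsion t" if "\<bar>t\<bar> \<le> 1" for t
      unfolding h_def using tendsto_uniform_limitI[OF f(5), of t] that
      by (intro LIMSEQ_ignore_initial_segment) (auto simp: abs_le_iff)
    have h'lim: "(\<lambda>n. deriv (h n) t) \<longlonglongrightarrow> slab_torsion' t" if "\<bar>t\<bar> < 1" for t
      unfolding h_def using f(4)[of t] that by (intro LIMSEQ_ignore_initial_segment) (auto simp: abs_less_iff)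
    \<comment> \<open>The derivative of \<open>G\<close>: smooth, between 0 and 1, and positive
      exactly above \<delta>. The threshold leaves room for the approximation error of
      \<open>h n\<close>.\<close>
    define \<gamma> where "\<gamma> = (\<lambda>s. flat 0 (s - \<delta>))"
    have \<gamma>: "0 \<le> \<gamma> s" "\<gamma> s \<le> 1" "s \<le> \<delta> \<Longrightarrow> \<gamma> s = 0" "\<delta> < s \<Longrightarrow> 0 < \<gamma> s" for s
      by (auto simp: \<gamma>_def flat_def)
    have \<gamma>s: "smooth \<gamma>"
      unfolding \<gamma>_def by (rule smooth_compose[OF smooth_flat smooth_diff[OF smooth_ident smooth_const]])
    obtain G0 where G0: "smooth G0" "\<And>t. (G0 has_real_derivative \<gamma> t) (at t)"
      by (rule smooth_antiderivative[OF \<gamma>s], (rule that; assumption))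
    define G where "G = (\<lambda>s. G0 s - G0 \<delta>)"
    have Gs: "smooth G"
      unfolding G_def by (rule smooth_diff[OF G0(1) smooth_const])
    have DG: "(G has_real_derivative \<gamma> t) (at t)" for t
      unfolding G_def by (auto intro!: derivative_eq_intros G0(2))
    have derivG: "deriv G = \<gamma>"
      using DG DERIV_imp_deriv by blast
    have Gmvt: "\<exists>z. \<delta> < z \<and> z < s \<and> G s = (s - \<delta>) * \<gamma> z" if "\<delta> < s" for s
      using MVT2[OF that DG] by (simp add: G_def)
    have G_pos: "0 < G s" if "\<delta> < s" for s
      using Gmvt[OF that] \<gamma>(4) that by (metis diff_gt_0_iff_gt mult_pos_pos)
    have G_zero: "G s = 0" if "s \<le> \<delta>" for s
    proof (cases "s = \<delta>")
      case False
      then have "\<exists>z. s < z \<and> z < \<delta> \<and> G \<delta> - G s = (\<delta> - s) * \<gamma> z"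
        using that by (intro MVT2 DG) auto
      then obtain z where "z < \<delta>" "G \<delta> - G s = (\<delta> - s) * \<gamma> z"
        by blast
      then show ?thesis
        using \<gamma>(3)[of z] by (simp add: G_def)
    qed (simp add: G_def)
    have G_le: "\<bar>G s\<bar> \<le> \<bar>s\<bar>" for s
    proof (cases "s \<le> \<delta>")
      case False
      then obtain z where z: "G s = (s - \<delta>) * \<gamma> z"
        using Gmvt[of s] by auto
      have "G s \<le> (s - \<delta>) * 1"
        unfolding z by (intro mult_left_mono \<gamma>) (use False in auto)
      moreover have "0 < G s"
        using G_pos[of s] False by simp
      ultimately show ?thesis
        using \<delta> False by (auto simp: abs_if)
    qed (simp add: G_zero)
    define \<psi> where "\<psi> n x = G (\<phi> n x - h n (ht x))" for n x
    have smooth_arg: "smooth (\<lambda>x. \<phi> n x - h n (ht x))" for n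
      by (rule smooth_diff[OF \<phi>s smooth_compose[OF hs smooth_ht]])
    have \<psi>: "\<psi> n \<in> test_functions (\<Omega> k)" for n
    proof (rule test_functionsI[OF _ test_functionsD(2,3)[OF \<phi>]])
      show "smooth (\<psi> n)"
        unfolding \<psi>_def[abs_def] by (rule smooth_compose[OF Gs smooth_arg])
      show "\<psi> n x = 0" if "x \<notin> support (\<phi> n)" for x
        using test_functionsD(4)[OF \<phi> that] h_low[of n "ht x"] by (simp add: \<psi>_def G_zero)
    qed
    have g\<psi>: "gradient (\<psi> n) x = \<gamma> (\<phi> n x - h n (ht x)) *\<^sub>R (gradient (\<phi> n) x - deriv (h n) (ht x) *\<^sub>R gradient ht x)" for n x
      unfolding \<psi>_def[abs_def]
      by (simp add: gradient_compose[OF Gs smooth_arg] derivG gradient_diff[OF \<phi>s smooth_compose[OF hs smooth_ht]]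
          gradient_compose[OF hs smooth_ht])
    have cg: "continuous_on UNIV (gradient (\<psi> n))" "continuous_on UNIV (\<psi> n)" for n
      by (rule test_function_continuous[OF \<psi>])+
    have [measurable]: "\<psi> n \<in> borel_measurable ?M" "gradient (\<psi> n) \<in> borel_measurable ?M"
        "ht \<in> borel_measurable ?M" for n
      by (intro continuous_imp_borel_lebesgue_on cg ht_continuous)+
    have [measurable]: "\<gamma> \<in> borel_measurable borel" "G \<in> borel_measurable borel"
        "slab_torsion \<in> borel_measurable borel" "slab_torsion' \<in> borel_measurable borel"
      by (intro borel_measurable_continuous_onI smooth_continuous \<gamma>s Gs slab_torsion_continuous)+
    have cgr: "gradient ht = (\<lambda>x. (1 / c) *\<^sub>R e)"
      by (rule ext) (rule gradient_ht)
    have grad_bd: "F (gradient (\<psi> n) x) \<le> F (gradient (\<phi> n) x) + L" for n x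
    proof -
      have "F (gradient (\<phi> n) x - deriv (h n) (ht x) *\<^sub>R gradient ht x) \<le> F (gradient (\<phi> n) x) + \<bar>deriv (h n) (ht x)\<bar>"
        using F_triangle[of "gradient (\<phi> n) x" "- (deriv (h n) (ht x) *\<^sub>R gradient ht x)"]
        by (simp add: F_homogeneous F_gradient_ht)
      also have "\<dots> \<le> F (gradient (\<phi> n) x) + L"
        using f(3) by (simp add: h_def)
      finally have "F (gradient (\<phi> n) x - deriv (h n) (ht x) *\<^sub>R gradient ht x) \<le> F (gradient (\<phi> n) x) + L" .
      then have "\<gamma> (\<phi> n x - h n (ht x)) * F (gradient (\<phi> n) x - deriv (h n) (ht x) *\<^sub>R gradient ht x) \<le> 1 * (F (gradient (\<phi> n) x) + L)"
        by (intro mult_mono \<gamma>) (auto simp: F_nonneg L0)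
      then show ?thesis
        unfolding g\<psi> using \<gamma>(1) by (simp add: F_homogeneous)
    qed
    have glim: "AE x in ?M. (\<lambda>n. gradient (\<psi> n) x) \<longlonglongrightarrow> \<gamma> (v x - slab_torsion (ht x)) *\<^sub>R (g x - slab_torsion' (ht x) *\<^sub>R gradient ht x)"
      using lim sp
    proof eventually_elim
      case (elim x)
      have x: "\<bar>ht x\<bar> < 1"
        using elim(3) by (simp add: mem_\<Omega>)
      have "(\<lambda>n. \<gamma> (\<phi> n x - h n (ht x))) \<longlonglongrightarrow> \<gamma> (v x - slab_torsion (ht x))"
        by (rule continuous_on_tendsto_compose[OF smooth_continuous[OF \<gamma>s, of UNIV]])
           (use elim hlim[of "ht x"] x in \<open>auto intro!: tendsto_intros\<close>)
      then show ?case
        unfolding g\<psi> using elim(2) h'lim[OF x] by (intro tendsto_intros)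
    qed
    have \<psi>lim: "AE x in ?M. (\<lambda>n. \<psi> n x) \<longlonglongrightarrow> G (v x - slab_torsion (ht x))"
      using lim(1) sp
    proof eventually_elim
      case (elim x)
      have x: "\<bar>ht x\<bar> < 1"
        using elim(2) by (simp add: mem_\<Omega>)
      show ?case
        unfolding \<psi>_def
        by (rule continuous_on_tendsto_compose[OF smooth_continuous[OF Gs, of UNIV]])
           (use elim hlim[of "ht x"] x in \<open>auto intro!: tendsto_intros\<close>)
    qed
    define A where "A x = \<gamma> (v x - slab_torsion (ht x)) *\<^sub>R (g x - slab_torsion' (ht x) *\<^sub>R gradient ht x)" for x
    have [measurable]: "A \<in> borel_measurable ?M"
      unfolding A_def[abs_def] cgr by measurable
    have by_parts: "(LINT x|?M. ht x * (gradient (\<psi> n) x \<bullet> w)) = - (LINT x|?M. \<psi> n x)" for n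
    proof -
      have "((\<lambda>t. ht (x + t *\<^sub>R w)) has_real_derivative 1) (at 0)" for x
        unfolding ht_add_w by (auto intro!: derivative_eq_intros)
      from integral_by_parts_test_function[OF \<psi>[of n] \<Omega>_lebesgue this ht_continuous continuous_on_const]
      show ?thesis by simp
    qed
    define R1 where "R1 x = (1 + L) * (1 + E x)" for x
    have R1: "integrable ?M R1"
      unfolding R1_def[abs_def] using E integrable_const_\<Omega>[of k] by simp
    have E_nonneg: "AE x in ?M. 0 \<le> E x"
      using dom by eventually_elim (use order_trans[OF powr_ge_zero] in blast)
    have dF: "AE x in ?M. F (gradient (\<psi> n) x) \<le> R1 x" for n
      using dom E_nonneg
    proof eventually_elim
      case (elim x)
      have "F (gradient (\<psi> n) x) \<le> 1 + E x + L * 1"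
        using grad_bd[of n x] le_one_plus_powr[OF F_nonneg, of "gradient (\<phi> n) x"] elim(1)[rule_format, of n] by simp
      also have "\<dots> \<le> R1 x"
        unfolding R1_def using L0 elim(2) by (simp add: algebra_simps)
      finally show ?case .
    qed
    have d1: "AE x in ?M. norm (ht x * (gradient (\<psi> n) x \<bullet> w)) \<le> R1 x" for n
      using dF[of n] sp
    proof eventually_elim
      case (elim x)
      have "\<bar>ht x * (gradient (\<psi> n) x \<bullet> w)\<bar> \<le> 1 * F (gradient (\<psi> n) x)"
        unfolding abs_mult using elim(2) w_le[of "gradient (\<psi> n) x"]
        by (intro mult_mono) (auto simp: mem_\<Omega> inner_commute F_nonneg)
      then show ?case
        using elim(1) by simp
    qed
    have l1: "AE x in ?M. (\<lambda>n. ht x * (gradient (\<psi> n) x \<bullet> w)) \<longlonglongrightarrow> ht x * (A x \<bullet> w)"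
      using glim by eventually_elim (unfold A_def, intro tendsto_intros)
    have c1: "(\<lambda>n. LINT x|?M. ht x * (gradient (\<psi> n) x \<bullet> w)) \<longlonglongrightarrow> (LINT x|?M. ht x * (A x \<bullet> w))"
      by (rule integral_dominated_convergence[OF _ _ R1 l1 d1]) measurable
    have i1: "integrable ?M (\<lambda>x. ht x * (A x \<bullet> w))"
      by (rule integrable_dominated_convergence[OF _ _ R1 l1 d1]) measurable
    define R2 where "R2 x = F (g x) powr p + 2 powr p * (E x + L powr p)" for x
    have R2: "integrable ?M R2"
      unfolding R2_def[abs_def] using E iF integrable_const_\<Omega>[of k] by simp
    have d2: "AE x in ?M. norm (field (g x) \<bullet> gradient (\<psi> n) x) \<le> R2 x" for n
      using dom
    proof eventually_elim
      case (elim x)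
      have "\<bar>field (g x) \<bullet> gradient (\<psi> n) x\<bar> \<le> F (gradient (\<psi> n) x) * F (g x) powr (p - 1)"
        using field_le[of "g x" "gradient (\<psi> n) x"] by (simp add: mult.commute)
      also have "\<dots> \<le> F (gradient (\<psi> n) x) powr p + F (g x) powr p"
        by (rule young(2)) (auto simp: F_nonneg)
      also have "F (gradient (\<psi> n) x) powr p \<le> (F (gradient (\<phi> n) x) + L) powr p"
        by (rule powr_mono2) (use grad_bd p in \<open>auto simp: F_nonneg\<close>)
      also have "\<dots> \<le> 2 powr p * (F (gradient (\<phi> n) x) powr p + L powr p)"
        by (rule powr_add_le) (use p L0 in \<open>auto simp: F_nonneg\<close>)
      also have "\<dots> \<le> 2 powr p * (E x + L powr p)"
        using elim by (intro mult_left_mono) auto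
      finally show ?case
        by (simp add: R2_def)
    qed
    have l2: "AE x in ?M. (\<lambda>n. field (g x) \<bullet> gradient (\<psi> n) x) \<longlonglongrightarrow> field (g x) \<bullet> A x"
      using glim by eventually_elim (unfold A_def, intro tendsto_intros)
    have c2: "(\<lambda>n. LINT x|?M. field (g x) \<bullet> gradient (\<psi> n) x) \<longlonglongrightarrow> (LINT x|?M. field (g x) \<bullet> A x)"
      by (rule integral_dominated_convergence[OF _ _ R2 l2 d2]) measurable
    have i2: "integrable ?M (\<lambda>x. field (g x) \<bullet> A x)"
      by (rule integrable_dominated_convergence[OF _ _ R2 l2 d2]) measurable
    define R3 where "R3 x = (1 + E x) + (1 / q + \<delta>)" for x
    have R3: "integrable ?M R3"
      unfolding R3_def[abs_def] using E integrable_const_\<Omega>[of k] by simp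
    have d3: "AE x in ?M. norm (\<psi> n x) \<le> R3 x" for n
      using dom sp
    proof eventually_elim
      case (elim x)
      have t: "\<bar>ht x\<bar> \<le> 1"
        using elim(2) by (simp add: mem_\<Omega>)
      have "\<bar>\<psi> n x\<bar> \<le> \<bar>\<phi> n x\<bar> + \<bar>h n (ht x)\<bar>"
        unfolding \<psi>_def using G_le[of "\<phi> n x - h n (ht x)"] by linarith
      also have "\<bar>h n (ht x)\<bar> \<le> 1 / q + \<delta>"
        using h_close[OF t, of n] slab_torsion_bounds(1)[OF t] slab_torsion_bounds(2)[of "ht x"] by linarith
      also have "\<bar>\<phi> n x\<bar> \<le> 1 + E x"
        using le_one_plus_powr[of "\<bar>\<phi> n x\<bar>"] elim(1)[rule_format, of n] by simp
      finally show ?case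
        by (simp add: R3_def)
    qed
    have c3: "(\<lambda>n. LINT x|?M. \<psi> n x) \<longlonglongrightarrow> (LINT x|?M. G (v x - slab_torsion (ht x)))"
      by (rule integral_dominated_convergence[OF _ _ R3 \<psi>lim d3]) measurable
    have i3: "integrable ?M (\<lambda>x. G (v x - slab_torsion (ht x)))"
      by (rule integrable_dominated_convergence[OF _ _ R3 \<psi>lim d3]) measurable
    have "(LINT x|?M. field (g x) \<bullet> A x) = (LINT x|?M. G (v x - slab_torsion (ht x)))"
      using c2 c3 unfolding eq[OF \<psi>] by (rule LIMSEQ_unique)
    moreover have E2: "(LINT x|?M. ht x * (A x \<bullet> w)) = - (LINT x|?M. G (v x - slab_torsion (ht x)))"
      using c1 tendsto_minus[OF c3] unfolding by_parts by (rule LIMSEQ_unique)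
    ultimately have "(LINT x|?M. field (g x) \<bullet> A x + ht x * (A x \<bullet> w)) = 0"
      using i1 i2 by (simp add: Bochner_Integration.integral_add)
    \<comment> \<open>The two integrands add up to \<open>\<gamma>\<close> times the monotonicity
      gap, which is nonnegative and has integral 0.\<close>
    moreover have Aeq: "field (g x) \<bullet> A x + ht x * (A x \<bullet> w)
        = \<gamma> (v x - slab_torsion (ht x)) * ((field (g x) + ht x *\<^sub>R w) \<bullet> (g x - slab_torsion' (ht x) *\<^sub>R gradient ht x))" for x
      by (simp add: A_def inner_add_left inner_commute algebra_simps)
    moreover have "0 \<le> field (g x) \<bullet> A x + ht x * (A x \<bullet> w)" for x
      unfolding Aeq by (intro mult_nonneg_nonneg \<gamma> monotonicity_gap)
    moreover have "integrable ?M (\<lambda>x. field (g x) \<bullet> A x + ht x * (A x \<bullet> w))"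
      by (rule Bochner_Integration.integrable_add[OF i2 i1])
    ultimately have "AE x in ?M. field (g x) \<bullet> A x + ht x * (A x \<bullet> w) = 0"
      using integral_nonneg_eq_0_iff_AE[of ?M "\<lambda>x. field (g x) \<bullet> A x + ht x * (A x \<bullet> w)"] by simp
    \<comment> \<open>The component along \<open>w\<close> suffices:
      \<open>ht x * (A x \<bullet> w)\<close> integrates to minus the integral of
      \<open>G (v x - slab_torsion (ht x))\<close>, which must then be 0.\<close>
    then have "AE x in ?M. A x \<bullet> w = 0"
    proof eventually_elim
      case (elim x)
      show ?case
      proof (cases "\<gamma> (v x - slab_torsion (ht x)) = 0")
        case False
        then have "g x \<bullet> w = slab_torsion' (ht x)"
          using elim unfolding Aeq by (intro monotonicity_gap(2)) simp
        moreover have "gradient ht x \<bullet> w = 1"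
          using w_gradient_ht[of x] by (simp add: inner_commute)
        ultimately show ?thesis
          by (simp add: A_def inner_diff_left)
      qed (simp add: A_def)
    qed
    then have "(LINT x|?M. ht x * (A x \<bullet> w)) = 0"
      by (intro integral_eq_zero_AE) (auto elim: eventually_mono)
    with E2 have "(LINT x|?M. G (v x - slab_torsion (ht x))) = 0"
      by simp
    moreover have "0 \<le> G s" for s
      using G_pos[of s] G_zero[of s] by (cases "s \<le> \<delta>") auto
    ultimately have "AE x in ?M. G (v x - slab_torsion (ht x)) = 0"
      using i3 by (subst (asm) integral_nonneg_eq_0_iff_AE) auto
    then show ?thesis
    proof eventually_elim
      case (elim x)
      then have "v x - slab_torsion (ht x) \<le> \<delta>"
        using G_pos[of "v x - slab_torsion (ht x)"] by (cases "v x - slab_torsion (ht x) \<le> \<delta>") auto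
      then show ?case
        using slab_torsion_bounds(2)[of "ht x"] by linarith
    qed
  qed
  have "AE x in ?M. \<forall>n. v x \<le> 1 / q + 1 / real (Suc n)"
    unfolding AE_all_countable by (intro allI main) simp
  then show ?thesis
  proof eventually_elim
    case (elim x)
    have "(\<lambda>n. 1 / q + 1 / real (Suc n)) \<longlonglongrightarrow> 1 / q"
      by real_asymp
    then show ?case
      by (rule LIMSEQ_le_const) (use elim in auto)
  qed
qed


text \<open>The equation is tested with \<open>eta k * (v - f \<circ> ht)\<close>, and Young's inequality bounds the divergence
  identity for the field \<open>eta k * m \<circ> ht\<close> in direction \<open>w\<close>. With \<open>m t = - t + \<theta> \<Psi> t\<close> the factor \<open>m' + 1\<close> is \<open>\<theta> \<Psi>'\<close>.\<close>

lemma torsion_lower_bound: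
  assumes f: "smooth f" "r < 1" "\<And>t. r \<le> \<bar>t\<bar> \<Longrightarrow> f t = 0"
    and m: "\<And>t. (m has_real_derivative m' t) (at t)" "continuous_on UNIV m'" "\<And>t. 0 \<le> m' t + 1"
  shows "\<exists>K. \<forall>k v g B. 0 < k \<longrightarrow> weak_solution k v g \<longrightarrow> (AE x in lebesgue_on (\<Omega> k). v x \<le> B) \<longrightarrow>
    integral {-1..1} (\<lambda>t. f t - \<bar>deriv f t\<bar> powr p / p - \<bar>m t\<bar> powr q / q - B * (m' t + 1)) \<le> K / k"
proof -
  obtain C1 where C1: "0 \<le> C1" "\<And>k x. 0 < k \<Longrightarrow> F (gradient (eta k) x) \<le> C1 / k"
    using eta_gradient_bound by blast
  have fcont: "continuous_on S f" "continuous_on S (deriv f)" for S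
    using smooth_continuous f(1) smooth_realD(2) by blast+
  have mcont: "continuous_on S m" for S
    by (rule DERIV_continuous_on[OF DERIV_subset[OF m(1) subset_UNIV]])
  have m'cont: "continuous_on S m'" for S
    using m(2) continuous_on_subset by blast
  have "bounded (f ` {-1..1})" "bounded (m ` {-1..1})"
    by (intro compact_imp_bounded compact_continuous_image fcont mcont compact_Icc)+
  then obtain B1 B2 where "\<forall>t\<in>{-1..1}. \<bar>f t\<bar> \<le> B1" "\<forall>t\<in>{-1..1}. \<bar>m t\<bar> \<le> B2"
    unfolding bounded_iff by auto
  then have B: "\<bar>f t\<bar> \<le> B1" "\<bar>m t\<bar> \<le> B2" if "\<bar>t\<bar> \<le> 1" for t
    using that by (auto simp: abs_le_iff)
  have B_nonneg: "0 \<le> B1" "0 \<le> B2"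
    using B[of 0] by auto
  define X where "X = integral {-1..1} cutoff"
  have X: "0 < X"
    using cutoff_integral_pos[of 1] cutoff(2) by (simp add: X_def)
  \<comment> \<open>Coefficients of the terms that contain the gradient of \<open>eta k\<close>:
    \<open>1 / q\<close> bounds v by comparison with the slab, \<open>B1\<close> bounds f,
    \<open>B2\<close> bounds m, and \<open>C1 / k\<close> bounds the gradient.\<close>
  define K1 where "K1 = (1 / q + B1) * C1"
  define K2 where "K2 = (1 / q) * (B2 * C1)"
  \<comment> \<open>The ratio of the volume to the factor \<open>Y\<close> common to the slab
    integrals. In the final constant \<open>(2 * K1 + K2) * \<kappa>\<close> the 2 comes from
    integrating 1 + F(g)^p, which is at most twice the volume by the energy bound.\<close>
  define \<kappa> where "\<kappa> = 2 * (2 / X) ^ (DIM('a) - 1)"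
  have K1: "0 \<le> K1" and K2: "0 \<le> K2"
    using pq(1) B_nonneg C1(1) by (auto simp: K1_def K2_def)
  show ?thesis
  proof (intro exI[of _ "(2 * K1 + K2) * \<kappa>"] allI impI)
    fix k :: real and v g and B0 :: real
    assume k: "0 < k" and v: "weak_solution k v g" and vB: "AE x in lebesgue_on (\<Omega> k). v x \<le> B0"
    let ?M = "lebesgue_on (\<Omega> k)"
    have S: "sobolev0 p (\<Omega> k) v g" and vpos: "AE x in ?M. 0 < v x"
      using v by (auto simp: weak_solution_def)
    note vq = weak_solution_le[OF v]
    note energy = weak_solution_energy[OF v]
    note [measurable] = sobolev0_integrable(1,2)[OF S]
    note iF = sobolev0_integrable(4)[OF S]
    have sp: "AE x in ?M. x \<in> \<Omega> k"
      by (rule AE_I2) simp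
    define H where "H t = f t - \<bar>deriv f t\<bar> powr p / p - \<bar>m t\<bar> powr q / q - B0 * (m' t + 1)" for t
    have Hcont: "continuous_on UNIV H"
      unfolding H_def[abs_def] using p pq(1)
      by (intro continuous_on_diff continuous_on_mult continuous_on_add continuous_on_const continuous_on_divide
          continuous_on_abs_powr fcont mcont m'cont) auto
    define \<Theta> where "\<Theta> x = eta k x * m (ht x)" for x
    define D where "D x = (gradient (eta k) x \<bullet> w) * m (ht x) + eta k x * m' (ht x)" for x
    have ceta: "continuous_on UNIV (eta k)" "continuous_on UNIV (gradient (eta k))"
      unfolding gradient_def[abs_def]
      by (intro continuous_intros smooth_continuous smooth_directional_derivative(1) smooth_eta)+
    have cm: "continuous_on UNIV (\<lambda>x. m (ht x))" "continuous_on UNIV (\<lambda>x. m' (ht x))" "continuous_on UNIV (\<lambda>x. H (ht x))"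
      by (intro continuous_on_compose2[OF mcont[of UNIV] ht_continuous] continuous_on_compose2[OF m'cont[of UNIV] ht_continuous]
          continuous_on_compose2[OF Hcont ht_continuous] subset_UNIV)+
    have c\<Theta>: "continuous_on UNIV \<Theta>" "continuous_on UNIV D"
      unfolding \<Theta>_def[abs_def] D_def[abs_def]
      by (intro continuous_on_mult continuous_on_add continuous_on_inner continuous_on_const ceta cm)+
    have D\<Theta>: "((\<lambda>t. \<Theta> (x + t *\<^sub>R w)) has_real_derivative D x) (at 0)" for x
    proof -
      have 1: "((\<lambda>t. eta k (x + t *\<^sub>R w)) has_real_derivative gradient (eta k) x \<bullet> w) (at 0)"
        using smooth_directional_derivative(2,3)[OF smooth_eta, of k x w] by simp
      have 2: "((\<lambda>t. m (ht x + t)) has_real_derivative m' (ht x) * 1) (at 0)"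
        by (rule DERIV_chain2) (use m(1)[of "ht x"] in \<open>auto intro!: derivative_eq_intros\<close>)
      show ?thesis
        using DERIV_mult[OF 1 2] by (simp add: \<Theta>_def D_def ht_add_w mult_ac)
    qed
    define Xt where "Xt x = f (ht x) * eta k x" for x
    have Xt: "Xt \<in> test_functions (\<Omega> k)"
      unfolding Xt_def[abs_def] by (rule eta_test_function[OF f k])
    have gXt: "gradient Xt x = f (ht x) *\<^sub>R gradient (eta k) x + (eta k x * deriv f (ht x)) *\<^sub>R gradient ht x" for x
      unfolding Xt_def[abs_def]
      by (simp add: gradient_mult[OF smooth_compose[OF f(1) smooth_ht] smooth_eta] gradient_compose[OF f(1) smooth_ht])
    define Q1 where "Q1 x = field (g x) \<bullet> (eta k x *\<^sub>R g x + v x *\<^sub>R gradient (eta k) x - gradient Xt x)" for x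
    define Q2 where "Q2 x = eta k x * v x - Xt x" for x
    have Q: "(LINT x|?M. Q1 x) = (LINT x|?M. Q2 x)" "integrable ?M Q1" "integrable ?M Q2"
      unfolding Q1_def[abs_def] Q2_def[abs_def] using weak_solution_test[OF v smooth_eta Xt] by auto
    define P1 where "P1 x = \<Theta> x * (g x \<bullet> w)" for x
    define P2 where "P2 x = v x * D x" for x
    have P: "(LINT x|?M. P1 x) = - (LINT x|?M. P2 x)"
      unfolding P1_def P2_def by (rule sobolev0_by_parts[OF S D\<Theta> c\<Theta>])
    have [measurable]: "\<Theta> \<in> borel_measurable ?M" "D \<in> borel_measurable ?M" "eta k \<in> borel_measurable ?M"
        "(\<lambda>x. H (ht x)) \<in> borel_measurable ?M"
      by (intro continuous_imp_borel_lebesgue_on c\<Theta> ceta cm)+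
    obtain BT where BT: "0 \<le> BT" "\<And>x. x \<in> \<Omega> k \<Longrightarrow> norm (\<Theta> x) \<le> BT"
      by (rule bounded_on_\<Omega>[OF c\<Theta>(1), of k], (rule that; assumption))
    obtain BD where BD: "0 \<le> BD" "\<And>x. x \<in> \<Omega> k \<Longrightarrow> norm (D x) \<le> BD"
      by (rule bounded_on_\<Omega>[OF c\<Theta>(2), of k], (rule that; assumption))
    have iP1: "integrable ?M P1"
    proof (rule Bochner_Integration.integrable_bound)
      show "integrable ?M (\<lambda>x. BT * (1 + F (g x) powr p))"
        using iF integrable_const_\<Omega>[of k] by simp
      show "AE x in ?M. norm (P1 x) \<le> norm (BT * (1 + F (g x) powr p))"
        using sp
      proof eventually_elim
        case (elim x)
        have "\<bar>\<Theta> x * (g x \<bullet> w)\<bar> \<le> BT * (1 + F (g x) powr p)"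
          unfolding abs_mult using BT(2)[OF elim] BT(1) w_le[of "g x"] le_one_plus_powr[OF F_nonneg, of "g x"]
          by (intro mult_mono) (auto simp: inner_commute)
        then show ?case
          using BT(1) by (simp add: P1_def)
      qed
      show "P1 \<in> borel_measurable ?M"
        unfolding P1_def[abs_def] by measurable
    qed
    have iP2: "integrable ?M P2"
    proof (rule Bochner_Integration.integrable_bound)
      show "integrable ?M (\<lambda>x. 1 / q * BD)"
        by (rule integrable_const_\<Omega>)
      show "AE x in ?M. norm (P2 x) \<le> norm (1 / q * BD)"
        using vq vpos sp
      proof eventually_elim
        case (elim x)
        have "\<bar>v x * D x\<bar> \<le> 1 / q * BD"
          unfolding abs_mult using BD(2)[OF elim(3)] elim(1,2) pq(1) by (intro mult_mono) auto
        then show ?case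
          using pq(1) BD(1) by (simp add: P2_def)
      qed
      show "P2 \<in> borel_measurable ?M"
        unfolding P2_def[abs_def] by measurable
    qed
    define R where "R x = H (ht x) * eta k x - (K1 / k * (1 + F (g x) powr p) + K2 / k)" for x
    have iH: "integrable ?M (\<lambda>x. H (ht x) * eta k x)"
    proof -
      obtain BH where BH: "0 \<le> BH" "\<And>x. x \<in> \<Omega> k \<Longrightarrow> norm (H (ht x)) \<le> BH"
        by (rule bounded_on_\<Omega>[OF cm(3), of k], (rule that; assumption))
      have "\<bar>H (ht x) * eta k x\<bar> \<le> BH * 1" if "x \<in> \<Omega> k" for x
        unfolding abs_mult using BH(1) BH(2)[OF that] eta_bounds by (intro mult_mono) auto
      then show ?thesis
        by (intro integrable_\<Omega>) auto
    qed
    have iK: "integrable ?M (\<lambda>x. K1 / k * (1 + F (g x) powr p) + K2 / k)"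
      using iF integrable_const_\<Omega>[of k] by simp
    have iR: "integrable ?M R"
      unfolding R_def[abs_def] by (rule Bochner_Integration.integrable_diff[OF iH iK])
    \<comment> \<open>The right-hand side has integral 0 by the two identities. The energy
      \<open>eta k x * F (g x) powr p\<close> inside \<open>Q1\<close> is spent on two Young
      inequalities: the share 1/q against the slope of f, the share 1/p against m.\<close>
    have pointwise: "AE x in ?M. R x \<le> Q1 x - Q2 x - (P1 x + P2 x)"
      using vq vpos vB sp
    proof eventually_elim
      case (elim x)
      define \<eta> where "\<eta> = eta k x"
      define t where "t = ht x"
      define s where "s = F (g x)"
      have \<eta>: "0 \<le> \<eta>" "\<eta> \<le> 1"
        using eta_bounds by (auto simp: \<eta>_def)
      have s: "0 \<le> s"
        by (simp add: s_def F_nonneg)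
      have t: "\<bar>t\<bar> \<le> 1"
        using elim(4) by (simp add: t_def mem_\<Omega>)
      have Q1: "Q1 x = \<eta> * s powr p + (v x - f t) * (field (g x) \<bullet> gradient (eta k) x) - \<eta> * (deriv f t * (field (g x) \<bullet> gradient ht x))"
        unfolding Q1_def gXt by (simp add: \<eta>_def t_def s_def inner_diff_right inner_add_right field_self algebra_simps)
      have a: "- (K1 / k * (1 + s powr p)) \<le> (v x - f t) * (field (g x) \<bullet> gradient (eta k) x)"
      proof -
        have "\<bar>(v x - f t) * (field (g x) \<bullet> gradient (eta k) x)\<bar> \<le> (1 / q + B1) * ((1 + s powr p) * (C1 / k))"
          unfolding abs_mult
        proof (intro mult_mono)
          show "\<bar>v x - f t\<bar> \<le> 1 / q + B1"
            using elim(1,2) B(1)[OF t] by linarith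
          have "\<bar>field (g x) \<bullet> gradient (eta k) x\<bar> \<le> s powr (p - 1) * F (gradient (eta k) x)"
            unfolding s_def by (rule field_le)
          also have "\<dots> \<le> (1 + s powr p) * (C1 / k)"
            by (intro mult_mono powr_pred_le s C1(2) k) (auto simp: F_nonneg)
          finally show "\<bar>field (g x) \<bullet> gradient (eta k) x\<bar> \<le> (1 + s powr p) * (C1 / k)" .
        qed (use pq(1) B_nonneg in auto)
        also have "\<dots> = K1 / k * (1 + s powr p)"
          by (simp add: K1_def)
        finally show ?thesis
          by linarith
      qed
      have b: "deriv f t * (field (g x) \<bullet> gradient ht x) \<le> \<bar>deriv f t\<bar> powr p / p + s powr p / q"
      proof -
        have "deriv f t * (field (g x) \<bullet> gradient ht x) \<le> \<bar>deriv f t\<bar> * \<bar>field (g x) \<bullet> gradient ht x\<bar>"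
          unfolding abs_mult[symmetric] by (rule abs_ge_self)
        also have "\<dots> \<le> \<bar>deriv f t\<bar> * s powr (p - 1)"
          using field_le[of "g x" "gradient ht x"] by (intro mult_left_mono) (auto simp: F_gradient_ht s_def)
        also have "\<dots> \<le> \<bar>deriv f t\<bar> powr p / p + s powr p / q"
          by (rule young(1)) (use s in auto)
        finally show ?thesis .
      qed
      have c: "m t * (g x \<bullet> w) \<le> s powr p / p + \<bar>m t\<bar> powr q / q"
      proof -
        have "m t * (g x \<bullet> w) \<le> \<bar>m t\<bar> * \<bar>w \<bullet> g x\<bar>"
          unfolding abs_mult[symmetric] inner_commute[of w] by (rule abs_ge_self)
        also have "\<dots> \<le> \<bar>m t\<bar> * s"
          unfolding s_def by (intro mult_left_mono w_le) simp
        also have "\<dots> = s * \<bar>m t\<bar>"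
          by (rule mult.commute)
        also have "\<dots> \<le> s powr p / p + \<bar>m t\<bar> powr q / q"
          by (rule Youngs_inequality) (use p pq s in auto)
        finally show ?thesis .
      qed
      have d: "v x * ((gradient (eta k) x \<bullet> w) * m t) \<le> K2 / k"
      proof -
        have "v x * ((gradient (eta k) x \<bullet> w) * m t) \<le> \<bar>v x\<bar> * (\<bar>w \<bullet> gradient (eta k) x\<bar> * \<bar>m t\<bar>)"
          unfolding abs_mult[symmetric] inner_commute[of w] by (rule abs_ge_self)
        also have "\<dots> \<le> (1 / q) * ((C1 / k) * B2)"
        proof (intro mult_mono)
          show "\<bar>w \<bullet> gradient (eta k) x\<bar> \<le> C1 / k"
            using w_le C1(2)[OF k] by (rule order_trans)
        qed (use elim(1,2) B(2)[OF t] pq(1) C1(1) k in auto)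
        finally show ?thesis
          by (simp add: K2_def mult.commute)
      qed
      \<comment> \<open>Here alone the upper bound \<open>B0\<close> and the sign of
        \<open>m' + 1\<close> enter: the unknown values of v are traded for a constant.\<close>
      have e': "\<eta> * v x * (m' t + 1) \<le> \<eta> * B0 * (m' t + 1)"
        using \<eta> elim(3) m(3) by (intro mult_right_mono mult_left_mono) auto
      have "\<eta> * (deriv f t * (field (g x) \<bullet> gradient ht x)) \<le> \<eta> * (\<bar>deriv f t\<bar> powr p / p + s powr p / q)"
        "\<eta> * (m t * (g x \<bullet> w)) \<le> \<eta> * (s powr p / p + \<bar>m t\<bar> powr q / q)"
        by (intro mult_left_mono b c \<eta>)+
      moreover have "\<eta> * (s powr p / q) + \<eta> * (s powr p / p) = \<eta> * s powr p"
      proof -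
        have "\<eta> * (s powr p / q) + \<eta> * (s powr p / p) = \<eta> * s powr p * (1 / p + 1 / q)"
          by (simp add: algebra_simps)
        then show ?thesis
          using pq(6) by simp
      qed
      moreover have "P1 x = \<eta> * (m t * (g x \<bullet> w))"
        by (simp add: P1_def \<Theta>_def \<eta>_def t_def)
      moreover have "P2 x = v x * ((gradient (eta k) x \<bullet> w) * m t) + \<eta> * v x * m' t"
        by (simp add: P2_def D_def \<eta>_def t_def algebra_simps)
      moreover have "Q2 x = \<eta> * v x - \<eta> * f t"
        by (simp add: Q2_def Xt_def \<eta>_def t_def)
      moreover have "R x = \<eta> * f t - \<eta> * (\<bar>deriv f t\<bar> powr p / p) - \<eta> * (\<bar>m t\<bar> powr q / q) - \<eta> * B0 * (m' t + 1)
          - K1 / k * (1 + s powr p) - K2 / k"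
        by (simp add: R_def H_def \<eta>_def t_def s_def algebra_simps)
      ultimately show ?case
        using Q1 a d e' by (simp add: distrib_left)
    qed
    have "(LINT x|?M. R x) \<le> (LINT x|?M. Q1 x - Q2 x - (P1 x + P2 x))"
      by (intro integral_mono_AE iR pointwise Bochner_Integration.integrable_diff Bochner_Integration.integrable_add Q iP1 iP2)
    also have "\<dots> = 0"
      using Q P iP1 iP2 by (simp add: Bochner_Integration.integral_diff Bochner_Integration.integral_add)
    finally have R_le: "(LINT x|?M. R x) \<le> 0" .
    define Y where "Y = c * (k * X) ^ (DIM('a) - 1)"
    have Y: "0 < Y"
      using c_pos k X by (simp add: Y_def)
    have vol: "vol k = Y * \<kappa>"
      using X k by (simp add: vol_eq Y_def \<kappa>_def power_mult_distrib power_divide)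
    have "(LINT x|?M. H (ht x) * eta k x) = Y * integral {-1..1} H"
      using integral_slab_product[OF Hcont cutoff_continuous k] by (simp add: eta_def Y_def X_def mult_ac)
    moreover have "(LINT x|?M. R x) = (LINT x|?M. H (ht x) * eta k x) - (LINT x|?M. K1 / k * (1 + F (g x) powr p) + K2 / k)"
      unfolding R_def by (rule Bochner_Integration.integral_diff[OF iH iK])
    moreover have "(LINT x|?M. K1 / k * (1 + F (g x) powr p) + K2 / k) \<le> (2 * K1 + K2) / k * vol k"
    proof -
      have "(LINT x|?M. K1 / k * (1 + F (g x) powr p) + K2 / k)
          = K1 / k * (vol k + (LINT x|?M. F (g x) powr p)) + K2 / k * vol k"
        using iF integrable_const_\<Omega>[of k] integral_const_\<Omega>[of k 1] integral_const_\<Omega>[of k "K2 / k"]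
        by (simp add: Bochner_Integration.integral_add)
      also have "\<dots> \<le> K1 / k * (vol k + vol k) + K2 / k * vol k"
        using energy K1 k by (intro add_right_mono mult_left_mono) auto
      also have "\<dots> = (2 * K1 + K2) / k * vol k"
        by (simp add: algebra_simps add_divide_distrib)
      finally show ?thesis .
    qed
    ultimately have "Y * integral {-1..1} H \<le> (2 * K1 + K2) / k * vol k"
      using R_le by linarith
    also have "\<dots> = Y * ((2 * K1 + K2) * \<kappa> / k)"
      by (simp add: vol)
    finally have "integral {-1..1} H \<le> (2 * K1 + K2) * \<kappa> / k"
      using mult_le_cancel_left_pos[OF Y] by blast
    then show "integral {-1..1} (\<lambda>t. f t - \<bar>deriv f t\<bar> powr p / p - \<bar>m t\<bar> powr q / q - B0 * (m' t + 1)) \<le> (2 * K1 + K2) * \<kappa> / k"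
      by (simp add: H_def[abs_def])
  qed
qed

section \<open>Limit of the maximum\<close>

text \<open>Comparison with the slab, and positivity on a set of positive measure, confine the
  essential supremum to [0, 1/q]. It is therefore finite and the conversion in
  \<open>maximum_on\<close> is faithful.\<close>

lemma maximum_bounds:
  assumes k: "0 < k" and v: "weak_solution k v g"
  shows "0 \<le> maximum_on (\<Omega> k) v" "maximum_on (\<Omega> k) v \<le> 1 / q"
    "AE x in lebesgue_on (\<Omega> k). v x \<le> maximum_on (\<Omega> k) v"
proof -
  let ?M = "lebesgue_on (\<Omega> k)"
  define z where "z = esssup ?M (\<lambda>x. ereal (v x))"
  have S: "sobolev0 p (\<Omega> k) v g" and vpos: "AE x in ?M. 0 < v x"
    using v by (auto simp: weak_solution_def)
  note [measurable] = sobolev0_integrable(1)[OF S]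
  have up: "z \<le> ereal (1 / q)"
    unfolding z_def by (rule esssup_I) (use weak_solution_le[OF v] in auto)
  have ae: "AE x in ?M. ereal (v x) \<le> z"
    unfolding z_def by (rule esssup_AE)
  have low: "0 \<le> z"
  proof (rule ccontr)
    assume "\<not> 0 \<le> z"
    have "AE x in ?M. False"
      using ae vpos
    proof eventually_elim
      case (elim x)
      then have "ereal 0 < z"
        using less_le_trans[of "ereal 0" "ereal (v x)" z] by simp
      then show ?case
        using \<open>\<not> 0 \<le> z\<close> by (simp add: zero_ereal_def)
    qed
    then have "(LINT x|?M. 1::real) = 0"
      by (intro integral_eq_zero_AE) (auto elim: eventually_mono)
    then show False
      using integral_const_\<Omega>[of k 1] vol_pos[OF k] by simp
  qed
  have zm: "z = ereal (maximum_on (\<Omega> k) v)"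
    using up low unfolding maximum_on_def z_def[symmetric] by (cases z) auto
  show "0 \<le> maximum_on (\<Omega> k) v" "maximum_on (\<Omega> k) v \<le> 1 / q"
    using up low by (simp_all add: zm)
  show "AE x in ?M. v x \<le> maximum_on (\<Omega> k) v"
    using ae by (simp add: zm)
qed

text \<open>The two integrands differ by the derivative of (t - t |t|^q) / q, which vanishes at both
  ends. In the setting of \<open>torsion_lower_bound\<close> this says that the one-dimensional
  extremals f = \<open>slab_torsion\<close> and m t = - t balance to 0, so that a perturbation of m
  is visible at first order.\<close>

lemma slab_torsion_energy:
  "integral {-1..1} (\<lambda>t. slab_torsion t - \<bar>slab_torsion' t\<bar> powr p / p) = integral {-1..1} (\<lambda>t. \<bar>t\<bar> powr q / q)"
proof -
  have "((\<lambda>t. 1 / q * (1 - (1 + q) * \<bar>t\<bar> powr q)) has_integral (1 / q * (1 - 1 * \<bar>1\<bar> powr q) - 1 / q * ((-1) - (-1) * \<bar>-1\<bar> powr q))) {-1..1::real}"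
  proof (rule fundamental_theorem_of_calculus)
    fix t :: real
    have "((\<lambda>t. 1 / q * (t - t * \<bar>t\<bar> powr q)) has_real_derivative
        1 / q * (1 - (1 * \<bar>t\<bar> powr q + q * (sgn t * \<bar>t\<bar> powr (q - 1)) * t))) (at t)"
      by (intro DERIV_cmult DERIV_diff DERIV_ident DERIV_mult has_real_derivative_abs_powr pq(1))
    moreover have "1 * \<bar>t\<bar> powr q + q * (sgn t * \<bar>t\<bar> powr (q - 1)) * t = (1 + q) * \<bar>t\<bar> powr q"
      using powr_product_sgn[of t q] by (simp add: algebra_simps)
    ultimately have "((\<lambda>t. 1 / q * (t - t * \<bar>t\<bar> powr q)) has_real_derivative 1 / q * (1 - (1 + q) * \<bar>t\<bar> powr q)) (at t)"
      by simp
    then show "((\<lambda>t. 1 / q * (t - t * \<bar>t\<bar> powr q)) has_vector_derivative 1 / q * (1 - (1 + q) * \<bar>t\<bar> powr q)) (at t within {-1..1})"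
      by (simp add: has_real_derivative_iff_has_vector_derivative has_vector_derivative_at_within)
  qed simp
  then have 1: "((\<lambda>t. 1 / q * (1 - (1 + q) * \<bar>t\<bar> powr q)) has_integral 0) {-1..1::real}"
    by simp
  have 2: "((\<lambda>t. \<bar>t\<bar> powr q / q) has_integral integral {-1..1} (\<lambda>t. \<bar>t\<bar> powr q / q)) {-1..1::real}"
    by (rule integrable_integral) (use pq(1) in \<open>auto intro!: integrable_continuous_real continuous_intros\<close>)
  have "slab_torsion t - \<bar>slab_torsion' t\<bar> powr p / p = 1 / q * (1 - (1 + q) * \<bar>t\<bar> powr q) + \<bar>t\<bar> powr q / q" for t
  proof -
    have "\<bar>slab_torsion' t\<bar> powr p = \<bar>t\<bar> powr q"
    proof (cases "t = 0")
      case False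
      then have "\<bar>slab_torsion' t\<bar> = \<bar>t\<bar> powr (q - 1)"
        by (simp add: slab_torsion'_def abs_mult abs_sgn_eq)
      then show ?thesis
        using pq(3) by (simp add: powr_powr)
    qed (use pq p in \<open>simp add: slab_torsion'_def\<close>)
    moreover have "1 / p = 1 - 1 / q"
      using pq(6) by simp
    then have "\<bar>t\<bar> powr q / p = \<bar>t\<bar> powr q * (1 - 1 / q)"
      by (metis mult.right_neutral times_divide_eq_right)
    ultimately show ?thesis
      using pq(1) by (simp add: slab_torsion_def field_simps)
  qed
  then show ?thesis
    using has_integral_add[OF 1 2] by (simp add: integral_unique)
qed

lemma integral_abs_powr_pred: "integral {-1..1} (\<lambda>t. \<bar>t\<bar> powr (q - 1)) = 2 / q"
proof -
  have "((\<lambda>t. \<bar>t\<bar> powr (q - 1)) has_integral (sgn 1 * \<bar>1\<bar> powr q / q - sgn (-1) * \<bar>-1\<bar> powr q / q)) {-1..1::real}"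
  proof (rule fundamental_theorem_of_calculus_interior_strong[of "{0}"])
    show "continuous_on {-1..1::real} (\<lambda>t. sgn t * \<bar>t\<bar> powr q / q)"
      using pq(1) by (intro continuous_on_divide continuous_on_const continuous_on_sgn_abs_powr) auto
    fix t :: real
    assume "t \<in> {-1<..<1} - {0}"
    then have t: "t \<noteq> 0" by simp
    have ev: "\<forall>\<^sub>F x in nhds t. sgn t * \<bar>x\<bar> powr q / q = sgn x * \<bar>x\<bar> powr q / q"
    proof (cases "0 < t")
      case True
      then show ?thesis
        by (intro eventually_mono[OF eventually_nhds_in_open[of "{0<..}" t]]) auto
    next
      case False
      then show ?thesis
        using t by (intro eventually_mono[OF eventually_nhds_in_open[of "{..<0}" t]]) auto
    qed
    have "((\<lambda>x. sgn t * \<bar>x\<bar> powr q / q) has_real_derivative sgn t * (q * (sgn t * \<bar>t\<bar> powr (q - 1))) / q) (at t)"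
      by (intro DERIV_cdivide DERIV_cmult has_real_derivative_abs_powr pq(1))
    moreover have "sgn t * (q * (sgn t * \<bar>t\<bar> powr (q - 1))) / q = \<bar>t\<bar> powr (q - 1)"
      using t pq(1) by (simp add: sgn_if)
    ultimately have "((\<lambda>x. sgn x * \<bar>x\<bar> powr q / q) has_real_derivative \<bar>t\<bar> powr (q - 1)) (at t)"
      using DERIV_cong_ev[OF refl ev refl] by simp
    then show "((\<lambda>x. sgn x * \<bar>x\<bar> powr q / q) has_vector_derivative \<bar>t\<bar> powr (q - 1)) (at t)"
      by (simp add: has_real_derivative_iff_has_vector_derivative)
  qed auto
  then show ?thesis
    by (simp add: integral_unique)
qed

text \<open>No order between a and b is presupposed, and the intermediate point is located relative
  to a, so that it tends to a as b does.\<close>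

lemma abs_powr_mean_value:
  "\<exists>z. \<bar>z - a\<bar> \<le> \<bar>a - b\<bar> \<and> \<bar>a\<bar> powr q / q - \<bar>b\<bar> powr q / q = (a - b) * (sgn z * \<bar>z\<bar> powr (q - 1))"
proof -
  have D: "((\<lambda>t. \<bar>t\<bar> powr q / q) has_real_derivative sgn t * \<bar>t\<bar> powr (q - 1)) (at t)" for t
  proof -
    have "((\<lambda>t. \<bar>t\<bar> powr q / q) has_real_derivative q * (sgn t * \<bar>t\<bar> powr (q - 1)) / q) (at t)"
      by (intro DERIV_cdivide has_real_derivative_abs_powr pq(1))
    then show ?thesis
      using pq(1) by simp
  qed
  consider "a < b" | "a = b" | "b < a"
    by linarith
  then show ?thesis
  proof cases
    case 1
    from MVT2[OF this D] obtain z where "a < z" "z < b" "\<bar>b\<bar> powr q / q - \<bar>a\<bar> powr q / q = (b - a) * (sgn z * \<bar>z\<bar> powr (q - 1))"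
      by blast
    then show ?thesis
      by (intro exI[of _ z]) (simp add: algebra_simps)
  next
    case 3
    from MVT2[OF this D] obtain z where "b < z" "z < a" "\<bar>a\<bar> powr q / q - \<bar>b\<bar> powr q / q = (a - b) * (sgn z * \<bar>z\<bar> powr (q - 1))"
      by blast
    then show ?thesis
      by (intro exI[of _ z]) simp
  qed auto
qed

text \<open>The derivative of \<open>\<theta> \<mapsto> - \<integral> \<bar>t - \<theta> sgn t\<bar>\<^sup>q / q\<close> at \<open>0\<close>, with \<open>sgn\<close> smoothed to \<open>tanh (t / \<theta>)\<close>.\<close>

lemma smoothed_variation_limit:
  "(\<lambda>n. real (Suc n) * integral {-1..1} (\<lambda>t. \<bar>t\<bar> powr q / q - \<bar>- t + 1 / real (Suc n) * tanh (real (Suc n) * t)\<bar> powr q / q))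
    \<longlonglongrightarrow> 2 / q"
proof -
  define \<theta> where "\<theta> n = 1 / real (Suc n)" for n
  have \<theta>: "0 < \<theta> n" "\<theta> n \<le> 1" "real (Suc n) * \<theta> n = 1" for n
    by (auto simp: \<theta>_def)
  define \<Psi> where "\<Psi> n t = tanh (real (Suc n) * t)" for n t
  have \<Psi>: "\<bar>\<Psi> n t\<bar> \<le> 1" for n t
    using tanh_real_lt_1[of "real (Suc n) * t"] tanh_real_gt_neg1[of "real (Suc n) * t"]
    by (auto simp: \<Psi>_def abs_le_iff)
  define J where "J n t = real (Suc n) * (\<bar>t\<bar> powr q / q - \<bar>- t + \<theta> n * \<Psi> n t\<bar> powr q / q)" for n t
  have ex: "\<exists>z. \<bar>z - t\<bar> \<le> \<theta> n \<and> J n t = \<Psi> n t * (sgn z * \<bar>z\<bar> powr (q - 1))" for n t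
    proof -
      obtain z where z: "\<bar>z - t\<bar> \<le> \<bar>t - (t - \<theta> n * \<Psi> n t)\<bar>"
        "\<bar>t\<bar> powr q / q - \<bar>t - \<theta> n * \<Psi> n t\<bar> powr q / q = (t - (t - \<theta> n * \<Psi> n t)) * (sgn z * \<bar>z\<bar> powr (q - 1))"
        using abs_powr_mean_value[of t "t - \<theta> n * \<Psi> n t"] by blast
      have "\<bar>z - t\<bar> \<le> \<theta> n"
      proof -
        have "\<bar>\<theta> n * \<Psi> n t\<bar> \<le> \<theta> n * 1"
          unfolding abs_mult using \<theta>(1)[of n] \<Psi>[of n t] by (intro mult_mono) auto
        then show ?thesis
          using z(1) by simp
      qed
      moreover have "\<bar>- t + \<theta> n * \<Psi> n t\<bar> = \<bar>t - \<theta> n * \<Psi> n t\<bar>"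
        by (simp add: abs_if)
      then have "J n t = real (Suc n) * (\<theta> n * \<Psi> n t * (sgn z * \<bar>z\<bar> powr (q - 1)))"
        unfolding J_def using z(2) by simp
      then have "J n t = \<Psi> n t * (sgn z * \<bar>z\<bar> powr (q - 1))"
        using \<theta>(3)[of n] by (simp flip: mult.assoc)
      ultimately show ?thesis
        by blast
    qed
  \<comment> \<open>The intermediate point is chosen separately for each t. Measurability of the
    choice is not at stake, as the integrated function \<open>J n\<close> is given
    explicitly.\<close>
  define z where "z n t = (SOME z. \<bar>z - t\<bar> \<le> \<theta> n \<and> J n t = \<Psi> n t * (sgn z * \<bar>z\<bar> powr (q - 1)))" for n t
  have z: "\<bar>z n t - t\<bar> \<le> \<theta> n" "J n t = \<Psi> n t * (sgn (z n t) * \<bar>z n t\<bar> powr (q - 1))" for n t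
    using someI_ex[OF ex[of t n]] unfolding z_def by blast+
  have \<theta>lim: "\<theta> \<longlonglongrightarrow> 0"
    unfolding \<theta>_def[abs_def] by real_asymp
  have zlim: "(\<lambda>n. z n t) \<longlonglongrightarrow> t" for t
  proof -
    have "(\<lambda>n. z n t - t) \<longlonglongrightarrow> 0"
      by (rule Lim_null_comparison[OF _ \<theta>lim]) (use z(1) in auto)
    then show ?thesis
      by (simp add: LIM_zero_iff)
  qed
  have Jlim: "(\<lambda>n. J n t) \<longlonglongrightarrow> \<bar>t\<bar> powr (q - 1)" for t
  proof -
    have "(\<lambda>n. \<Psi> n t) \<longlonglongrightarrow> sgn t"
    proof -
      consider "t < 0" | "t = 0" | "0 < t" by linarith
      then show ?thesis
      proof cases
        case 1
        have "filterlim (\<lambda>n. real (Suc n) * t) at_bot sequentially"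
          using 1 by real_asymp
        then have "(\<lambda>n. tanh (real (Suc n) * t)) \<longlonglongrightarrow> -1"
          by (rule filterlim_compose[OF tanh_real_at_bot])
        then show ?thesis
          using 1 by (simp add: \<Psi>_def)
      next
        case 3
        have "filterlim (\<lambda>n. real (Suc n) * t) at_top sequentially"
          using 3 by real_asymp
        then have "(\<lambda>n. tanh (real (Suc n) * t)) \<longlonglongrightarrow> 1"
          by (rule filterlim_compose[OF tanh_real_at_top])
        then show ?thesis
          using 3 by (simp add: \<Psi>_def)
      qed (simp add: \<Psi>_def)
    qed
    moreover have "(\<lambda>n. sgn (z n t) * \<bar>z n t\<bar> powr (q - 1)) \<longlonglongrightarrow> sgn t * \<bar>t\<bar> powr (q - 1)"
      by (rule isCont_tendsto_compose[OF continuous_sgn_abs_powr zlim]) (use pq(1) in simp)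
    ultimately have "(\<lambda>n. J n t) \<longlonglongrightarrow> sgn t * (sgn t * \<bar>t\<bar> powr (q - 1))"
      unfolding z(2) by (rule tendsto_mult)
    then show ?thesis
      using pq(1) by (cases "t = 0") (auto simp: sgn_if split: if_splits)
  qed
  have Jcont: "continuous_on {-1..1} (J n)" for n
    unfolding J_def[abs_def] \<Psi>_def using pq(1)
    by (intro continuous_on_mult continuous_on_diff continuous_on_divide continuous_on_abs_powr continuous_on_add
        continuous_on_minus continuous_on_id continuous_on_const continuous_on_tanh) auto
  have "(\<lambda>n. integral {-1..1} (J n)) \<longlonglongrightarrow> integral {-1..1} (\<lambda>t. \<bar>t\<bar> powr (q - 1))"
  proof (rule dominated_convergence(2)[where h = "\<lambda>t. 2 powr (q - 1)"])
    show "J n integrable_on {-1..1}" for n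
      by (rule integrable_continuous_real[OF Jcont])
    show "norm (J n t) \<le> 2 powr (q - 1)" if "t \<in> {-1..1}" for n t
    proof -
      have "\<bar>z n t\<bar> \<le> 2"
        using z(1)[of n t] \<theta>(2)[of n] that by (auto simp: abs_le_iff)
      then have "\<bar>z n t\<bar> powr (q - 1) \<le> 2 powr (q - 1)"
        using pq(1) by (intro powr_mono2) auto
      then have "\<bar>\<Psi> n t\<bar> * (\<bar>sgn (z n t)\<bar> * \<bar>z n t\<bar> powr (q - 1)) \<le> 1 * (1 * 2 powr (q - 1))"
        using \<Psi>[of n t] by (intro mult_mono) (auto simp: abs_sgn_eq)
      then show ?thesis
        by (simp add: z(2) abs_mult)
    qed
    show "(\<lambda>n. J n t) \<longlonglongrightarrow> \<bar>t\<bar> powr (q - 1)" for t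
      by (rule Jlim)
  qed auto
  then show ?thesis
    unfolding integral_abs_powr_pred by (simp add: J_def[abs_def] \<theta>_def \<Psi>_def)
qed

text \<open>The upper half is the comparison with the slab. In the lower half \<theta> = 1/(n+1) is
  fixed so that the first variation exceeds 2 a \<theta>, next an approximant of
  \<open>slab_torsion\<close> is fixed, and finally k tends to infinity. What remains for large k is
  2 a \<theta> < M * 2 \<theta> with M the maximum, and \<theta> cancels. Convergence of the torsion
  functions themselves is never invoked.\<close>

lemma maximum_limit:
  assumes v: "\<And>k. 0 < k \<Longrightarrow> torsion_function F p (\<Omega> k) (v k)"
  shows "((\<lambda>k. maximum_on (\<Omega> k) (v k)) \<longlongrightarrow> 1 / q) at_top"
proof (rule order_tendstoI)
  fix a :: real
  assume "1 / q < a"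
  show "\<forall>\<^sub>F k in at_top. maximum_on (\<Omega> k) (v k) < a"
    using eventually_gt_at_top[of 0]
  proof eventually_elim
    case (elim k)
    obtain g where "weak_solution k (v k) g"
      using torsion_function_weak_solution[OF v[OF elim]] by blast
    then show ?case
      using maximum_bounds(2)[OF elim] \<open>1 / q < a\<close> by fastforce
  qed
next
  fix a :: real
  assume "a < 1 / q"
  then have "2 * a < 2 / q"
    by simp
  from order_tendstoD(1)[OF smoothed_variation_limit this]
  obtain n where n: "2 * a < real (Suc n) * integral {-1..1} (\<lambda>t. \<bar>t\<bar> powr q / q - \<bar>- t + 1 / real (Suc n) * tanh (real (Suc n) * t)\<bar> powr q / q)"
    using eventually_happens by fastforce
  define \<theta> where "\<theta> = 1 / real (Suc n)"
  have \<theta>: "0 < \<theta>" "\<theta> * real (Suc n) = 1"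
    by (auto simp: \<theta>_def)
  define m where "m t = - t + \<theta> * tanh (real (Suc n) * t)" for t
  define m' where "m' t = - 1 + (1 - tanh (real (Suc n) * t) ^ 2)" for t
  have m: "(m has_real_derivative m' t) (at t)" for t
  proof -
    have "(m has_real_derivative - 1 + \<theta> * ((1 - tanh (real (Suc n) * t) ^ 2) * real (Suc n))) (at t)"
      unfolding m_def[abs_def] by (auto intro!: derivative_eq_intros)
    then show ?thesis
      using \<theta>(2) by (simp add: m'_def mult_ac flip: mult.assoc)
  qed
  have m'_cont: "continuous_on UNIV m'"
    unfolding m'_def[abs_def] by (intro continuous_intros) auto
  have m_cont: "continuous_on S m" for S
    by (rule DERIV_continuous_on[OF DERIV_subset[OF m subset_UNIV]])
  have m'_nonneg: "0 \<le> m' t + 1" for t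
  proof -
    have "\<bar>tanh (real (Suc n) * t)\<bar> \<le> 1"
      using tanh_real_lt_1[of "real (Suc n) * t"] tanh_real_gt_neg1[of "real (Suc n) * t"] by (auto simp: abs_le_iff)
    then show ?thesis
      by (simp add: m'_def abs_square_le_1)
  qed
  \<comment> \<open>The weight \<open>m' + 1\<close> is the derivative of \<theta> tanh(t /
    \<theta>), so its mass is at most 2 \<theta>, whereas the gain in the remaining terms is about 2
    \<theta> / q. The ratio of the two is the value 1 / q to be reached.\<close>
  have m'_int: "integral {-1..1} (\<lambda>t. m' t + 1) \<le> 2 * \<theta>"
  proof -
    have "((\<lambda>t. m' t + 1) has_integral ((m 1 + 1) - (m (-1) + (-1)))) {-1..1}"
    proof (rule fundamental_theorem_of_calculus)
      show "((\<lambda>t. m t + t) has_vector_derivative m' t + 1) (at t within {-1..1})" for t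
        using DERIV_add[OF m DERIV_ident, of t]
        by (simp add: has_real_derivative_iff_has_vector_derivative has_vector_derivative_at_within)
    qed simp
    then have "integral {-1..1} (\<lambda>t. m' t + 1) = 2 * (\<theta> * tanh (real (Suc n)))"
      by (simp add: integral_unique m_def algebra_simps del: of_nat_Suc)
    also have "\<dots> \<le> 2 * (\<theta> * 1)"
      using \<theta>(1) tanh_real_lt_1[of "real (Suc n)"] by (intro mult_left_mono) auto
    finally show ?thesis by simp
  qed
  have n': "2 * a * \<theta> < integral {-1..1} (\<lambda>t. \<bar>t\<bar> powr q / q - \<bar>m t\<bar> powr q / q)"
  proof -
    define I where "I = integral {-1..1} (\<lambda>t. \<bar>t\<bar> powr q / q - \<bar>m t\<bar> powr q / q)"
    have "2 * a < real (Suc n) * I"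
      using n by (simp only: I_def m_def \<theta>_def)
    then have "2 * a * \<theta> < real (Suc n) * I * \<theta>"
      using \<theta>(1) by (rule mult_strict_right_mono)
    also have "real (Suc n) * I * \<theta> = I"
      using \<theta>(2) by (simp add: mult_ac flip: mult.assoc)
    finally show ?thesis
      by (simp add: I_def)
  qed
  obtain f L where f: "\<And>j::nat. smooth (f j)" "\<And>j. \<exists>r<1. \<forall>t. r \<le> \<bar>t\<bar> \<longrightarrow> f j t = 0"
    "\<And>j t. \<bar>deriv (f j) t\<bar> \<le> L" "\<And>t. -1 < t \<Longrightarrow> t < 1 \<Longrightarrow> (\<lambda>j. deriv (f j) t) \<longlonglongrightarrow> slab_torsion' t"
    "uniform_limit {-1..1} f slab_torsion sequentially"
    by (rule slab_torsion_approximation, (rule that; assumption))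
  define J where "J h h' t = h t - \<bar>h' t\<bar> powr p / p - \<bar>m t\<bar> powr q / q" for h h' :: "real \<Rightarrow> real" and t
  let ?I = "{-1<..<1::real}"
  have int_open: "integral {-1..1} h = integral ?I h" for h :: "real \<Rightarrow> real"
    by (simp add: integral_open_interval_real)
  have iob: "h integrable_on ?I" if "continuous_on {-1..1} h" for h :: "real \<Rightarrow> real"
    using that by (simp add: integrable_on_open_interval_real integrable_continuous_real)
  have fcont: "continuous_on A (f j)" "continuous_on A (deriv (f j))" for A j
    using smooth_continuous f(1) smooth_realD(2) by blast+
  have Jcont: "continuous_on {-1..1} (J h h')" if "continuous_on {-1..1} h" "continuous_on {-1..1} h'" for h h'
    unfolding J_def[abs_def] using p pq(1)
    by (intro continuous_on_diff continuous_on_divide continuous_on_abs_powr continuous_on_const that m_cont) auto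
  have "\<forall>\<^sub>F j in sequentially. \<forall>t\<in>{-1..1}. dist (f j t) (slab_torsion t) < 1"
    using f(5) by (simp add: uniform_limit_iff)
  then obtain n0 where n0: "\<forall>j\<ge>n0. \<forall>t\<in>{-1..1}. dist (f j t) (slab_torsion t) < 1"
    unfolding eventually_sequentially by blast
  define h where "h j = f (j + n0)" for j
  have "bounded (m ` {-1..1})"
    by (intro compact_imp_bounded compact_continuous_image m_cont compact_Icc)
  then obtain Bm where Bm: "\<forall>t\<in>{-1..1}. \<bar>m t\<bar> \<le> Bm"
    unfolding bounded_iff by auto
  have "(\<lambda>j. integral ?I (J (h j) (deriv (h j)))) \<longlonglongrightarrow> integral ?I (J slab_torsion slab_torsion')"
  proof (rule dominated_convergence(2)[where h = "\<lambda>t. (1 / q + 1) + L powr p / p + Bm powr q / q"])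
    show "J (h j) (deriv (h j)) integrable_on ?I" for j
      unfolding h_def by (intro iob Jcont fcont)
    show "norm (J (h j) (deriv (h j)) t) \<le> (1 / q + 1) + L powr p / p + Bm powr q / q" if t: "t \<in> ?I" for j t
    proof -
      have "dist (h j t) (slab_torsion t) < 1"
        using n0 t by (simp add: h_def)
      then have "\<bar>h j t\<bar> \<le> 1 / q + 1"
        using slab_torsion_bounds(1)[of t] slab_torsion_bounds(2)[of t] t by (auto simp: dist_real_def abs_le_iff)
      moreover have "\<bar>deriv (h j) t\<bar> powr p / p \<le> L powr p / p"
        using f(3)[of "j + n0" t] p by (intro divide_right_mono powr_mono2) (auto simp: h_def)
      moreover have "\<bar>m t\<bar> powr q / q \<le> Bm powr q / q"
        using Bm t pq(1) by (intro divide_right_mono powr_mono2) auto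
      moreover have "0 \<le> \<bar>deriv (h j) t\<bar> powr p / p" "0 \<le> \<bar>m t\<bar> powr q / q"
        using p pq(1) by auto
      ultimately show ?thesis
        unfolding J_def real_norm_def by linarith
    qed
    show "(\<lambda>j. J (h j) (deriv (h j)) t) \<longlonglongrightarrow> J slab_torsion slab_torsion' t" if t: "t \<in> ?I" for t
    proof -
      have "(\<lambda>j. h j t) \<longlonglongrightarrow> slab_torsion t"
        unfolding h_def using tendsto_uniform_limitI[OF f(5), of t] t by (intro LIMSEQ_ignore_initial_segment) auto
      moreover have "(\<lambda>j. deriv (h j) t) \<longlonglongrightarrow> slab_torsion' t"
        unfolding h_def using f(4)[of t] t by (intro LIMSEQ_ignore_initial_segment) auto
      ultimately show ?thesis
        unfolding J_def using p by (intro tendsto_intros) auto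
    qed
  qed (auto intro!: iob)
  then have "(\<lambda>j. integral {-1..1} (J (h j) (deriv (h j)))) \<longlonglongrightarrow> integral {-1..1} (J slab_torsion slab_torsion')"
    by (simp add: int_open)
  \<comment> \<open>By \<open>slab_torsion_energy\<close> only the effect of perturbing m is
    left.\<close>
  moreover have "2 * a * \<theta> < integral {-1..1} (J slab_torsion slab_torsion')"
  proof -
    have i: "(\<lambda>t. \<bar>m t\<bar> powr q / q) integrable_on {-1..1}" "(\<lambda>t. \<bar>t\<bar> powr q / q) integrable_on {-1..1::real}"
      "(\<lambda>t. slab_torsion t - \<bar>slab_torsion' t\<bar> powr p / p) integrable_on {-1..1}"
      using p pq(1)
      by (intro integrable_continuous_real continuous_on_diff continuous_on_divide continuous_on_abs_powr
          continuous_on_const continuous_on_id slab_torsion_continuous m_cont; simp)+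
    have "integral {-1..1} (J slab_torsion slab_torsion')
        = integral {-1..1} (\<lambda>t. \<bar>t\<bar> powr q / q) - integral {-1..1} (\<lambda>t. \<bar>m t\<bar> powr q / q)"
      unfolding J_def[abs_def] using i by (simp add: Henstock_Kurzweil_Integration.integral_diff slab_torsion_energy)
    also have "\<dots> = integral {-1..1} (\<lambda>t. \<bar>t\<bar> powr q / q - \<bar>m t\<bar> powr q / q)"
      using i by (simp add: Henstock_Kurzweil_Integration.integral_diff)
    finally show ?thesis
      using n' by simp
  qed
  ultimately have "\<forall>\<^sub>F j in sequentially. 2 * a * \<theta> < integral {-1..1} (J (h j) (deriv (h j)))"
    by (rule order_tendstoD)
  then obtain j where j: "2 * a * \<theta> < integral {-1..1} (J (h j) (deriv (h j)))"
    using eventually_happens by fastforce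
  obtain r where r: "r < 1" "\<And>t. r \<le> \<bar>t\<bar> \<Longrightarrow> h j t = 0"
    using f(2) unfolding h_def by blast
  have hs: "smooth (h j)"
    by (simp add: h_def f(1))
  obtain K where K: "\<And>k v g B. 0 < k \<Longrightarrow> weak_solution k v g \<Longrightarrow> AE x in lebesgue_on (\<Omega> k). v x \<le> B \<Longrightarrow>
    integral {-1..1} (\<lambda>t. h j t - \<bar>deriv (h j) t\<bar> powr p / p - \<bar>m t\<bar> powr q / q - B * (m' t + 1)) \<le> K / k"
    using torsion_lower_bound[OF hs r m m'_cont m'_nonneg] by blast
  define JJ where "JJ = integral {-1..1} (J (h j) (deriv (h j)))"
  have "((\<lambda>k. JJ - K / k) \<longlongrightarrow> JJ - 0) at_top"
    by (intro tendsto_intros real_tendsto_divide_at_top[OF tendsto_const] filterlim_ident)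
  then have "\<forall>\<^sub>F k in at_top. 2 * a * \<theta> < JJ - K / k"
    by (rule order_tendstoD) (use j in \<open>simp add: JJ_def\<close>)
  then show "\<forall>\<^sub>F k in at_top. a < maximum_on (\<Omega> k) (v k)"
    using eventually_gt_at_top[of 0]
  proof eventually_elim
    case (elim k)
    obtain g where ws: "weak_solution k (v k) g"
      using torsion_function_weak_solution[OF v[OF elim(2)]] by blast
    define M where "M = maximum_on (\<Omega> k) (v k)"
    note mb = maximum_bounds[OF elim(2) ws, folded M_def]
    have "integral {-1..1} (\<lambda>t. J (h j) (deriv (h j)) t - M * (m' t + 1)) \<le> K / k"
      using K[OF elim(2) ws mb(3)] by (simp add: J_def)
    moreover have "integral {-1..1} (\<lambda>t. J (h j) (deriv (h j)) t - M * (m' t + 1))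
        = JJ - M * integral {-1..1} (\<lambda>t. m' t + 1)"
    proof -
      have "continuous_on {-1..1} (J (h j) (deriv (h j)))" "continuous_on {-1..1} (\<lambda>t. M * (m' t + 1))"
        by (intro Jcont smooth_continuous hs smooth_realD(2))
          (intro continuous_on_mult continuous_on_add continuous_on_const continuous_on_subset[OF m'_cont] subset_UNIV)
      then show ?thesis
        unfolding JJ_def
        by (subst Henstock_Kurzweil_Integration.integral_diff) (auto intro!: integrable_continuous_real)
    qed
    moreover have "M * integral {-1..1} (\<lambda>t. m' t + 1) \<le> M * (2 * \<theta>)"
      by (intro mult_left_mono m'_int mb(1))
    ultimately have "2 * a * \<theta> < M * (2 * \<theta>)"
      using elim(1) by linarith
    then have "a < M"
      using \<theta>(1) by simp
    then show ?case
      by (simp add: M_def)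
  qed
qed

end

section \<open>Limits of the six ratios\<close>

lemma pi_p_pos: "1 < p \<Longrightarrow> 0 < pi_p p"
  using riccati[of p "p / (p - 1)"] by fastforce

text \<open>Each ingredient has a limit of its own: the inradius, the Cheeger constant and the
  quotient of perimeter and volume tend to 1, the eigenvalue to \<mu> =
  \<open>(pi_p p / 2) powr p\<close>, and the maximum to 1 / q. Both sides of every inequality thus
  tend to the same positive number.\<close>

theorem theorem5p8:
  fixes F :: "'a::euclidean_space \<Rightarrow> real" and p q \<beta> :: real
  assumes dim: "DIM('a) \<ge> 2"
    and p: "1 < p"
    and q: "q = p / (p - 1)"
    and F_nonneg: "\<And>\<xi>. 0 \<le> F \<xi>"
    and F_convex: "convex_on UNIV F"
    and F_homogeneous: "\<And>t \<xi>. F (t *\<^sub>R \<xi>) = \<bar>t\<bar> * F \<xi>"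
    and F_lower: "\<exists>a0>0. \<forall>\<xi>. a0 * norm \<xi> \<le> F \<xi>"
    and \<beta>: "0 < \<beta>" "\<beta> \<le> 1"
    and F_regular: "Ck_holder_on 3 \<beta> F (-{0})"
    and F_hessian: "\<And>\<xi> h. \<xi> \<noteq> 0 \<Longrightarrow> h \<noteq> 0 \<Longrightarrow> hessian (\<lambda>\<eta>. F \<eta> powr p) \<xi> h h > 0"
  shows "\<exists>a>0. \<exists>\<nu> :: nat \<Rightarrow> 'a. orthonormal_basis \<nu> \<and>
    (let \<Omega> = slab_box \<nu> a;
         R = (\<lambda>k. inradius F (\<Omega> k));
         h = (\<lambda>k. real_of_ereal (cheeger F (\<Omega> k)));
         P = (\<lambda>k. real_of_ereal (perimeter F (\<Omega> k)));
         V = (\<lambda>k. measure lebesgue (\<Omega> k));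
         l = (\<lambda>k. eigenvalue F p (\<Omega> k))
     in
       ((\<lambda>k. (1 / R k) / h k) \<longlongrightarrow> 1) at_top \<and>
       ((\<lambda>k. l k / ((pi_p p / 2) powr p * (P k / V k) powr p)) \<longlongrightarrow> 1) at_top \<and>
       ((\<lambda>k. l k / ((pi_p p / 2) powr p * h k powr p)) \<longlongrightarrow> 1) at_top \<and>
       ((\<lambda>k. l k / ((pi_p p / 2) powr p * (1 / R k powr p))) \<longlongrightarrow> 1) at_top \<and>
       (\<forall>v :: real \<Rightarrow> 'a \<Rightarrow> real. (\<forall>k>0. torsion_function F p (\<Omega> k) (v k)) \<longrightarrow>
          ((\<lambda>k. (((p - 1) / p) powr (p - 1) * (pi_p p / 2) powr p) /
                (l k * maximum_on (\<Omega> k) (v k) powr (p - 1))) \<longlongrightarrow> 1) at_top \<and>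
          ((\<lambda>k. maximum_on (\<Omega> k) (v k) / (R k powr q / q)) \<longlongrightarrow> 1) at_top))"
proof -
  obtain b where b: "bij_betw b {0..<DIM('a)} (Basis :: 'a set)"
    using ex_bij_betw_nat_finite[OF finite_Basis] by blast
  \<comment> \<open>The enumeration of \<open>Basis\<close> starts at 0, that of an
    \<open>orthonormal_basis\<close> at 1.\<close>
  define \<nu> where "\<nu> i = b (i - 1)" for i
  have \<nu>_basis: "\<nu> i \<in> Basis" if "i \<in> {1..DIM('a)}" for i
    using that bij_betw_apply[OF b, of "i - 1"] by (auto simp: \<nu>_def)
  have \<nu>_inj: "\<nu> i = \<nu> j \<longleftrightarrow> i = j" if "i \<in> {1..DIM('a)}" "j \<in> {1..DIM('a)}" for i j
  proof -
    have "\<nu> i = \<nu> j \<longleftrightarrow> i - 1 = j - 1"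
      unfolding \<nu>_def by (rule inj_on_eq_iff[OF bij_betw_imp_inj_on[OF b]]) (use that in auto)
    also have "\<dots> \<longleftrightarrow> i = j"
      using that by auto
    finally show ?thesis .
  qed
  have \<nu>_surj: "\<exists>i\<in>{1..DIM('a)}. x = \<nu> i" if "x \<in> Basis" for x
  proof -
    have "x \<in> b ` {0..<DIM('a)}"
      using that bij_betw_imp_surj_on[OF b] by simp
    then obtain i where "i < DIM('a)" "x = b i"
      by auto
    then show ?thesis
      by (intro bexI[of _ "Suc i"]) (auto simp: \<nu>_def)
  qed
  have image: "\<nu> ` {1..DIM('a)} = Basis"
    using \<nu>_basis \<nu>_surj by blast
  define e where "e = \<nu> 1"
  have e: "e \<in> Basis"
    unfolding e_def using dim by (intro \<nu>_basis) auto
  have orth: "orthonormal_basis \<nu>"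
    unfolding orthonormal_basis_def image using \<nu>_basis \<nu>_inj by (simp add: inner_Basis)
  have rest: "\<nu> ` {2..DIM('a)} = Basis - {e}"
  proof -
    have "\<nu> ` {2..DIM('a)} = \<nu> ` ({1..DIM('a)} - {1})"
      by (rule arg_cong[where f = "image \<nu>"]) auto
    also have "\<dots> = \<nu> ` {1..DIM('a)} - \<nu> ` {1}"
      by (rule inj_on_image_set_diff[of _ "{1..DIM('a)}"]) (use \<nu>_inj dim in \<open>auto simp: inj_on_def\<close>)
    finally show ?thesis
      unfolding image e_def by simp
  qed
  have reg: "F differentiable_on (-{0})" "\<And>b. b \<in> Basis \<Longrightarrow> (\<lambda>x. frechet_derivative F (at x) b) differentiable_on (-{0})"
    using F_regular by (simp_all add: numeral_3_eq_3)
  interpret anisotropy F p q e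
  proof
    show "F differentiable (at \<xi>)" if "\<xi> \<noteq> 0" for \<xi>
    proof -
      have "F differentiable (at \<xi> within -{0})"
        using reg(1) that unfolding differentiable_on_def by blast
      moreover have "at \<xi> within -{0} = at \<xi>"
        by (rule at_within_open[OF _ open_Compl[OF closed_singleton]]) (use that in simp)
      ultimately show ?thesis
        by (simp only:)
    qed
    show "continuous_on (-{0}) (gradient F)"
      unfolding gradient_def[abs_def]
      by (intro continuous_intros differentiable_imp_continuous_on reg(2))
  qed (use p q F_nonneg F_convex F_homogeneous F_lower e in auto)
  \<comment> \<open>The half-width a of the statement is taken to be \<open>c\<close>, the value of
    \<open>F\<close> at the slab normal.\<close>
  have \<Omega>_eq: "slab_box \<nu> c = \<Omega>"
  proof
    fix k
    have "x \<in> slab_box \<nu> c k \<longleftrightarrow> \<bar>x \<bullet> e\<bar> < c \<and> (\<forall>b\<in>\<nu> ` {2..DIM('a)}. \<bar>x \<bullet> b\<bar> < k)" for x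
      by (simp add: slab_box_def e_def)
    then show "slab_box \<nu> c k = \<Omega> k"
      using c_pos unfolding rest by (auto simp: mem_\<Omega> ht_def)
  qed
  define \<mu> where "\<mu> = (pi_p p / 2) powr p"
  have \<mu>: "0 < \<mu>"
    using pi_p_pos[OF p] by (simp add: \<mu>_def)
  have big: "\<forall>\<^sub>F k in at_top. 0 < k \<and> upper \<le> k"
    by (intro eventually_conj eventually_gt_at_top eventually_ge_at_top)
  have upper_lim: "((\<lambda>k. 1 + upper / k) \<longlongrightarrow> 1 + 0) at_top"
    by (intro tendsto_intros real_tendsto_divide_at_top[OF tendsto_const] filterlim_ident)
  have R: "((\<lambda>k. inradius F (\<Omega> k)) \<longlongrightarrow> 1) at_top"
    by (rule tendsto_eventually) (use big inradius_eq_1 in \<open>auto elim!: eventually_mono\<close>)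
  have h: "((\<lambda>k. real_of_ereal (cheeger F (\<Omega> k))) \<longlongrightarrow> 1) at_top"
  proof (rule tendsto_sandwich[OF _ _ tendsto_const])
    show "\<forall>\<^sub>F k in at_top. 1 \<le> real_of_ereal (cheeger F (\<Omega> k))"
      "\<forall>\<^sub>F k in at_top. real_of_ereal (cheeger F (\<Omega> k)) \<le> 1 + upper / k"
      using big by (eventually_elim, use cheeger_perimeter_bounds in \<open>force intro: order_trans\<close>)+
  qed (use upper_lim in simp)
  have PV: "((\<lambda>k. real_of_ereal (perimeter F (\<Omega> k)) / measure lebesgue (\<Omega> k)) \<longlongrightarrow> 1) at_top"
  proof (rule tendsto_sandwich[OF _ _ tendsto_const])
    show "\<forall>\<^sub>F k in at_top. 1 \<le> real_of_ereal (perimeter F (\<Omega> k)) / measure lebesgue (\<Omega> k)"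
      "\<forall>\<^sub>F k in at_top. real_of_ereal (perimeter F (\<Omega> k)) / measure lebesgue (\<Omega> k) \<le> 1 + upper / k"
      unfolding vol_def[symmetric]
      using big by (eventually_elim, use cheeger_perimeter_bounds in \<open>force intro: order_trans\<close>)+
  qed (use upper_lim in simp)
  have l: "((\<lambda>k. eigenvalue F p (\<Omega> k)) \<longlongrightarrow> \<mu>) at_top"
    unfolding \<mu>_def by (rule eigenvalue_limit)
  have limit_1: "((\<lambda>k. f k / g k) \<longlongrightarrow> 1) at_top"
    if "(f \<longlongrightarrow> L) at_top" "(g \<longlongrightarrow> L) at_top" "L \<noteq> 0" for f g :: "real \<Rightarrow> real" and L
    using tendsto_divide[OF that(1,2,3)] that(3) by simp
  have powr_1: "((\<lambda>k. f k powr s) \<longlongrightarrow> 1) at_top" if "(f \<longlongrightarrow> 1) at_top" for f :: "real \<Rightarrow> real" and s :: real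
    using tendsto_powr[OF that tendsto_const[of s]] by simp
  have \<mu>_1: "((\<lambda>k. \<mu> * f k) \<longlongrightarrow> \<mu>) at_top" if "(f \<longlongrightarrow> 1) at_top" for f :: "real \<Rightarrow> real"
    using tendsto_mult[OF tendsto_const[of \<mu>] that] by simp
  have inv_1: "((\<lambda>k. 1 / f k) \<longlongrightarrow> 1) at_top" if "(f \<longlongrightarrow> 1) at_top" for f :: "real \<Rightarrow> real"
    by (rule limit_1[OF tendsto_const that]) simp
  have torsion: "((\<lambda>k. (((p - 1) / p) powr (p - 1) * \<mu>) /
                (eigenvalue F p (\<Omega> k) * maximum_on (\<Omega> k) (v k) powr (p - 1))) \<longlongrightarrow> 1) at_top \<and>
          ((\<lambda>k. maximum_on (\<Omega> k) (v k) / (inradius F (\<Omega> k) powr q / q)) \<longlongrightarrow> 1) at_top"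
    if "\<forall>k>0. torsion_function F p (\<Omega> k) (v k)" for v
  proof
    have M: "((\<lambda>k. maximum_on (\<Omega> k) (v k)) \<longlongrightarrow> 1 / q) at_top"
      by (rule maximum_limit) (use that in blast)
    \<comment> \<open>With (p - 1) / p = 1 / q the constant side of (v) is seen to equal the limit
      of the other side.\<close>
    have pq': "(p - 1) / p = 1 / q" "0 < 1 / q"
      using p by (auto simp: q)
    have "((\<lambda>k. eigenvalue F p (\<Omega> k) * maximum_on (\<Omega> k) (v k) powr (p - 1)) \<longlongrightarrow> \<mu> * (1 / q) powr (p - 1)) at_top"
      by (intro tendsto_mult l tendsto_powr M tendsto_const) (use pq' in auto)
    then show "((\<lambda>k. (((p - 1) / p) powr (p - 1) * \<mu>) /
                (eigenvalue F p (\<Omega> k) * maximum_on (\<Omega> k) (v k) powr (p - 1))) \<longlongrightarrow> 1) at_top"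
      unfolding pq'(1) mult.commute[of "(1 / q) powr (p - 1)" \<mu>]
      by (rule limit_1[OF tendsto_const]) (use \<mu> pq' in auto)
    have "((\<lambda>k. inradius F (\<Omega> k) powr q / q) \<longlongrightarrow> 1 / q) at_top"
      by (intro tendsto_divide powr_1 R tendsto_const) (use pq' in auto)
    then show "((\<lambda>k. maximum_on (\<Omega> k) (v k) / (inradius F (\<Omega> k) powr q / q)) \<longlongrightarrow> 1) at_top"
      by (rule limit_1[OF M]) (use pq' in auto)
  qed
  show ?thesis
    unfolding Let_def
  proof (rule exI[of _ c], intro conjI exI[of _ \<nu>] c_pos orth, unfold \<Omega>_eq \<mu>_def[symmetric])
    show "((\<lambda>k. (1 / inradius F (\<Omega> k)) / real_of_ereal (cheeger F (\<Omega> k))) \<longlongrightarrow> 1) at_top"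
      by (rule limit_1[OF inv_1[OF R] h]) simp
    show "((\<lambda>k. eigenvalue F p (\<Omega> k) / (\<mu> * (real_of_ereal (perimeter F (\<Omega> k)) / measure lebesgue (\<Omega> k)) powr p)) \<longlongrightarrow> 1) at_top"
      by (rule limit_1[OF l \<mu>_1[OF powr_1[OF PV]]]) (use \<mu> in simp)
    show "((\<lambda>k. eigenvalue F p (\<Omega> k) / (\<mu> * real_of_ereal (cheeger F (\<Omega> k)) powr p)) \<longlongrightarrow> 1) at_top"
      by (rule limit_1[OF l \<mu>_1[OF powr_1[OF h]]]) (use \<mu> in simp)
    show "((\<lambda>k. eigenvalue F p (\<Omega> k) / (\<mu> * (1 / inradius F (\<Omega> k) powr p))) \<longlongrightarrow> 1) at_top"
      by (rule limit_1[OF l \<mu>_1[OF inv_1[OF powr_1[OF R]]]]) (use \<mu> in simp)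
    show "\<forall>v. (\<forall>k>0. torsion_function F p (\<Omega> k) (v k)) \<longrightarrow>
          ((\<lambda>k. (((p - 1) / p) powr (p - 1) * \<mu>) /
                (eigenvalue F p (\<Omega> k) * maximum_on (\<Omega> k) (v k) powr (p - 1))) \<longlongrightarrow> 1) at_top \<and>
          ((\<lambda>k. maximum_on (\<Omega> k) (v k) / (inradius F (\<Omega> k) powr q / q)) \<longlongrightarrow> 1) at_top"
      using torsion by blast
  qed
qed

end
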